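(* Fix $L>0$. There exists $\delta\in(0,1)$ with the following property. Let $\rho_0\in A_\delta\cap C([0,L])$. Then, as $h\to0$, $$J_h(\,\cdot\,;\rho_0)-\frac1{4h}d(\,\cdot\,,\rho_0)^2\longrightarrow \frac12E(\cdot)-\frac12E(\rho_0)\qquad\text{in the set }A_\delta,$$ in the sense of Gamma-convergence with respect to the narrow topology. That is: (1) (Lower bound) For each sequence $\rho^h\rightharpoonup\rho$ in $A_\delta$ (as $h\to0$), $$\liminf_{h\to0}\Bigl(J_h(\rho^h;\rho_0)-\frac1{4h}d(\rho^h,\rho_0)^2\Bigr)\ge\frac12E(\rho)-\frac12E(\rho_0).$$ (2) (Recovery sequence) For each $\rho\in A_\delta$ there exists a sequence $(\rho^h)\subset A_\delta$ with $\rho^h\rightharpoonup\rho$ such that $$\lim_{h\to0}\Bigl(J_h(\rho^h;\rho_0)-\frac1{4h}d(\rho^h,\rho_0)^2\Bigr)=\frac12E(\rho)-\frac12E(\rho_0).$$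
   Context: $\mathcal M_1(\mathbb R)$ and $\mathcal M_1(\mathbb R\times\mathbb R)$ denote the sets of Borel probability measures. A measure is identified with its Lebesgue density, and densities on $(0,L)$ are extended by zero to $\mathbb R$. The convergence $\rightharpoonup$ is narrow convergence (weak convergence of probability measures, in duality with continuous bounded functions). For $0<\delta<1$, $$A_\delta:=\Bigl\{\rho\in L^\infty(0,L):\int_0^L\rho=1\text{ and }\|\rho-L^{-1}\|_\infty<\delta\Bigr\}.$$ For $\rho_0,\rho\in\mathcal M_1(\mathbb R)$ let $\Gamma(\rho_0,\rho)$ be the set of $q\in\mathcal M_1(\mathbb R\times\mathbb R)$ with first marginal $\pi_0q=\rho_0$ and second marginal $\pi_1q=\rho$. The relative entropy is $H(q\,|\,p)=\int f\log f\,dp$ if $q\ll p$ with $f=dq/dp$, and $+\infty$ otherwise. For $h>0$ let $p_h(x,y)=(4\pi h)^{-1/2}e^{-(y-x)^2/4h}$, $q_0(dx,dy)=\rho_0(dx)p_h(x,y)\,dy$, and $$J_h(\rho;\rho_0):=\inf_{q\in\Gamma(\rho_0,\rho)}H(q\,|\,q_0).$$ The Wasserstein distance is given by $d(\rho_0,\rho_1)^2:=\inf_{\gamma\in\Gamma(\rho_0,\rho_1)}\int_{\mathbb R\times\mathbb R}(x-y)^2\,\gamma(d(x,y))$, and the entropy is $E(\rho):=\int_{\mathbb R}\rho\log\rho\,dx$ (with $0\log 0=0$). *)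

theory Defs
  imports "HOL-Probability.Probability" "HOL-Probability.Essential_Supremum"
begin

abbreviation M1 :: "'a::topological_space measure set" where
  "M1 \<equiv> space (prob_algebra borel)"

definition narrow_conv ::
    "('i \<Rightarrow> 'a::topological_space measure) \<Rightarrow> 'a measure \<Rightarrow> 'i filter \<Rightarrow> bool" where
  "narrow_conv \<mu> \<nu> F \<longleftrightarrow>
     (\<forall>f :: 'a \<Rightarrow> real. continuous_on UNIV f \<and> bounded (range f) \<longrightarrow>
        ((\<lambda>i. \<integral>x. f x \<partial>\<mu> i) \<longlongrightarrow> (\<integral>x. f x \<partial>\<nu>)) F)"

definition couplings :: "real measure \<Rightarrow> real measure \<Rightarrow> (real \<times> real) measure set" where
  "couplings \<mu> \<nu> = {q \<in> M1. distr q borel fst = \<mu> \<and> distr q borel snd = \<nu>}"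

text \<open>
  The integral of \<open>f log f\<close> is split into its positive and negative parts, so that it is
  \<open>\<infinity>\<close> when the positive part is not integrable. (The Bochner integral, and with it the
  library's \<open>KL_divergence\<close>, would be 0 there.) The negative part has finite integral whenever
  \<open>p\<close> is a finite measure.
\<close>

definition relative_entropy :: "'a measure \<Rightarrow> 'a measure \<Rightarrow> ereal" where
  "relative_entropy q p =
     (if absolutely_continuous p q then
        (let g = (\<lambda>z. enn2real (RN_deriv p q z) * ln (enn2real (RN_deriv p q z)))
         in enn2ereal (\<integral>\<^sup>+z. ennreal (g z) \<partial>p) - enn2ereal (\<integral>\<^sup>+z. ennreal (- g z) \<partial>p))
      else \<infinity>)"

definition heat_kernel :: "real \<Rightarrow> real \<Rightarrow> real \<Rightarrow> real" where
  "heat_kernel h x y = exp (- (y - x)\<^sup>2 / (4 * h)) / sqrt (4 * pi * h)"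

definition heat_joint :: "real \<Rightarrow> real measure \<Rightarrow> (real \<times> real) measure" where
  "heat_joint h \<mu> = density (\<mu> \<Otimes>\<^sub>M lborel) (\<lambda>(x, y). ennreal (heat_kernel h x y))"

definition J :: "real \<Rightarrow> real measure \<Rightarrow> real measure \<Rightarrow> ereal" where
  "J h \<nu> \<mu> = (INF q \<in> couplings \<mu> \<nu>. relative_entropy q (heat_joint h \<mu>))"

definition wasserstein_sq :: "real measure \<Rightarrow> real measure \<Rightarrow> ennreal" where
  "wasserstein_sq \<mu> \<nu> = (INF \<gamma> \<in> couplings \<mu> \<nu>. \<integral>\<^sup>+(x, y). ennreal ((x - y)\<^sup>2) \<partial>\<gamma>)"

text \<open>
  Elements of \<open>L\<^sup>\<infinity>(0,L)\<close> are represented by functions on the whole line of which only the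
  values on \<open>(0,L)\<close> matter; \<open>zero_ext\<close> is the extension by zero.
\<close>

definition Linf_norm :: "real \<Rightarrow> (real \<Rightarrow> real) \<Rightarrow> ereal" where
  "Linf_norm L f = esssup (restrict_space lborel {0<..<L}) (\<lambda>x. ereal \<bar>f x\<bar>)"

definition Linf :: "real \<Rightarrow> (real \<Rightarrow> real) set" where
  "Linf L = {f \<in> borel_measurable (restrict_space lborel {0<..<L}). Linf_norm L f < \<infinity>}"

definition A :: "real \<Rightarrow> real \<Rightarrow> (real \<Rightarrow> real) set" where
  "A L \<delta> = {\<rho> \<in> Linf L. (LINT x:{0<..<L}|lborel. \<rho> x) = 1 \<and> Linf_norm L (\<lambda>x. \<rho> x - 1 / L) < ereal \<delta>}"

definition zero_ext :: "real \<Rightarrow> (real \<Rightarrow> real) \<Rightarrow> real \<Rightarrow> real" where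
  "zero_ext L \<rho> x = (if x \<in> {0<..<L} then \<rho> x else 0)"

definition meas :: "real \<Rightarrow> (real \<Rightarrow> real) \<Rightarrow> real measure" where
  "meas L \<rho> = density lborel (\<lambda>x. ennreal (zero_ext L \<rho> x))"

text \<open>Used only for bounded densities supported in a bounded interval, where the Bochner integral exists.\<close>

definition entropy_fun :: "(real \<Rightarrow> real) \<Rightarrow> real" where
  "entropy_fun f = (LINT x|lborel. f x * ln (f x))"

definition scaled_gap :: "real \<Rightarrow> real \<Rightarrow> (real \<Rightarrow> real) \<Rightarrow> (real \<Rightarrow> real) \<Rightarrow> ereal" where
  "scaled_gap L h \<rho> \<rho>0 =
     J h (meas L \<rho>) (meas L \<rho>0)
       - ereal (1 / (4 * h)) * enn2ereal (wasserstein_sq (meas L \<rho>) (meas L \<rho>0))"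

end

theory Submission
  imports Defs
begin

text \<open>
  Let \<open>T\<close> be the monotone map that transports \<open>\<rho>0\<close> to \<open>\<rho>\<close>. Kantorovich potentials split
  the cost as \<open>(x - y)\<^sup>2 = \<phi> x + \<psi> y + 2 * \<Delta> x y\<close>, where \<open>\<Delta> x y = U x + V y - x * y\<close> is nonnegative
  and vanishes on the graph of \<open>T\<close>; the separable part integrates to the squared Wasserstein distance
  against every coupling. Subtracting \<open>d\<^sup>2 / 4h\<close> therefore replaces the heat kernel by the kernel
  \<open>exp (- \<Delta> / 2h) / sqrt (4 \<pi> h)\<close>, which concentrates on the graph of \<open>T\<close>. Near a point of the graph
  \<open>\<Delta>\<close> is close to \<open>(y - T x)\<^sup>2 / (2 * T' x)\<close>, and the Gaussian normalisation
  \<open>sqrt (T') = sqrt (\<rho>0 / \<rho>)\<close> is where the two halves of the entropies come from.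

  Lower bound. The entropy inequality \<open>H q p \<ge> \<integral>f dq - ln (\<integral>exp f dp)\<close> is applied with
  \<open>f = (\<phi> + \<psi>) / 4h - ln \<rho>0 / 2 + ln \<sigma> / 2\<close>, where \<open>\<sigma>\<close> is a fixed continuous function close to the
  limit density. Because \<open>\<sigma>\<close> is fixed, narrow convergence handles \<open>\<integral>ln \<sigma> d\<rho>\<^sup>h\<close>, and it remains to see
  that \<open>\<integral>\<integral>sqrt (\<rho>0 x * \<sigma> y) * exp (- \<Delta> / 2h) / sqrt (4 \<pi> h)\<close> is asymptotically at most
  \<open>(\<integral>\<rho>0 + \<integral>\<sigma>) / 2\<close>, uniformly in the densities \<open>\<rho>\<^sup>h\<close>, which may oscillate at the scale
  \<open>sqrt h\<close> of the kernel (lemma \<open>kernel_mass_le\<close>). No expansion of \<open>\<Delta>\<close> is available there. What is true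
  (lemma \<open>line_integral_le\<close>) is that, once \<open>T\<close> is scaled to have slopes close to one, the integral of
  the kernel along every line \<open>x + y = const\<close> is at most its value for \<open>T = id\<close>. The reason is
  d'Alembert's formula for \<open>\<Delta>\<close>, whose mixed derivative is constant, together with a nonlinear Gaussian
  Poincare inequality (lemma \<open>damped_cosh_integral\<close>); closeness of the slopes to one, hence the small
  \<open>\<delta>\<close>, gives the room that this inequality needs.

  Upper bound. The constant sequence is a recovery sequence. In mass coordinates (the distribution
  functions) a coupling is a doubly stochastic kernel on an interval. The interval is cut into blocks, and
  on each block the kernel is a truncated Gaussian, reflected at the ends of the block, whose variance
  is \<open>h\<close> times a constant adapted to the two densities there (lemma \<open>gap_le_blocks\<close>). Its entropy and
  its transport cost can be evaluated up to boundary terms of order \<open>sqrt h\<close>; refining the blocks after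
  letting \<open>h\<close> tend to zero gives the entropies (lemma \<open>gap_limsup\<close>).
\<close>

section \<open>A damped Gaussian inequality on the half-line\<close>

lemma abs_mult_le_from_squares:
  fixes a b x :: real
  assumes "0 \<le> a" "0 \<le> b" "x\<^sup>2 \<le> 4 * a * b"
  shows "\<bar>x\<bar> \<le> a + b"
proof -
  have "(a + b)\<^sup>2 = (a - b)\<^sup>2 + 4 * a * b" by (simp add: power2_eq_square algebra_simps)
  hence "\<bar>x\<bar>\<^sup>2 \<le> (a + b)\<^sup>2"
    using assms(3) zero_le_power2[of "a - b"] unfolding power2_abs by linarith
  thus ?thesis using assms by (meson add_nonneg_nonneg power2_le_imp_le)
qed

text \<open>
  With \<open>f = cosh F - 1\<close> one has \<open>sinh\<^sup>2 F \<le> 2 f cosh F\<close>, so the cross term \<open>sinh F * e * \<eta>\<close> is absorbed by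
  \<open>2 \<eta>\<^sup>2 f\<close>, which the Riccati inequality for \<open>\<eta>\<close> provides, together with \<open>e\<^sup>2 cosh F / 4\<close>, which the
  damping factor provides as long as \<open>e\<close> is at most one. For larger \<open>e\<close> the damping factor is at most
  \<open>7/10\<close>, and the cross term is at most \<open>3/10 * cosh F\<close> by hypothesis.
\<close>

lemma damped_cosh_pointwise:
  fixes F e v \<eta> \<eta>' \<kappa> :: real
  assumes ric: "v * \<eta> - \<eta>' \<ge> 1 + 2 * \<eta>\<^sup>2" and k: "\<kappa> \<ge> 9/10"
    and small: "\<bar>e\<bar> \<le> 1 \<or> \<bar>e * \<eta>\<bar> \<le> 3/10"
  shows "exp (- (\<kappa> * e\<^sup>2 / 2)) * cosh F - 1
           \<le> (cosh F - 1) * (v * \<eta> - \<eta>') - sinh F * e * \<eta>"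
proof -
  define f where "f = cosh F - 1"
  have f0: "f \<ge> 0" using cosh_real_ge_1[of F] by (simp add: f_def)
  have c0: "cosh F \<ge> 1" by (rule cosh_real_ge_1)
  have A: "exp (- (\<kappa> * e\<^sup>2 / 2)) \<le> exp (- (9/20 * e\<^sup>2))"
    using mult_right_mono[OF k, of "e\<^sup>2"] zero_le_power2[of e] unfolding exp_le_cancel_iff by linarith
  have fr: "f * (v * \<eta> - \<eta>') \<ge> f + 2 * \<eta>\<^sup>2 * f"
    using mult_left_mono[OF ric f0] by (simp add: algebra_simps)
  consider "\<bar>e\<bar> \<le> 1" | "\<bar>e\<bar> > 1" "\<bar>e * \<eta>\<bar> \<le> 3/10" using small by linarith
  thus ?thesis
  proof cases
    case 1
    define q where "q = e\<^sup>2"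
    have q: "0 \<le> q" "q \<le> 1" using 1 by (auto simp: q_def abs_square_le_1)
    have "1 + 9/20 * q \<le> exp (9/20 * q)" by (rule exp_ge_add_one_self)
    hence "exp (- (9/20 * q)) \<le> 1 / (1 + 9/20 * q)"
      using q by (simp add: exp_minus field_simps)
    also have "\<dots> \<le> 1 - q / 4"
    proof -
      have "1 \<le> (1 - q / 4) * (1 + 9/20 * q)"
        using mult_nonneg_nonneg[OF q(1), of "1 - q"] q by (simp add: algebra_simps)
      thus ?thesis using q by (simp add: divide_le_eq)
    qed
    finally have B: "exp (- (\<kappa> * e\<^sup>2 / 2)) \<le> 1 - e\<^sup>2 / 4" using A unfolding q_def by linarith
    have "exp (- (\<kappa> * e\<^sup>2 / 2)) * cosh F \<le> (1 - e\<^sup>2 / 4) * cosh F"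
      using B c0 by (intro mult_right_mono) auto
    moreover have "\<bar>sinh F * e * \<eta>\<bar> \<le> 2 * \<eta>\<^sup>2 * f + e\<^sup>2 * cosh F / 4"
    proof (rule abs_mult_le_from_squares)
      show "0 \<le> 2 * \<eta>\<^sup>2 * f" "0 \<le> e\<^sup>2 * cosh F / 4" using f0 c0 by auto
      have "(sinh F)\<^sup>2 = f * (f + 2)"
        using cosh_square_eq[of F] by (simp add: f_def power2_eq_square algebra_simps)
      also have "\<dots> \<le> f * (2 * cosh F)" using f0 c0 by (intro mult_left_mono) (auto simp: f_def)
      finally have "(sinh F)\<^sup>2 * (e * \<eta>)\<^sup>2 \<le> f * (2 * cosh F) * (e * \<eta>)\<^sup>2"
        by (intro mult_right_mono) auto
      thus "(sinh F * e * \<eta>)\<^sup>2 \<le> 4 * (2 * \<eta>\<^sup>2 * f) * (e\<^sup>2 * cosh F / 4)"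
        by (simp add: power_mult_distrib algebra_simps)
    qed
    ultimately show ?thesis using fr unfolding f_def[symmetric] by (simp add: f_def algebra_simps)
  next
    case 2
    have "e\<^sup>2 \<ge> 1" using 2(1) by (metis abs_le_square_iff abs_one less_imp_le one_power2 power2_abs)
    hence "exp (- (\<kappa> * e\<^sup>2 / 2)) \<le> exp (- (9/20))"
      using A by (intro order_trans[OF A]) simp
    also have "\<dots> \<le> 7/10"
      using exp_ge_add_one_self[of "9/20"] by (simp add: exp_minus field_simps)
    finally have "exp (- (\<kappa> * e\<^sup>2 / 2)) * cosh F \<le> 7/10 * cosh F"
      using c0 by (intro mult_right_mono) auto
    moreover have "sinh F * e * \<eta> \<le> 3/10 * cosh F"
    proof -
      have "\<bar>sinh F\<bar> \<le> cosh F"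
        by (metis sinh_real_abs cosh_real_abs sinh_less_cosh_real less_imp_le)
      hence "\<bar>sinh F * (e * \<eta>)\<bar> \<le> cosh F * (3/10)"
        unfolding abs_mult using 2(2) c0 by (intro mult_mono) (auto simp: abs_mult)
      thus ?thesis by (simp add: mult.assoc abs_le_iff)
    qed
    moreover have "f \<le> f * (v * \<eta> - \<eta>')"
      using f0 by (intro order_trans[OF _ fr]) simp
    moreover have "cosh F = f + 1" by (simp add: f_def)
    ultimately show ?thesis unfolding f_def[symmetric] by linarith
  qed
qed

text \<open>
  Up to the Gaussian weight, the right-hand side of the pointwise inequality is the derivative of
  \<open>- (cosh F - 1) * \<eta> * exp (- v\<^sup>2 / 2)\<close>; integrating it leaves boundary terms only.
\<close>

lemma damped_cosh_piece:
  fixes F e \<eta> \<eta>' :: "real \<Rightarrow> real"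
  assumes ab: "a \<le> b" and k: "\<kappa> \<ge> 9/10"
    and dF: "\<And>v. (F has_real_derivative e v) (at v)" and ce: "continuous_on UNIV e"
    and dn: "\<And>v. v \<in> {a..b} \<Longrightarrow> (\<eta> has_real_derivative \<eta>' v) (at v)"
    and ric: "\<And>v. v \<in> {a..b} \<Longrightarrow> v * \<eta> v - \<eta>' v \<ge> 1 + 2 * (\<eta> v)\<^sup>2"
    and small: "\<And>v. v \<in> {a..b} \<Longrightarrow> \<bar>e v\<bar> \<le> 1 \<or> \<bar>e v * \<eta> v\<bar> \<le> 3/10"
  shows "integral {a..b} (\<lambda>v. exp (- (v\<^sup>2 / 2)) * (exp (- (\<kappa> * (e v)\<^sup>2 / 2)) * cosh (F v) - 1))
     \<le> (cosh (F a) - 1) * \<eta> a * exp (- (a\<^sup>2 / 2)) - (cosh (F b) - 1) * \<eta> b * exp (- (b\<^sup>2 / 2))"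
proof -
  define W where "W v = - ((cosh (F v) - 1) * \<eta> v * exp (- (v\<^sup>2 / 2)))" for v
  define w where "w v = exp (- (v\<^sup>2 / 2)) * ((cosh (F v) - 1) * (v * \<eta> v - \<eta>' v) - sinh (F v) * e v * \<eta> v)" for v
  have cF: "continuous_on S F" for S
    by (meson DERIV_isCont continuous_at_imp_continuous_on dF)
  have ce': "continuous_on S e" for S using ce continuous_on_subset by blast
  have "(W has_real_derivative w v) (at v)" if "v \<in> {a..b}" for v
    unfolding W_def w_def
    by (rule derivative_eq_intros dF dn that refl | simp)+ (simp add: algebra_simps)
  hence "(w has_integral (W b - W a)) {a..b}"
    using ab by (intro fundamental_theorem_of_calculus)
      (auto simp flip: has_real_derivative_iff_has_vector_derivative intro: has_field_derivative_at_within)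
  moreover have I: "(\<lambda>v. exp (- (v\<^sup>2 / 2)) * (exp (- (\<kappa> * (e v)\<^sup>2 / 2)) * cosh (F v) - 1)) integrable_on {a..b}"
    by (intro integrable_continuous_real continuous_intros cF ce') simp_all
  ultimately have "integral {a..b} (\<lambda>v. exp (- (v\<^sup>2 / 2)) * (exp (- (\<kappa> * (e v)\<^sup>2 / 2)) * cosh (F v) - 1)) \<le> W b - W a"
  proof (intro has_integral_le[OF integrable_integral[OF I], of w])
    fix v assume v: "v \<in> {a..b}"
    show "exp (- (v\<^sup>2 / 2)) * (exp (- (\<kappa> * (e v)\<^sup>2 / 2)) * cosh (F v) - 1) \<le> w v"
      unfolding w_def using damped_cosh_pointwise[OF ric[OF v] k small[OF v]] by (intro mult_left_mono) auto
  qed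
  thus ?thesis by (simp add: W_def)
qed

text \<open>
  A nonlinear form of the Gaussian Poincare inequality. If \<open>F\<close> is linear, \<open>F v = c v\<close>, the two sides agree on
  \<open>[0, \<infinity>)\<close> for \<open>\<kappa> = 1\<close>; a second zero of \<open>F\<close> excludes this case and makes room for \<open>\<kappa> < 1\<close>.
  The weights are \<open>\<eta> = g' / (2 g)\<close> with \<open>g v = 2/5 - (v - 3/5)\<^sup>2\<close> up to the zero \<open>6/5\<close> and
  \<open>g v = v\<^sup>2 - 1\<close>, the second Hermite polynomial, after it. They do not match at \<open>6/5\<close>, but the boundary
  terms there vanish with \<open>F\<close>.
\<close>

lemma damped_cosh_integral:
  fixes F e :: "real \<Rightarrow> real"
  assumes k: "\<kappa> \<ge> 9/10"
    and dF: "\<And>v. (F has_real_derivative e v) (at v)"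
    and lip: "\<And>v w. \<bar>e v - e w\<bar> \<le> 1/20 * \<bar>v - w\<bar>"
    and F0: "F 0 = 0" and Fa: "F (6/5) = 0" and R: "R \<ge> 6/5"
  shows "integral {0..R} (\<lambda>v. exp (- (v\<^sup>2 / 2)) * (exp (- (\<kappa> * (e v)\<^sup>2 / 2)) * cosh (F v)))
         \<le> integral {0..R} (\<lambda>v. exp (- (v\<^sup>2 / 2)))"
proof -
  let ?g = "\<lambda>v::real. exp (- (v\<^sup>2 / 2))"
  let ?G = "\<lambda>v. ?g v * (exp (- (\<kappa> * (e v)\<^sup>2 / 2)) * cosh (F v) - 1)"
  have ce: "continuous_on UNIV e"
  proof -
    have "(1/20)-lipschitz_on UNIV e"
      by (rule lipschitz_onI) (use lip in \<open>auto simp: dist_real_def\<close>)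
    thus ?thesis by (rule lipschitz_on_continuous_on)
  qed
  have ce': "continuous_on S e" for S using ce continuous_on_subset by blast
  have cF: "continuous_on S F" for S
    by (meson DERIV_isCont continuous_at_imp_continuous_on dF)
  obtain \<xi> where xi: "0 < \<xi>" "\<xi> < 6/5" "e \<xi> = 0"
  proof -
    have "\<exists>z>0. z < 6/5 \<and> DERIV F z :> 0"
    proof -
      have "F (6/5) = F 0" using F0 Fa by simp
      from Rolle_deriv[of 0 "6/5" F] this obtain z where "0<z" "z<6/5" "deriv F z = 0"
        using cF dF by (metis (no_types, lifting) Rolle DERIV_imp_deriv dF real_differentiable_def divide_pos_pos zero_less_numeral)
      thus ?thesis using dF by (metis DERIV_imp_deriv)
    qed
    then obtain z where z: "z>0" "z < 6/5" "DERIV F z :> 0" by blast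
    have "e z = 0" using DERIV_unique[OF dF z(3)] .
    thus ?thesis using that z by blast
  qed
  have eb: "\<bar>e v\<bar> \<le> 1/20 * \<bar>v - \<xi>\<bar>" for v using lip[of v \<xi>] xi by simp
  have I1: "integral {0..6/5} ?G \<le> 0"
  proof -
    define \<eta> where "\<eta> v = (3/5 - v) / (2/5 - (v - 3/5)\<^sup>2)" for v :: real
    define \<eta>' where "\<eta>' v = - (2/5 + (v - 3/5)\<^sup>2) / (2/5 - (v - 3/5)\<^sup>2)\<^sup>2" for v :: real
    have pos: "2/5 - (v - 3/5)\<^sup>2 > 0" if "v \<in> {0..6/5}" for v :: real
    proof -
      have "\<bar>v - 3/5\<bar> \<le> 3/5" using that unfolding atLeastAtMost_iff by linarith
      hence "(v - 3/5)\<^sup>2 \<le> (3/5)\<^sup>2" by (metis abs_ge_zero power2_abs power_mono)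
      thus ?thesis by (simp add: power2_eq_square)
    qed
    have "integral {0..6/5} ?G \<le> (cosh (F 0) - 1) * \<eta> 0 * ?g 0 - (cosh (F (6/5)) - 1) * \<eta> (6/5) * ?g (6/5)"
    proof (rule damped_cosh_piece[OF _ k dF ce, where \<eta>' = \<eta>'])
      fix v :: real assume v: "v \<in> {0..6/5}"
      note p = pos[OF v]
      define t where "t = v - 3/5"
      define d where "d = 2/5 - t\<^sup>2"
      have d: "d > 0" using p by (simp add: d_def t_def)
      show "(\<eta> has_real_derivative \<eta>' v) (at v)"
        unfolding \<eta>_def
      proof (rule DERIV_cong)
        show "((\<lambda>v. (3/5 - v) / (2/5 - (v - 3/5)\<^sup>2)) has_real_derivative
          (- (2/5 - (v - 3/5)\<^sup>2) - (3/5 - v) * - (2 * (v - 3/5))) / (2/5 - (v - 3/5)\<^sup>2)\<^sup>2) (at v)"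
          using p by (auto intro!: derivative_eq_intros simp: power2_eq_square)
        show "(- (2/5 - (v - 3/5)\<^sup>2) - (3/5 - v) * - (2 * (v - 3/5))) / (2/5 - (v - 3/5)\<^sup>2)\<^sup>2 = \<eta>' v"
          unfolding \<eta>'_def by (rule arg_cong2[where f = "(/)"]) (simp_all add: power2_eq_square algebra_simps)
      qed
      have e1: "\<eta> v = - t / d" "\<eta>' v = - (2/5 + t\<^sup>2) / d\<^sup>2" by (simp_all add: \<eta>_def \<eta>'_def t_def d_def)
      have "v * \<eta> v - \<eta>' v - 2 * (\<eta> v)\<^sup>2 = (- v * t * d + (2/5 + t\<^sup>2) - 2 * t\<^sup>2) / d\<^sup>2"
        unfolding e1 using d by (simp add: field_simps power2_eq_square)
      also have "- v * t * d + (2/5 + t\<^sup>2) - 2 * t\<^sup>2 = (1 - v * t) * d"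
      proof -
        have "(2/5 + t\<^sup>2) - 2 * t\<^sup>2 = d" by (simp add: d_def)
        thus ?thesis by (simp add: algebra_simps)
      qed
      also have "(1 - v * t) * d / d\<^sup>2 = (1 - v * t) / d" using d by (simp add: power2_eq_square)
      also have "\<dots> \<ge> 1"
      proof -
        have "1 - v * t - d = 3/5 * (1 - t)" by (simp add: d_def t_def power2_eq_square algebra_simps)
        moreover have "1 - t \<ge> 0" using v by (simp add: t_def)
        ultimately have "0 \<le> 1 - v * t - d" by simp
        hence "d \<le> 1 - v * t" by simp
        thus ?thesis using d by simp
      qed
      finally show "v * \<eta> v - \<eta>' v \<ge> 1 + 2 * (\<eta> v)\<^sup>2" by simp
      have "\<bar>e v\<bar> \<le> 1" using eb[of v] v xi by (auto simp: abs_if split: if_splits)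
      thus "\<bar>e v\<bar> \<le> 1 \<or> \<bar>e v * \<eta> v\<bar> \<le> 3/10" ..
    qed simp
    thus ?thesis by (simp add: F0 Fa)
  qed
  have I2: "integral {6/5..R} ?G \<le> 0"
  proof -
    define \<eta> where "\<eta> v = v / (v\<^sup>2 - 1)" for v :: real
    define \<eta>' where "\<eta>' v = - (v\<^sup>2 + 1) / (v\<^sup>2 - 1)\<^sup>2" for v :: real
    have sq: "v\<^sup>2 \<ge> 36/25" if "v \<ge> 6/5" for v :: real
      using power_mono[OF that, of 2] by (simp add: power2_eq_square)
    have "integral {6/5..R} ?G \<le> (cosh (F (6/5)) - 1) * \<eta> (6/5) * ?g (6/5) - (cosh (F R) - 1) * \<eta> R * ?g R"
    proof (rule damped_cosh_piece[OF R k dF ce, where \<eta>' = \<eta>'])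
      fix v :: real assume v: "v \<in> {6/5..R}"
      have v2: "v\<^sup>2 \<ge> 36/25" using sq v by auto
      define d where "d = v\<^sup>2 - 1"
      have d: "d > 0" using v2 by (simp add: d_def)
      show "(\<eta> has_real_derivative \<eta>' v) (at v)"
        unfolding \<eta>_def \<eta>'_def using v2
        by (auto intro!: derivative_eq_intros simp: field_simps power2_eq_square)
      have e1: "\<eta> v = v / d" "\<eta>' v = - (v\<^sup>2 + 1) / d\<^sup>2" by (simp_all add: \<eta>_def \<eta>'_def d_def)
      have "v * \<eta> v - \<eta>' v - 2 * (\<eta> v)\<^sup>2 = (v\<^sup>2 * d + (v\<^sup>2 + 1) - 2 * v\<^sup>2) / d\<^sup>2"
        unfolding e1 using d by (simp add: field_simps power2_eq_square)
      also have "v\<^sup>2 * d + (v\<^sup>2 + 1) - 2 * v\<^sup>2 = d\<^sup>2"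
        by (simp add: d_def power2_eq_square algebra_simps)
      finally show "v * \<eta> v - \<eta>' v \<ge> 1 + 2 * (\<eta> v)\<^sup>2" using d by simp
      have "\<bar>e v\<bar> \<le> 1/20 * v" using eb[of v] v xi by auto
      hence "\<bar>e v * \<eta> v\<bar> \<le> 1/20 * v * (v / d)"
        unfolding abs_mult e1 using d v by (intro mult_mono) auto
      also have "\<dots> \<le> 3/10" using v2 d by (simp add: d_def field_simps power2_eq_square)
      finally show "\<bar>e v\<bar> \<le> 1 \<or> \<bar>e v * \<eta> v\<bar> \<le> 3/10" ..
    qed
    also have "\<dots> \<le> 0"
      using sq[OF R] cosh_real_ge_1[of "F R"] R
      by (auto simp: Fa \<eta>_def)
    finally show ?thesis .
  qed
  have intG: "?G integrable_on S" if "S = {x..y}" for S x y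
    unfolding that by (intro integrable_continuous_real continuous_intros cF ce') simp_all
  have "integral {0..R} ?G = integral {0..6/5} ?G + integral {6/5..R} ?G"
    using R by (intro Henstock_Kurzweil_Integration.integral_combine[symmetric] intG[OF refl]) auto
  hence "integral {0..R} ?G \<le> 0" using I1 I2 by linarith
  moreover have "integral {0..R} ?G = integral {0..R} (\<lambda>v. ?g v * (exp (- (\<kappa> * (e v)\<^sup>2 / 2)) * cosh (F v)))
      - integral {0..R} ?g"
    unfolding right_diff_distrib mult_1_right
    by (intro Henstock_Kurzweil_Integration.integral_diff integrable_continuous_real continuous_intros cF ce') simp_all
  ultimately show ?thesis by simp
qed

section \<open>Gaussian bound along a line\<close>

lemma borel_measurable_cosh [measurable (raw)]:
  fixes f :: "'a \<Rightarrow> real"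
  assumes "f \<in> borel_measurable M" shows "(\<lambda>x. cosh (f x)) \<in> borel_measurable M"
  using assms unfolding cosh_def by simp

lemma half_line_gaussian:
  "(\<integral>\<^sup>+v. ennreal (exp (- (v\<^sup>2 / 2))) * indicator {0..} v \<partial>lborel) = ennreal (sqrt (pi / 2))"
proof -
  have "(\<integral>\<^sup>+x. ennreal (indicator {0..} x *\<^sub>R exp (- x\<^sup>2)) \<partial>lborel) = ennreal (sqrt pi / 2)"
    using gaussian_moment_0 by (intro nn_integral_eq_integral[THEN trans])
      (auto simp: has_bochner_integral_iff)
  also have "(\<integral>\<^sup>+x. ennreal (indicator {0..} x *\<^sub>R exp (- x\<^sup>2)) \<partial>lborel)
     = \<bar>1 / sqrt 2\<bar> * (\<integral>\<^sup>+x. ennreal (indicator {0..} (0 + 1 / sqrt 2 * x) *\<^sub>R exp (- (0 + 1 / sqrt 2 * x)\<^sup>2)) \<partial>lborel)"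
    by (rule nn_integral_real_affine) auto
  also have "(\<integral>\<^sup>+x. ennreal (indicator {0..} (0 + 1 / sqrt 2 * x) *\<^sub>R exp (- (0 + 1 / sqrt 2 * x)\<^sup>2)) \<partial>lborel)
     = (\<integral>\<^sup>+v. ennreal (exp (- (v\<^sup>2 / 2))) * indicator {0..} v \<partial>lborel)" (is "_ = ?I")
    by (intro nn_integral_cong) (auto simp: indicator_def zero_le_divide_iff power_divide)
  finally have "ennreal (1 / sqrt 2) * ?I = ennreal (sqrt pi / 2)" by simp
  hence "ennreal (sqrt 2) * (ennreal (1 / sqrt 2) * ?I) = ennreal (sqrt 2) * ennreal (sqrt pi / 2)" by simp
  moreover have "ennreal (sqrt 2) * (ennreal (1 / sqrt 2) * ?I) = ?I"
    by (simp add: mult.assoc[symmetric] ennreal_mult[symmetric])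
  moreover have "sqrt 2 * (sqrt pi / 2) = sqrt (pi / 2)"
    by (simp add: real_sqrt_divide real_div_sqrt field_simps)
  ultimately show ?thesis by (simp add: ennreal_mult[symmetric])
qed

lemma nn_integral_symmetrise:
  fixes g :: "real \<Rightarrow> ennreal"
  assumes [measurable]: "g \<in> borel_measurable borel"
  shows "(\<integral>\<^sup>+v. g v \<partial>lborel) = (\<integral>\<^sup>+v. (g v + g (- v)) * indicator {0..} v \<partial>lborel)"
proof -
  have "(\<integral>\<^sup>+v. g v \<partial>lborel) = (\<integral>\<^sup>+v. g v * indicator {0..} v + g v * indicator {..<0} v \<partial>lborel)"
    by (intro nn_integral_cong) (auto simp: indicator_def)
  also have "\<dots> = (\<integral>\<^sup>+v. g v * indicator {0..} v \<partial>lborel) + (\<integral>\<^sup>+v. g v * indicator {..<0} v \<partial>lborel)"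
    by (intro nn_integral_add) auto
  also have "(\<integral>\<^sup>+v. g v * indicator {..<0} v \<partial>lborel) = (\<integral>\<^sup>+v. g (-v) * indicator {..<0} (-v) \<partial>lborel)"
    by (subst nn_integral_real_affine[where c = "-1" and t = 0]) auto
  also have "\<dots> = (\<integral>\<^sup>+v. g (-v) * indicator {0..} v \<partial>lborel)"
    by (intro nn_integral_cong_AE AE_I[where N = "{0}"]) (auto simp: indicator_def)
  also have "(\<integral>\<^sup>+v. g v * indicator {0..} v \<partial>lborel) + \<dots> = (\<integral>\<^sup>+v. (g v + g (- v)) * indicator {0..} v \<partial>lborel)"
    by (subst nn_integral_add[symmetric]) (auto simp: distrib_right)
  finally show ?thesis .
qed

lemma nn_integral_Icc_continuous:
  fixes f :: "real \<Rightarrow> real"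
  assumes c: "continuous_on UNIV f" and nn: "\<And>v. v \<in> {a..b} \<Longrightarrow> f v \<ge> 0"
  shows "(\<integral>\<^sup>+v\<in>{a..b}. ennreal (f v) \<partial>lborel) = ennreal (integral {a..b} f)"
proof -
  have si: "set_integrable lborel {a..b} f"
    by (intro borel_integrable_atLeastAtMost') (use continuous_on_subset[OF c] in auto)
  hence "(\<integral>\<^sup>+v\<in>{a..b}. ennreal (f v) \<partial>lborel) = ennreal (set_lebesgue_integral lborel {a..b} f)"
    unfolding set_integrable_def set_lebesgue_integral_def
    by (subst nn_integral_eq_integral[symmetric]) (auto simp: nn indicator_def intro!: nn_integral_cong)
  thus ?thesis using set_borel_integral_eq_integral(2)[OF si] by simp
qed

text \<open>
  Folding the line at the origin turns \<open>exp (- F)\<close>, for odd \<open>F\<close>, into \<open>2 cosh F\<close> on the half-line.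
\<close>

lemma damped_exp_nn_integral:
  fixes F e :: "real \<Rightarrow> real"
  assumes k: "\<kappa> \<ge> 9/10"
    and dF: "\<And>v. (F has_real_derivative e v) (at v)"
    and lip: "\<And>v w. \<bar>e v - e w\<bar> \<le> 1/20 * \<bar>v - w\<bar>"
    and Fa: "F (6/5) = 0" and odd: "\<And>v. F (- v) = - F v" and even: "\<And>v. e (- v) = e v"
  shows "(\<integral>\<^sup>+v. ennreal (exp (- (v\<^sup>2 / 2 + F v + \<kappa> * (e v)\<^sup>2 / 2))) \<partial>lborel) \<le> ennreal (sqrt (2 * pi))"
proof -
  let ?g = "\<lambda>v::real. exp (- (v\<^sup>2 / 2))"
  let ?H = "\<lambda>v. ?g v * (exp (- (\<kappa> * (e v)\<^sup>2 / 2)) * cosh (F v))"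
  have ce: "continuous_on S e" for S
  proof -
    have "(1/20)-lipschitz_on S e"
      by (rule lipschitz_onI) (use lip in \<open>auto simp: dist_real_def\<close>)
    thus ?thesis by (rule lipschitz_on_continuous_on)
  qed
  have cF: "continuous_on S F" for S
    by (meson DERIV_isCont continuous_at_imp_continuous_on dF)
  have [measurable]: "e \<in> borel_measurable borel" "F \<in> borel_measurable borel"
    using ce cF by (auto intro: borel_measurable_continuous_onI)
  have cH: "continuous_on S ?H" for S by (intro continuous_intros ce cF) simp_all
  have F0: "F 0 = 0" using odd[of 0] by simp
  have step: "(\<integral>\<^sup>+v\<in>{0..R}. ennreal (?H v) \<partial>lborel) \<le> ennreal (sqrt (pi / 2))" if "R \<ge> 6/5" for R
  proof -
    have "(\<integral>\<^sup>+v\<in>{0..R}. ennreal (?H v) \<partial>lborel) = ennreal (integral {0..R} ?H)"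
      by (rule nn_integral_Icc_continuous[OF cH]) simp
    also have "\<dots> \<le> ennreal (integral {0..R} ?g)"
      by (intro ennreal_leI damped_cosh_integral k dF lip F0 Fa that)
    also have "\<dots> = (\<integral>\<^sup>+v\<in>{0..R}. ennreal (?g v) \<partial>lborel)"
      by (rule nn_integral_Icc_continuous[symmetric]) (auto intro!: continuous_intros)
    also have "\<dots> \<le> (\<integral>\<^sup>+v. ennreal (?g v) * indicator {0..} v \<partial>lborel)"
      by (intro nn_integral_mono) (auto simp: indicator_def)
    finally show ?thesis by (simp add: half_line_gaussian)
  qed
  have "(\<integral>\<^sup>+v. ennreal (?H v) * indicator {0..} v \<partial>lborel)
      = (\<integral>\<^sup>+v. (SUP n. ennreal (?H v) * indicator {0..real n + 2} v) \<partial>lborel)"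
  proof (intro nn_integral_cong antisym)
    fix v :: real
    obtain n where "v \<le> real n" using real_arch_simple by blast
    hence "ennreal (?H v) * indicator {0..} v \<le> ennreal (?H v) * indicator {0..real n + 2} v"
      by (auto simp: indicator_def)
    thus "ennreal (?H v) * indicator {0..} v \<le> (SUP n. ennreal (?H v) * indicator {0..real n + 2} v)"
      by (rule SUP_upper2[OF UNIV_I])
    show "(SUP n. ennreal (?H v) * indicator {0..real n + 2} v) \<le> ennreal (?H v) * indicator {0..} v"
      by (intro SUP_least) (auto simp: indicator_def)
  qed
  also have "\<dots> = (SUP n. \<integral>\<^sup>+v. ennreal (?H v) * indicator {0..real n + 2} v \<partial>lborel)"
    by (intro nn_integral_monotone_convergence_SUP; (measurable)?) (auto simp: incseq_def le_fun_def indicator_def)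
  also have "\<dots> \<le> ennreal (sqrt (pi / 2))" by (intro SUP_least step) auto
  finally have le: "(\<integral>\<^sup>+v. ennreal (?H v) * indicator {0..} v \<partial>lborel) \<le> ennreal (sqrt (pi / 2))" .
  have "(\<integral>\<^sup>+v. ennreal (exp (- (v\<^sup>2 / 2 + F v + \<kappa> * (e v)\<^sup>2 / 2))) \<partial>lborel)
     = (\<integral>\<^sup>+v. (ennreal (exp (- (v\<^sup>2 / 2 + F v + \<kappa> * (e v)\<^sup>2 / 2)))
           + ennreal (exp (- (v\<^sup>2 / 2 - F v + \<kappa> * (e v)\<^sup>2 / 2)))) * indicator {0..} v \<partial>lborel)"
    by (subst nn_integral_symmetrise) (auto simp: odd even)
  also have "\<dots> = (\<integral>\<^sup>+v. 2 * (ennreal (?H v) * indicator {0..} v) \<partial>lborel)"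
  proof (intro nn_integral_cong)
    fix v
    have "exp (- (v\<^sup>2 / 2 + F v + \<kappa> * (e v)\<^sup>2 / 2)) + exp (- (v\<^sup>2 / 2 - F v + \<kappa> * (e v)\<^sup>2 / 2)) = 2 * ?H v"
      unfolding cosh_def by (simp add: exp_add[symmetric] exp_diff exp_minus divide_simps algebra_simps flip: exp_add)
    thus "(ennreal (exp (- (v\<^sup>2 / 2 + F v + \<kappa> * (e v)\<^sup>2 / 2)))
           + ennreal (exp (- (v\<^sup>2 / 2 - F v + \<kappa> * (e v)\<^sup>2 / 2)))) * indicator {0..} v = 2 * (ennreal (?H v) * indicator {0..} v)"
      by (simp flip: ennreal_plus add: ennreal_mult mult.assoc)
  qed
  also have "\<dots> = 2 * (\<integral>\<^sup>+v. ennreal (?H v) * indicator {0..} v \<partial>lborel)"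
    by (intro nn_integral_cmult) auto
  also have "\<dots> \<le> 2 * ennreal (sqrt (pi / 2))" by (intro mult_left_mono le) auto
  also have "\<dots> = ennreal (sqrt (2 * pi))"
  proof -
    have "2 * sqrt (pi / 2) = sqrt (4 * (pi / 2))" by (subst real_sqrt_mult) simp
    also have "4 * (pi / 2) = 2 * pi" by simp
    finally show ?thesis by (metis ennreal_mult ennreal_numeral pi_ge_zero real_sqrt_ge_zero zero_le_divide_iff zero_le_numeral)
  qed
  finally show ?thesis .
qed

text \<open>
  The function is still nonnegative after the Newton step \<open>- f' / M\<close>.
\<close>

lemma nonneg_deriv_square_le:
  fixes f f' :: "real \<Rightarrow> real"
  assumes d: "\<And>t. (f has_real_derivative f' t) (at t)" and nn: "\<And>t. f t \<ge> 0"
    and lip: "\<And>s t. \<bar>f' s - f' t\<bar> \<le> M * \<bar>s - t\<bar>" and M: "M > 0"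
  shows "(f' t)\<^sup>2 \<le> 2 * M * f t"
proof -
  have upper: "f (t + v) \<le> f t + f' t * v + M * v\<^sup>2 / 2" for v
  proof -
    define h where "h s = f t + f' t * (s - t) + M * (s - t)\<^sup>2 / 2 - f s" for s
    have dh: "(h has_real_derivative (f' t + M * (s - t) - f' s)) (at s)" for s
      unfolding h_def by (auto intro!: derivative_eq_intros d simp: field_simps)
    have "h (t + v) \<ge> h t"
    proof (cases "v \<ge> 0")
      case True
      show ?thesis
      proof (rule DERIV_nonneg_imp_nondecreasing[of t "t + v" h])
        fix s assume "t \<le> s" "s \<le> t + v"
        thus "\<exists>y. (h has_real_derivative y) (at s) \<and> 0 \<le> y"
          using lip[of s t] dh[of s] by (intro exI[of _ "f' t + M * (s - t) - f' s"]) auto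
      qed (use True in auto)
    next
      case False
      show ?thesis
      proof (rule DERIV_nonpos_imp_nonincreasing[of "t + v" t h])
        fix s assume "t + v \<le> s" "s \<le> t"
        thus "\<exists>y. (h has_real_derivative y) (at s) \<and> y \<le> 0"
          using lip[of s t] dh[of s] by (intro exI[of _ "f' t + M * (s - t) - f' s"]) (auto simp: algebra_simps abs_if split: if_splits)
      qed (use False in auto)
    qed
    thus ?thesis by (simp add: h_def)
  qed
  have "0 \<le> f (t + (- f' t / M))" by (rule nn)
  also have "\<dots> \<le> f t + f' t * (- f' t / M) + M * (- f' t / M)\<^sup>2 / 2" by (rule upper)
  also have "\<dots> = f t - (f' t)\<^sup>2 / (2 * M)" using M by (simp add: field_simps power2_eq_square)
  finally show ?thesis using M by (simp add: field_simps)
qed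

text \<open>
  The exponent \<open>D\<close> is the sum of a function of \<open>x = z - v/2\<close>, a function of \<open>y = z + v/2\<close> and
  \<open>- x * y\<close>, so it solves an inhomogeneous wave equation in \<open>(z, v)\<close>, and d'Alembert's formula
  expresses \<open>D\<close> at \<open>(z, m + v)\<close> by its values and its \<open>v\<close>-derivatives on the line \<open>v = m\<close>. Since
  \<open>D\<close> is nonnegative, the values dominate the squares of the derivatives. Hence \<open>D\<close> exceeds
  \<open>v\<^sup>2 / 2\<close> by at least an odd function \<open>P\<close> of \<open>v\<close> plus a multiple of \<open>P'\<^sup>2\<close>.
\<close>

lemma line_integral_le:
  fixes \<alpha> \<beta> \<alpha>' \<beta>' :: "real \<Rightarrow> real"
  assumes da: "\<And>t. (\<alpha> has_real_derivative \<alpha>' t) (at t)" and db: "\<And>t. (\<beta> has_real_derivative \<beta>' t) (at t)"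
    and la: "\<And>s t. \<bar>\<alpha>' s - \<alpha>' t\<bar> \<le> 1/10 * \<bar>s - t\<bar>" and lb: "\<And>s t. \<bar>\<beta>' s - \<beta>' t\<bar> \<le> 1/10 * \<bar>s - t\<bar>"
    and nn: "\<And>x y. (x - y)\<^sup>2 / 2 + \<alpha> x + \<beta> y \<ge> 0"
  shows "(\<integral>\<^sup>+v. ennreal (exp (- (v\<^sup>2 / 2 + \<alpha> (z - v / 2) + \<beta> (z + v / 2)))) \<partial>lborel) \<le> ennreal (sqrt (2 * pi))"
proof -
  define D where "D \<zeta> v = v\<^sup>2 / 2 + \<alpha> (\<zeta> - v / 2) + \<beta> (\<zeta> + v / 2)" for \<zeta> v
  define D' where "D' \<zeta> v = v + (\<beta>' (\<zeta> + v / 2) - \<alpha>' (\<zeta> - v / 2)) / 2" for \<zeta> v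
  have D0: "D \<zeta> v \<ge> 0" for \<zeta> v using nn[of "\<zeta> - v/2" "\<zeta> + v/2"] by (simp add: D_def power2_eq_square)
  have dD: "((\<lambda>v. D \<zeta> v) has_real_derivative D' \<zeta> v) (at v)" for \<zeta> v
    unfolding D_def D'_def
    by (auto intro!: derivative_eq_intros DERIV_chain2[OF da] DERIV_chain2[OF db] simp: field_simps)
  have D'lip: "\<bar>D' \<zeta> v - D' \<zeta> w\<bar> \<le> 21/20 * \<bar>v - w\<bar>" for \<zeta> v w
  proof -
    have "\<zeta> - v/2 - (\<zeta> - w/2) = - ((v - w) / 2)" "\<zeta> + v/2 - (\<zeta> + w/2) = (v - w) / 2" by (simp_all add: field_simps)
    hence "\<bar>\<alpha>' (\<zeta> - v/2) - \<alpha>' (\<zeta> - w/2)\<bar> \<le> 1/20 * \<bar>v - w\<bar>" "\<bar>\<beta>' (\<zeta> + v/2) - \<beta>' (\<zeta> + w/2)\<bar> \<le> 1/20 * \<bar>v - w\<bar>"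
      using la[of "\<zeta> - v/2" "\<zeta> - w/2"] lb[of "\<zeta> + v/2" "\<zeta> + w/2"] by simp_all
    moreover have "D' \<zeta> v - D' \<zeta> w = (v - w) + ((\<beta>' (\<zeta> + v/2) - \<beta>' (\<zeta> + w/2)) - (\<alpha>' (\<zeta> - v/2) - \<alpha>' (\<zeta> - w/2))) / 2"
      by (simp add: D'_def field_simps)
    moreover have "\<bar>d + (b - a) / 2\<bar> \<le> 21/20 * \<bar>d\<bar>" if "\<bar>a\<bar> \<le> 1/20 * \<bar>d\<bar>" "\<bar>b\<bar> \<le> 1/20 * \<bar>d\<bar>" for a b d :: real
    proof -
      have "(b - a) / 2 \<le> 1/20 * \<bar>d\<bar>" "- ((b - a) / 2) \<le> 1/20 * \<bar>d\<bar>" using that by argo+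
      hence "\<bar>(b - a) / 2\<bar> \<le> 1/20 * \<bar>d\<bar>" by (rule abs_leI)
      thus ?thesis using abs_triangle_ineq[of d "(b - a) / 2"] by argo
    qed
    ultimately show ?thesis by metis
  qed
  have sq: "(D' \<zeta> v)\<^sup>2 \<le> 21/10 * D \<zeta> v" for \<zeta> v
    using nonneg_deriv_square_le[of "D \<zeta>" "D' \<zeta>" "21/20" v, OF dD D0 D'lip] by simp
  define P where "P m v = m * v + (\<beta> (z + m/2 + v/2) - \<beta> (z + m/2 - v/2)
       - \<alpha> (z - m/2 + v/2) + \<alpha> (z - m/2 - v/2)) / 2" for m v
  define e where "e m v = (D' (z + v/2) m + D' (z - v/2) m) / 2" for m v
  have dP: "(P m has_real_derivative e m v) (at v)" for m v
  proof (rule DERIV_cong)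
    show "(P m has_real_derivative m + (\<beta>' (z + m/2 + v/2) * (1/2) - \<beta>' (z + m/2 - v/2) * (- (1/2))
       - \<alpha>' (z - m/2 + v/2) * (1/2) + \<alpha>' (z - m/2 - v/2) * (- (1/2))) / 2) (at v)"
      unfolding P_def
      by (auto intro!: derivative_eq_intros DERIV_chain2[OF da] DERIV_chain2[OF db])
    have "z + v/2 + m/2 = z + m/2 + v/2" "z + v/2 - m/2 = z - m/2 + v/2"
      "z - v/2 + m/2 = z + m/2 - v/2" "z - v/2 - m/2 = z - m/2 - v/2" by simp_all
    thus "m + (\<beta>' (z + m/2 + v/2) * (1/2) - \<beta>' (z + m/2 - v/2) * (- (1/2))
       - \<alpha>' (z - m/2 + v/2) * (1/2) + \<alpha>' (z - m/2 - v/2) * (- (1/2))) / 2 = e m v"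
      unfolding e_def D'_def by argo
  qed
  have "\<exists>m. P m (6/5) = 0"
  proof -
    have dQ: "((\<lambda>m. P m (6/5)) has_real_derivative (6/5 + (\<beta>' (z + m/2 + 3/5) - \<beta>' (z + m/2 - 3/5)
       + \<alpha>' (z - m/2 + 3/5) - \<alpha>' (z - m/2 - 3/5)) / 4)) (at m)" for m
      unfolding P_def
      by (auto intro!: derivative_eq_intros DERIV_chain2[OF da] DERIV_chain2[OF db] simp: field_simps)
    have ge: "6/5 + (\<beta>' (z + m/2 + 3/5) - \<beta>' (z + m/2 - 3/5)
       + \<alpha>' (z - m/2 + 3/5) - \<alpha>' (z - m/2 - 3/5)) / 4 \<ge> 1" for m
    proof -
      have "\<bar>\<alpha>' (z - m/2 + 3/5) - \<alpha>' (z - m/2 - 3/5)\<bar> \<le> 3/25" "\<bar>\<beta>' (z + m/2 + 3/5) - \<beta>' (z + m/2 - 3/5)\<bar> \<le> 3/25"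
        using la[of "z - m/2 + 3/5" "z - m/2 - 3/5"] lb[of "z + m/2 + 3/5" "z + m/2 - 3/5"] by simp_all
      thus ?thesis unfolding abs_le_iff by argo
    qed
    define Q where "Q m = P m (6/5) - m" for m
    have "Q m \<le> Q n" if "m \<le> n" for m n
      using that
    proof (rule DERIV_nonneg_imp_nondecreasing)
      fix s
      show "\<exists>y. (Q has_real_derivative y) (at s) \<and> 0 \<le> y"
        unfolding Q_def by (rule exI, rule conjI, rule DERIV_diff[OF dQ DERIV_ident]) (use ge[of s] in simp)
    qed
    note mono = this
    define c where "c = \<bar>P 0 (6/5)\<bar>"
    have "P (- c) (6/5) \<le> 0" using mono[of "-c" 0] by (simp add: Q_def c_def)
    moreover have "0 \<le> P c (6/5)" using mono[of 0 c] by (simp add: Q_def c_def)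
    moreover have "continuous_on {-c..c} (\<lambda>m. P m (6/5))"
      by (intro continuous_at_imp_continuous_on ballI DERIV_isCont[OF dQ])
    ultimately show ?thesis using IVT'[of "\<lambda>m. P m (6/5)" "-c" 0 c] by (auto simp: c_def)
  qed
  \<comment> \<open>the choice of the line \<open>v = m\<close> that supplies the second zero of \<open>P\<close>\<close>
  then obtain m where m: "P m (6/5) = 0" by blast
  \<comment> \<open>d'Alembert's formula, with the two values of \<open>D\<close> on the line \<open>v = m\<close> bounded below by their derivatives\<close>
  have low: "v\<^sup>2 / 2 + P m v + 20/21 * (e m v)\<^sup>2 / 2 \<le> D z (m + v)" for v
  proof -
    have "D z (m + v) = v\<^sup>2 / 2 + P m v + (D (z + v/2) m + D (z - v/2) m) / 2"
    proof -
      have "z + (m + v)/2 = z + m/2 + v/2" "z - (m + v)/2 = z - m/2 - v/2"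
        "z + v/2 + m/2 = z + m/2 + v/2" "z + v/2 - m/2 = z - m/2 + v/2"
        "z - v/2 + m/2 = z + m/2 - v/2" "z - v/2 - m/2 = z - m/2 - v/2" by argo+
      moreover have "(m + v)\<^sup>2 = m\<^sup>2 + 2 * (m * v) + v\<^sup>2" by (simp add: power2_sum)
      ultimately show ?thesis unfolding D_def P_def by argo
    qed
    moreover have "(e m v)\<^sup>2 \<le> ((D' (z + v/2) m)\<^sup>2 + (D' (z - v/2) m)\<^sup>2) / 2"
      using zero_le_power2[of "D' (z + v/2) m - D' (z - v/2) m"]
      unfolding e_def by (simp add: power2_eq_square field_simps)
    ultimately show ?thesis using sq[of "z + v/2" m] sq[of "z - v/2" m] by argo
  qed
  have [measurable]: "\<alpha> \<in> borel_measurable borel" "\<beta> \<in> borel_measurable borel"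
    by (meson DERIV_isCont continuous_at_imp_continuous_on da db borel_measurable_continuous_onI)+
  have "(\<integral>\<^sup>+v. ennreal (exp (- D z v)) \<partial>lborel) = (\<integral>\<^sup>+v. ennreal (exp (- D z (m + v))) \<partial>lborel)"
    using nn_integral_real_affine[of "\<lambda>v. ennreal (exp (- D z v))" 1 m] by (simp add: D_def)
  also have "\<dots> \<le> (\<integral>\<^sup>+v. ennreal (exp (- (v\<^sup>2 / 2 + P m v + 20/21 * (e m v)\<^sup>2 / 2))) \<partial>lborel)"
    by (intro nn_integral_mono ennreal_leI, subst exp_le_cancel_iff, subst neg_le_iff_le) (rule low)
  also have "\<dots> \<le> ennreal (sqrt (2 * pi))"
  proof (rule damped_exp_nn_integral[OF _ dP _ m])
    show "\<bar>e m v - e m w\<bar> \<le> 1/20 * \<bar>v - w\<bar>" for v w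
    proof -
      have eq: "z + v/2 - m/2 - (z + w/2 - m/2) = (v - w)/2" "z - v/2 - m/2 - (z - w/2 - m/2) = - ((v - w)/2)"
        "z + v/2 + m/2 - (z + w/2 + m/2) = (v - w)/2" "z - v/2 + m/2 - (z - w/2 + m/2) = - ((v - w)/2)"
        by (simp_all add: field_simps)
      have "\<bar>\<alpha>' (z + v/2 - m/2) - \<alpha>' (z + w/2 - m/2)\<bar> \<le> 1/20 * \<bar>v - w\<bar>"
        "\<bar>\<alpha>' (z - v/2 - m/2) - \<alpha>' (z - w/2 - m/2)\<bar> \<le> 1/20 * \<bar>v - w\<bar>"
        "\<bar>\<beta>' (z + v/2 + m/2) - \<beta>' (z + w/2 + m/2)\<bar> \<le> 1/20 * \<bar>v - w\<bar>"
        "\<bar>\<beta>' (z - v/2 + m/2) - \<beta>' (z - w/2 + m/2)\<bar> \<le> 1/20 * \<bar>v - w\<bar>"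
        using la[of "z + v/2 - m/2" "z + w/2 - m/2"] la[of "z - v/2 - m/2" "z - w/2 - m/2"]
          lb[of "z + v/2 + m/2" "z + w/2 + m/2"] lb[of "z - v/2 + m/2" "z - w/2 + m/2"]
        unfolding eq by simp_all
      moreover have "e m v - e m w = ((\<beta>' (z + v/2 + m/2) - \<beta>' (z + w/2 + m/2)) - (\<alpha>' (z + v/2 - m/2) - \<alpha>' (z + w/2 - m/2))
          + (\<beta>' (z - v/2 + m/2) - \<beta>' (z - w/2 + m/2)) - (\<alpha>' (z - v/2 - m/2) - \<alpha>' (z - w/2 - m/2))) / 4"
        by (simp add: e_def D'_def field_simps)
      moreover have "\<bar>(a - b + c - d) / 4\<bar> \<le> k" if "\<bar>a\<bar> \<le> k" "\<bar>b\<bar> \<le> k" "\<bar>c\<bar> \<le> k" "\<bar>d\<bar> \<le> k" for a b c d k :: real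
        using that unfolding abs_le_iff by argo
      ultimately show ?thesis by metis
    qed
    show "P m (- v) = - P m v" for v by (simp add: P_def field_simps)
    show "e m (- v) = e m v" for v by (simp add: e_def)
  qed simp
  finally show ?thesis by (simp add: D_def)
qed

section \<open>Gaussian bound over a rectangle\<close>

text \<open>
  The rotation is composed of two shears, each of which is a translation on every line.
\<close>

lemma nn_integral_rotate:
  fixes g :: "real \<times> real \<Rightarrow> ennreal"
  assumes [measurable]: "g \<in> borel_measurable borel"
  shows "(\<integral>\<^sup>+x. \<integral>\<^sup>+y. g (x, y) \<partial>lborel \<partial>lborel) = (\<integral>\<^sup>+z. \<integral>\<^sup>+v. g (z - v / 2, z + v / 2) \<partial>lborel \<partial>lborel)"
proof -
  have m[measurable]: "g \<in> borel_measurable (lborel \<Otimes>\<^sub>M lborel)"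
    using assms by (simp add: lborel_prod)
  have "(\<integral>\<^sup>+x. \<integral>\<^sup>+y. g (x, y) \<partial>lborel \<partial>lborel) = (\<integral>\<^sup>+x. \<integral>\<^sup>+v. g (x, x + v) \<partial>lborel \<partial>lborel)"
  proof (rule nn_integral_cong)
    fix x :: real
    show "(\<integral>\<^sup>+y. g (x, y) \<partial>lborel) = (\<integral>\<^sup>+v. g (x, x + v) \<partial>lborel)"
      using nn_integral_real_affine[of "\<lambda>y. g (x, y)" 1 x] by simp
  qed
  also have "\<dots> = (\<integral>\<^sup>+v. \<integral>\<^sup>+x. g (x, x + v) \<partial>lborel \<partial>lborel)"
    by (rule lborel_pair.Fubini') (simp add: split_beta')
  also have "\<dots> = (\<integral>\<^sup>+v. \<integral>\<^sup>+z. g (z - v / 2, z + v / 2) \<partial>lborel \<partial>lborel)"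
  proof (rule nn_integral_cong)
    fix v :: real
    show "(\<integral>\<^sup>+x. g (x, x + v) \<partial>lborel) = (\<integral>\<^sup>+z. g (z - v / 2, z + v / 2) \<partial>lborel)"
      using nn_integral_real_affine[of "\<lambda>x. g (x, x + v)" 1 "- v / 2"] by (simp add: algebra_simps)
  qed
  also have "\<dots> = (\<integral>\<^sup>+z. \<integral>\<^sup>+v. g (z - v / 2, z + v / 2) \<partial>lborel \<partial>lborel)"
    by (rule lborel_pair.Fubini') (simp add: split_beta')
  finally show ?thesis .
qed

text \<open>
  Scaling \<open>x\<close> by \<open>p\<close> and \<open>y\<close> by \<open>q\<close> brings the derivatives of \<open>U\<close> and \<open>V\<close> close to the identity. Then
  every line \<open>x + y = 2 z\<close> contributes at most \<open>sqrt (2 * pi)\<close>, and \<open>z\<close> runs through an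
  interval whose length is half the sum of the scaled side lengths.
\<close>

lemma box_integral_le:
  fixes U V T S :: "real \<Rightarrow> real"
  assumes dU: "\<And>t. (U has_real_derivative T t) (at t)" and dV: "\<And>t. (V has_real_derivative S t) (at t)"
    and lT: "\<And>s t. \<bar>T s - T t - \<mu>\<^sup>2 * (s - t)\<bar> \<le> \<mu>\<^sup>2 / 10 * \<bar>s - t\<bar>"
    and lS: "\<And>s t. \<bar>S s - S t - (s - t) / \<mu>\<^sup>2\<bar> \<le> 1 / (10 * \<mu>\<^sup>2) * \<bar>s - t\<bar>"
    and nn: "\<And>x y. U x + V y - x * y \<ge> 0"
    and l: "\<mu> > 0" and h: "h > 0" and ab: "a \<le> b" "c \<le> d"
  shows "(\<integral>\<^sup>+x. \<integral>\<^sup>+y. ennreal (exp (- ((U x + V y - x * y) / (2 * h)))) * (indicator {a..b} x * indicator {c..d} y) \<partial>lborel \<partial>lborel)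
     \<le> ennreal (sqrt (pi * h) * (\<mu> * (b - a) + (d - c) / \<mu>))" (is "?L \<le> _")
proof -
  define p where "p = \<mu> / sqrt (2 * h)"
  define q where "q = 1 / (\<mu> * sqrt (2 * h))"
  have pq: "p > 0" "q > 0" "p * q = 1 / (2 * h)" using l h by (auto simp: p_def q_def)
  have p2: "p\<^sup>2 = \<mu>\<^sup>2 / (2 * h)" and q2: "q\<^sup>2 = 1 / (\<mu>\<^sup>2 * (2 * h))"
    using l h by (auto simp: p_def q_def power_divide power_mult_distrib)
  define \<alpha> where "\<alpha> X = U (X / p) / (2 * h) - X\<^sup>2 / 2" for X
  define \<beta> where "\<beta> Y = V (Y / q) / (2 * h) - Y\<^sup>2 / 2" for Y
  define \<alpha>' where "\<alpha>' X = T (X / p) / (2 * h * p) - X" for X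
  define \<beta>' where "\<beta>' Y = S (Y / q) / (2 * h * q) - Y" for Y
  have da: "(\<alpha> has_real_derivative \<alpha>' X) (at X)" for X
    unfolding \<alpha>_def \<alpha>'_def using pq h
    by (auto intro!: derivative_eq_intros DERIV_chain2[OF dU] simp: field_simps)
  have db: "(\<beta> has_real_derivative \<beta>' Y) (at Y)" for Y
    unfolding \<beta>_def \<beta>'_def using pq h
    by (auto intro!: derivative_eq_intros DERIV_chain2[OF dV] simp: field_simps)
  have la: "\<bar>\<alpha>' s - \<alpha>' t\<bar> \<le> 1/10 * \<bar>s - t\<bar>" for s t
  proof -
    have *: "2 * h * p * p = \<mu>\<^sup>2" using p2 h by (simp add: power2_eq_square field_simps)
    have "\<mu>\<^sup>2 * (s / p - t / p) = (s - t) * (2 * h * p)"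
      using pq(1) by (subst *[symmetric]) (simp add: field_simps)
    hence "\<alpha>' s - \<alpha>' t = (T (s / p) - T (t / p) - \<mu>\<^sup>2 * (s / p - t / p)) / (2 * h * p)"
      using pq h by (simp add: \<alpha>'_def diff_divide_distrib)
    also have "\<bar>\<dots>\<bar> \<le> (\<mu>\<^sup>2 / 10 * \<bar>s / p - t / p\<bar>) / (2 * h * p)"
      unfolding abs_divide using lT[of "s/p" "t/p"] pq h by (intro frac_le) auto
    also have "\<dots> = 1/10 * \<bar>s - t\<bar>"
      using pq(1) h by (subst *[symmetric]) (simp add: diff_divide_distrib[symmetric] abs_divide)
    finally show ?thesis .
  qed
  have lb: "\<bar>\<beta>' s - \<beta>' t\<bar> \<le> 1/10 * \<bar>s - t\<bar>" for s t
  proof -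
    have *: "2 * h * q * q = 1 / \<mu>\<^sup>2" using q2 h l by (simp add: power2_eq_square field_simps)
    hence "(s / q - t / q) / \<mu>\<^sup>2 = (s / q - t / q) * (2 * h * q * q)" by simp
    hence **: "(s / q - t / q) / \<mu>\<^sup>2 = (s - t) * (2 * h * q)"
    proof -
      have "(s / q - t / q) * (2 * h * q * q) = (s - t) * (2 * h * q)"
        using pq(2) by (simp add: field_simps)
      with \<open>(s / q - t / q) / \<mu>\<^sup>2 = (s / q - t / q) * (2 * h * q * q)\<close> show ?thesis by simp
    qed
    hence "\<beta>' s - \<beta>' t = (S (s / q) - S (t / q) - (s / q - t / q) / \<mu>\<^sup>2) / (2 * h * q)"
      using pq h by (simp add: \<beta>'_def diff_divide_distrib)
    also have "\<bar>\<dots>\<bar> \<le> (1 / (10 * \<mu>\<^sup>2) * \<bar>s / q - t / q\<bar>) / (2 * h * q)"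
      unfolding abs_divide using lS[of "s/q" "t/q"] pq h by (intro frac_le) auto
    also have "1 / (10 * \<mu>\<^sup>2) * \<bar>s / q - t / q\<bar> = 1/10 * \<bar>(s / q - t / q) / \<mu>\<^sup>2\<bar>"
      by (simp add: abs_divide)
    also have "\<dots> = 1/10 * \<bar>s - t\<bar> * (2 * h * q)" unfolding ** using pq h by (simp add: abs_mult)
    finally show ?thesis using pq h by simp
  qed
  define G where "G X Y = (X - Y)\<^sup>2 / 2 + \<alpha> X + \<beta> Y" for X Y
  have XY: "x * y / (2 * h) = p * x * (q * y)" for x y
    using pq(3) by (metis (no_types, lifting) mult.commute mult.left_commute times_divide_eq_right mult_1_right)
  have G: "G (p * x) (q * y) = (U x + V y - x * y) / (2 * h)" for x y
    using pq(1,2) XY[of x y] unfolding G_def \<alpha>_def \<beta>_def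
    by (simp add: diff_divide_distrib add_divide_distrib power2_diff)
  have nnG: "(X - Y)\<^sup>2 / 2 + \<alpha> X + \<beta> Y \<ge> 0" for X Y
    using G[of "X / p" "Y / q"] nn[of "X/p" "Y/q"] h pq unfolding G_def by simp
  have [measurable]: "\<alpha> \<in> borel_measurable borel" "\<beta> \<in> borel_measurable borel"
    by (meson DERIV_isCont continuous_at_imp_continuous_on da db borel_measurable_continuous_onI)+
  define g where "g = (\<lambda>(X, Y). ennreal (exp (- G X Y)) * (indicator {p*a..p*b} X * indicator {q*c..q*d} Y))"
  have gm[measurable]: "g \<in> borel_measurable (borel \<Otimes>\<^sub>M borel)" unfolding g_def G_def by measurable
  hence gb: "g \<in> borel_measurable borel" by (simp add: borel_prod)
  have "?L = (\<integral>\<^sup>+x. \<integral>\<^sup>+y. g (p * x, q * y) \<partial>lborel \<partial>lborel)"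
    using pq(1,2) by (intro nn_integral_cong) (auto simp: g_def G indicator_def)
  hence "ennreal (p * q) * ?L = ennreal p * (\<integral>\<^sup>+x. ennreal q * (\<integral>\<^sup>+y. g (p * x, q * y) \<partial>lborel) \<partial>lborel)"
    using pq(1,2) by (subst nn_integral_cmult) (auto simp: ennreal_mult mult.assoc)
  also have "(\<integral>\<^sup>+x. ennreal q * (\<integral>\<^sup>+y. g (p * x, q * y) \<partial>lborel) \<partial>lborel) = (\<integral>\<^sup>+x. \<integral>\<^sup>+Y. g (p * x, Y) \<partial>lborel \<partial>lborel)"
  proof (rule nn_integral_cong)
    fix x
    show "ennreal q * (\<integral>\<^sup>+y. g (p * x, q * y) \<partial>lborel) = (\<integral>\<^sup>+Y. g (p * x, Y) \<partial>lborel)"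
      using nn_integral_real_affine[of "\<lambda>Y. g (p * x, Y)" q 0] pq by simp
  qed
  also have "ennreal p * \<dots> = (\<integral>\<^sup>+X. \<integral>\<^sup>+Y. g (X, Y) \<partial>lborel \<partial>lborel)"
    using nn_integral_real_affine[of "\<lambda>X. \<integral>\<^sup>+Y. g (X, Y) \<partial>lborel" p 0] pq by simp
  also have "\<dots> = (\<integral>\<^sup>+z. \<integral>\<^sup>+v. g (z - v / 2, z + v / 2) \<partial>lborel \<partial>lborel)"
    by (rule nn_integral_rotate[OF gb])
  also have "\<dots> \<le> (\<integral>\<^sup>+z. ennreal (sqrt (2 * pi)) * indicator {(p*a+q*c)/2..(p*b+q*d)/2} z \<partial>lborel)"
  proof (rule nn_integral_mono)
    fix z :: real
    have "(\<integral>\<^sup>+v. g (z - v / 2, z + v / 2) \<partial>lborel)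
      \<le> (\<integral>\<^sup>+v. ennreal (exp (- (v\<^sup>2 / 2 + \<alpha> (z - v / 2) + \<beta> (z + v / 2)))) * indicator {(p*a+q*c)/2..(p*b+q*d)/2} z \<partial>lborel)"
      by (intro nn_integral_mono) (auto simp: g_def G_def indicator_def power2_eq_square)
    also have "\<dots> = (\<integral>\<^sup>+v. ennreal (exp (- (v\<^sup>2 / 2 + \<alpha> (z - v / 2) + \<beta> (z + v / 2)))) \<partial>lborel) * indicator {(p*a+q*c)/2..(p*b+q*d)/2} z"
      by (intro nn_integral_multc) auto
    also have "\<dots> \<le> ennreal (sqrt (2 * pi)) * indicator {(p*a+q*c)/2..(p*b+q*d)/2} z"
      by (intro mult_right_mono line_integral_le[OF da db la lb nnG]) auto
    finally show "(\<integral>\<^sup>+v. g (z - v / 2, z + v / 2) \<partial>lborel) \<le> ennreal (sqrt (2 * pi)) * indicator {(p*a+q*c)/2..(p*b+q*d)/2} z" .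
  qed
  also have "\<dots> = ennreal (sqrt (2 * pi)) * emeasure lborel {(p*a+q*c)/2..(p*b+q*d)/2}"
    by (rule nn_integral_cmult_indicator) simp
  also have "emeasure lborel {(p*a+q*c)/2..(p*b+q*d)/2} = ennreal ((p * (b - a) + q * (d - c)) / 2)"
  proof -
    have "p * a \<le> p * b" "q * c \<le> q * d" using pq ab by auto
    thus ?thesis by (subst emeasure_lborel_Icc) (auto simp: field_simps)
  qed
  also have "ennreal (sqrt (2 * pi)) * \<dots> = ennreal (sqrt (2 * pi) * ((p * (b - a) + q * (d - c)) / 2))"
    by (rule ennreal_mult[symmetric]) (use pq ab in auto)
  finally have "ennreal (2 * h) * (ennreal (p * q) * ?L) \<le> ennreal (2 * h) * ennreal (sqrt (2 * pi) * ((p * (b - a) + q * (d - c)) / 2))"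
    by (rule mult_left_mono) simp
  also have "ennreal (2 * h) * (ennreal (p * q) * ?L) = ?L"
    using pq h by (simp add: mult.assoc[symmetric] ennreal_mult[symmetric])
  also have "ennreal (2 * h) * ennreal (sqrt (2 * pi) * ((p * (b - a) + q * (d - c)) / 2))
     = ennreal (2 * h * (sqrt (2 * pi) * ((p * (b - a) + q * (d - c)) / 2)))"
    by (rule ennreal_mult[symmetric]) (use pq ab h in auto)
  also have "2 * h * (sqrt (2 * pi) * ((p * (b - a) + q * (d - c)) / 2)) = sqrt (pi * h) * (\<mu> * (b - a) + (d - c) / \<mu>)"
  proof -
    have "sqrt (2 * h) * sqrt (2 * h) = 2 * h" using h by simp
    hence s: "2 * h / sqrt (2 * h) = sqrt (2 * h)" using h by (metis nonzero_mult_div_cancel_left real_sqrt_eq_zero_cancel_iff mult_eq_0_iff less_irrefl zero_neq_numeral)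
    have "2 * h * (sqrt (2 * pi) * ((p * (b - a) + q * (d - c)) / 2)) = (2 * h / sqrt (2 * h)) * (sqrt (2 * pi) * (\<mu> * (b - a) + (d - c) / \<mu>)) / 2"
    proof -
      have "p * (b - a) + q * (d - c) = (\<mu> * (b - a) + (d - c) / \<mu>) / sqrt (2 * h)"
        by (simp add: p_def q_def add_divide_distrib)
      thus ?thesis by simp
    qed
    also have "\<dots> = sqrt (2 * h) * sqrt (2 * pi) * (\<mu> * (b - a) + (d - c) / \<mu>) / 2" unfolding s by simp
    also have "sqrt (2 * h) * sqrt (2 * pi) = 2 * sqrt (pi * h)" by (simp add: real_sqrt_mult)
    finally show ?thesis by simp
  qed
  finally show ?thesis .
qed

section \<open>Monotone transport maps and their potentials\<close>

text \<open>
  The maps live on the whole line, so that potentials and inverses need no boundary conditions; \<open>r\<close> is a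
  lower bound for the slopes of both maps.
\<close>

locale transport =
  fixes T S :: "real \<Rightarrow> real" and r :: real
  assumes r: "0 < r" "r \<le> 1"
    and TS: "\<And>y. T (S y) = y" and ST: "\<And>x. S (T x) = x"
    and slope_lower: "\<And>x y. x \<le> y \<Longrightarrow> r * (y - x) \<le> T y - T x"
    and slope_upper: "\<And>x y. x \<le> y \<Longrightarrow> T y - T x \<le> (y - x) / r"
begin

lemma T_mono: "x \<le> y \<Longrightarrow> T x \<le> T y"
  using slope_lower[of x y] mult_nonneg_nonneg[of r "y - x"] r by linarith

lemma T_strict_mono: "x < y \<Longrightarrow> T x < T y"
  using T_mono[of x y] ST by (metis less_le)

lemma T_le_iff: "T x \<le> T y \<longleftrightarrow> x \<le> y"
  using T_mono T_strict_mono by (meson not_le)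

lemma S_le_iff: "S x \<le> S y \<longleftrightarrow> x \<le> y"
  using T_le_iff[of "S x" "S y"] by (simp add: TS)

lemma transport_inverse: "transport S T r"
proof
  fix x y :: real assume xy: "x \<le> y"
  hence le: "S x \<le> S y" by (simp add: S_le_iff)
  show "r * (y - x) \<le> S y - S x"
    using slope_upper[OF le] r by (simp add: TS field_simps)
  show "S y - S x \<le> (y - x) / r"
    using slope_lower[OF le] r by (simp add: TS field_simps)
qed (use r TS ST in auto)

lemma T_abs_upper: "\<bar>T y - T x\<bar> \<le> \<bar>y - x\<bar> / r"
  using slope_upper[of x y] slope_upper[of y x] T_mono[of x y] T_mono[of y x] by (cases "x \<le> y") (auto simp: abs_if)

lemma T_continuous: "continuous_on X T"
proof (rule lipschitz_on_continuous_on[of "1/r"], rule lipschitz_onI)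
  show "dist (T x) (T y) \<le> 1 / r * dist x y" for x y
    using T_abs_upper[of x y] by (simp add: dist_real_def)
qed (use r in auto)

lemma T_isCont: "isCont T x"
  using T_continuous[of UNIV] by (simp add: continuous_on_eq_continuous_at)

lemma T_measurable [measurable]: "T \<in> borel_measurable borel"
  by (rule borel_measurable_continuous_onI[OF T_continuous])

text \<open>
  If \<open>\<mu>\<^sup>2\<close> and the slopes of \<open>T\<close> are all close to one, then \<open>T\<close> satisfies the hypothesis of the
  bound over rectangles at the scale \<open>\<mu>\<close>.
\<close>

lemma slope_near_square:
  assumes m: "\<mu> > 0" "10/11 \<le> r * \<mu>\<^sup>2" "10/11 * \<mu>\<^sup>2 \<le> r"
  shows "\<bar>T s - T t - \<mu>\<^sup>2 * (s - t)\<bar> \<le> \<mu>\<^sup>2 / 10 * \<bar>s - t\<bar>"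
proof -
  have "9/10 * \<mu>\<^sup>2 \<le> r" using m(3) zero_le_power2[of \<mu>] by linarith
  moreover have "1 / r \<le> 11/10 * \<mu>\<^sup>2" using m r by (simp add: field_simps)
  ultimately have b: "9/10 * \<mu>\<^sup>2 * (y - x) \<le> T y - T x" "T y - T x \<le> 11/10 * \<mu>\<^sup>2 * (y - x)" if "x \<le> y" for x y
    using order_trans[OF mult_right_mono slope_lower[OF that], of "9/10 * \<mu>\<^sup>2"]
      order_trans[OF slope_upper[OF that], of "11/10 * \<mu>\<^sup>2 * (y - x)"]
      mult_right_mono[of "1/r" "11/10 * \<mu>\<^sup>2" "y - x"] that by simp_all
  have "\<bar>T y - T x - \<mu>\<^sup>2 * (y - x)\<bar> \<le> \<mu>\<^sup>2 / 10 * (y - x)" if "x \<le> y" for x y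
  proof -
    have "9/10 * \<mu>\<^sup>2 * (y - x) = \<mu>\<^sup>2 * (y - x) - \<mu>\<^sup>2 / 10 * (y - x)"
      "11/10 * \<mu>\<^sup>2 * (y - x) = \<mu>\<^sup>2 * (y - x) + \<mu>\<^sup>2 / 10 * (y - x)"
      by (simp_all add: field_simps)
    thus ?thesis using b[OF that] by (intro abs_leI) linarith+
  qed
  note * = this[of s t] this[of t s]
  have "\<bar>T s - T t - \<mu>\<^sup>2 * (s - t)\<bar> = \<bar>T t - T s - \<mu>\<^sup>2 * (t - s)\<bar>"
    using abs_minus_cancel[of "T t - T s - \<mu>\<^sup>2 * (t - s)"] by (simp add: algebra_simps)
  thus ?thesis using * by (cases "s \<le> t") (auto simp: abs_if)
qed

text \<open>
  Equivalently, \<open>x\<^sup>2 - 2 * U x\<close> and \<open>y\<^sup>2 - 2 * V y\<close> are Kantorovich potentials for the quadratic cost.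
\<close>

definition "potentials U V \<longleftrightarrow> (\<forall>t. (U has_real_derivative T t) (at t)) \<and>
  (\<forall>t. (V has_real_derivative S t) (at t)) \<and> (\<forall>x. U x + V (T x) = x * T x)"

text \<open>
  For fixed \<open>y\<close> the gap is the difference between \<open>U\<close> and its tangent at \<open>S y\<close>, and \<open>U\<close> is
  convex with modulus \<open>r\<close> because its derivative \<open>T\<close> has slope at least \<open>r\<close>.
\<close>

lemma potential_gap_lower:
  assumes "potentials U V"
  shows "r ^ 3 / 2 * (y - T x)\<^sup>2 \<le> U x + V y - x * y"
proof -
  have dU: "(U has_real_derivative T t) (at t)" and eq: "U t + V (T t) = t * T t" for t
    using assms by (auto simp: potentials_def)
  define h where "h t = U t - U (S y) - (t - S y) * y - r / 2 * (t - S y)\<^sup>2" for t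
  have dh: "(h has_real_derivative (T t - y - r * (t - S y))) (at t)" for t
    unfolding h_def by (auto intro!: derivative_eq_intros dU simp: field_simps)
  have "h (S y) \<le> h x"
  proof (cases "S y \<le> x")
    case True
    show ?thesis
    proof (rule DERIV_nonneg_imp_nondecreasing[OF True])
      fix t assume "S y \<le> t" "t \<le> x"
      thus "\<exists>d. (h has_real_derivative d) (at t) \<and> 0 \<le> d"
        using slope_lower[of "S y" t] dh[of t] by (intro exI[of _ "T t - y - r * (t - S y)"]) (auto simp: TS)
    qed
  next
    case False
    hence "x \<le> S y" by simp
    thus ?thesis
    proof (rule DERIV_nonpos_imp_nonincreasing)
      fix t assume "x \<le> t" "t \<le> S y"
      thus "\<exists>d. (h has_real_derivative d) (at t) \<and> d \<le> 0"
        using slope_lower[of t "S y"] dh[of t] by (intro exI[of _ "T t - y - r * (t - S y)"]) (auto simp: TS algebra_simps)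
    qed
  qed
  hence "r / 2 * (x - S y)\<^sup>2 \<le> U x - U (S y) - (x - S y) * y" by (simp add: h_def)
  also have "\<dots> = U x + V y - x * y" using eq[of "S y"] by (simp add: TS algebra_simps)
  finally have 1: "r / 2 * (x - S y)\<^sup>2 \<le> U x + V y - x * y" .
  have "r * \<bar>T x - y\<bar> \<le> \<bar>x - S y\<bar>" using T_abs_upper[of x "S y"] r by (simp add: TS field_simps)
  hence "(r * \<bar>T x - y\<bar>)\<^sup>2 \<le> (x - S y)\<^sup>2" using power_mono[of "r * \<bar>T x - y\<bar>" "\<bar>x - S y\<bar>" 2] r by simp
  hence "r / 2 * (r\<^sup>2 * (T x - y)\<^sup>2) \<le> r / 2 * (x - S y)\<^sup>2"
    using r by (intro mult_left_mono) (auto simp: power_mult_distrib)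
  moreover have "r ^ 3 / 2 * (y - T x)\<^sup>2 = r / 2 * (r\<^sup>2 * (T x - y)\<^sup>2)"
    by (simp add: power3_eq_cube power2_eq_square[of r] power2_commute[of y])
  ultimately show ?thesis using 1 by linarith
qed

lemma potential_gap_nonneg:
  assumes "potentials U V" shows "0 \<le> U x + V y - x * y"
proof -
  have "0 \<le> r ^ 3 / 2 * (y - T x)\<^sup>2" using r by simp
  thus ?thesis using potential_gap_lower[OF assms, of y x] by linarith
qed

text \<open>
  \<open>V\<close> is the Legendre transform of \<open>U\<close>. The tangent inequality for \<open>U\<close> squeezes the difference
  quotients of \<open>V\<close> between values of the continuous function \<open>S\<close>, so \<open>V\<close> is differentiable although
  \<open>T\<close> need not be.
\<close>

lemma potentials_exist: "\<exists>U V. potentials U V"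
proof -
  have "\<exists>U. \<forall>x. - \<infinity> < ereal x \<longrightarrow> ereal x < \<infinity> \<longrightarrow> (U has_vector_derivative T x) (at x)"
    by (rule einterval_antiderivative) (simp_all add: T_isCont)
  then obtain U where dU: "\<And>x. (U has_real_derivative T x) (at x)"
    by (auto simp: has_real_derivative_iff_has_vector_derivative)
  define V where "V y = S y * y - U (S y)" for y
  interpret inv: transport S T r by (rule transport_inverse)
  have tangent: "U s \<ge> U t + (s - t) * T t" for s t
  proof (cases "t < s")
    case True
    then obtain z where "t < z" "z < s" "U s - U t = (s - t) * T z"
      using MVT2[of t s U T] dU by blast
    moreover have "(s - t) * T t \<le> (s - t) * T z" using \<open>t < z\<close> True by (intro mult_left_mono T_mono) auto
    ultimately show ?thesis by linarith
  next
    case False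
    show ?thesis
    proof (cases "s = t")
      case False
      with \<open>\<not> t < s\<close> have st: "s < t" by simp
      then obtain z where "s < z" "z < t" "U t - U s = (t - s) * T z"
        using MVT2[of s t U T] dU by blast
      moreover from this have "(t - s) * T z \<le> (t - s) * T t" using st T_mono[of z t] by (intro mult_left_mono) auto
      moreover have "(s - t) * T t = - ((t - s) * T t)" by algebra
      ultimately show ?thesis by linarith
    qed simp
  qed
  have V1: "V y' - V y \<ge> S y * (y' - y)" for y y'
    using tangent[of "S y'" "S y"] tangent[of "S y" "S y'"] by (simp add: V_def TS algebra_simps)
  have "(V has_real_derivative S y) (at y)" for y
    unfolding has_field_derivative_iff
  proof (rule tendsto_sandwich[of "\<lambda>z. min (S z) (S y)" _ _ "\<lambda>z. max (S z) (S y)"])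
    have "isCont S y" by (rule inv.T_isCont)
    hence S: "(S \<longlongrightarrow> S y) (at y)" by (simp add: isCont_def)
    show "((\<lambda>z. min (S z) (S y)) \<longlongrightarrow> S y) (at y)" "((\<lambda>z. max (S z) (S y)) \<longlongrightarrow> S y) (at y)"
      using tendsto_min[OF S tendsto_const, of "S y"] tendsto_max[OF S tendsto_const, of "S y"] by simp_all
    have b: "min (S z) (S y) \<le> (V z - V y) / (z - y) \<and> (V z - V y) / (z - y) \<le> max (S z) (S y)" if "z \<noteq> y" for z
    proof (cases "z > y")
      case True
      hence "S y \<le> S z" by (simp add: S_le_iff)
      thus ?thesis using True V1[of y z] V1[of z y] by (auto simp: min_def max_def field_simps)
    next
      case False
      with that have "z < y" by simp
      moreover from this have "S z \<le> S y" by (simp add: S_le_iff)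
      ultimately show ?thesis using V1[of y z] V1[of z y] by (auto simp: min_def max_def field_simps)
    qed
    show "\<forall>\<^sub>F z in at y. min (S z) (S y) \<le> (V z - V y) / (z - y)" "\<forall>\<^sub>F z in at y. (V z - V y) / (z - y) \<le> max (S z) (S y)"
      using b by (auto simp: eventually_at_filter)
  qed
  moreover have "U x + V (T x) = x * T x" for x by (simp add: V_def ST)
  ultimately show ?thesis using dU unfolding potentials_def by blast
qed

end

section \<open>Total mass of the transported kernel\<close>

lemma exp_gauss_tail_le:
  fixes c h :: real
  assumes "c > 0" "h > 0"
  shows "exp (- (c / h)) / sqrt (4 * pi * h) \<le> sqrt h / c"
proof -
  have "c / h \<le> exp (c / h)" using exp_ge_add_one_self[of "c/h"] by linarith
  hence "exp (- (c / h)) \<le> h / c" using assms by (simp add: exp_minus field_simps)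
  moreover have "sqrt h \<le> sqrt (4 * pi * h)"
    using assms pi_ge_two mult_right_mono[of 1 "4 * pi" h] by (intro real_sqrt_le_mono) simp
  ultimately have "exp (- (c / h)) / sqrt (4 * pi * h) \<le> (h / c) / sqrt h"
    using assms by (intro frac_le) auto
  also have "\<dots> = sqrt h / c" using assms by (simp add: real_div_sqrt field_simps)
  finally show ?thesis .
qed

lemma uniform_partition_cover:
  fixes L x :: real
  assumes "n > 0" "0 \<le> x" "x \<le> L" "L > 0"
  shows "\<exists>i<n. real i * L / n \<le> x \<and> x \<le> real (Suc i) * L / n"
proof (cases "x = L")
  case True
  thus ?thesis using assms by (intro exI[of _ "n - 1"]) (auto simp: field_simps of_nat_diff)
next
  case False
  hence x: "x < L" using assms by simp
  define i where "i = nat \<lfloor>x * n / L\<rfloor>"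
  have i: "real i \<le> x * n / L" "x * n / L < real i + 1"
    unfolding i_def using assms by (auto simp: of_nat_nat)
  have "real i < n"
  proof -
    have "x * n / L < n" using x assms by (simp add: field_simps)
    thus ?thesis using i(1) by linarith
  qed
  thus ?thesis using i assms by (intro exI[of _ i]) (auto simp: field_simps)
qed

lemma sum_integral_partition:
  fixes g :: "real \<Rightarrow> real" and t :: "nat \<Rightarrow> real"
  assumes g: "continuous_on UNIV g" and t: "\<And>i. t i \<le> t (Suc i)"
  shows "(\<Sum>i<n. integral {t i..t (Suc i)} g) = integral {t 0..t n} g"
proof (induction n)
  case (Suc n)
  have "t 0 \<le> t n" by (metis t lift_Suc_mono_le le0)
  hence "integral {t 0..t n} g + integral {t n..t (Suc n)} g = integral {t 0..t (Suc n)} g"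
    by (intro Henstock_Kurzweil_Integration.integral_combine t integrable_continuous_real)
       (use g continuous_on_subset in blast)+
  with Suc show ?case by simp
qed simp

lemma integral_const_lower:
  fixes g :: "real \<Rightarrow> real"
  assumes g: "continuous_on UNIV g" and ab: "a \<le> b" and m: "\<And>t. a \<le> t \<Longrightarrow> t \<le> b \<Longrightarrow> m \<le> g t"
  shows "m * (b - a) \<le> integral {a..b} g"
proof -
  have "integral {a..b} (\<lambda>_. m) \<le> integral {a..b} g"
    by (intro Henstock_Kurzweil_Integration.integral_le integrable_continuous_real)
       (use m continuous_on_subset[OF g] in \<open>auto\<close>)
  thus ?thesis using ab by (simp add: mult.commute)
qed

text \<open>
  Cut \<open>[0, L]\<close> into intervals \<open>I i\<close> and let \<open>J i\<close> be their images under \<open>T\<close>. Over \<open>I i\<close>, points that are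
  further than \<open>\<eta>\<close> from \<open>J i\<close> have a gap of order \<open>\<eta>\<^sup>2\<close> and carry exponentially little mass. On the
  remaining rectangle \<open>r0\<close> and \<open>rt\<close> are almost constants \<open>M i\<close> and \<open>N i\<close>, and the bound over rectangles with
  \<open>\<mu>\<^sup>2 = M i / N i\<close> replaces \<open>sqrt (M i * N i)\<close> by the mean of \<open>M i * \<bar>I i\<bar>\<close> and \<open>N i * \<bar>J i\<bar>\<close>.
  These sum up to Riemann sums for \<open>r0\<close> and \<open>rt\<close>. Only the slopes of \<open>T\<close> enter, so the threshold \<open>h0\<close>
  is uniform in \<open>T\<close>.
\<close>

lemma kernel_mass_le:
  fixes r0 rt :: "real \<Rightarrow> real" and L \<delta> \<epsilon> r :: real
  assumes L: "L > 0" and d: "\<delta> * L \<le> 1/100" and eps: "\<epsilon> > 0"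
    and c0: "continuous_on UNIV r0" and ct: "continuous_on UNIV rt"
    and b0: "\<And>x. \<bar>r0 x - 1 / L\<bar> \<le> \<delta>" and bt: "\<And>x. \<bar>rt x - 1 / L\<bar> \<le> \<delta>"
    and r_eq: "r = 99/101"
  shows "\<exists>h0>0. \<forall>h T S U V. 0 < h \<longrightarrow> h < h0 \<longrightarrow> transport T S r \<longrightarrow> T 0 = 0 \<longrightarrow> T L = L \<longrightarrow> transport.potentials T S U V \<longrightarrow>
    (\<integral>\<^sup>+x. \<integral>\<^sup>+y. ennreal (sqrt (r0 x * rt y) * exp (- ((U x + V y - x * y) / (2 * h))) / sqrt (4 * pi * h))
        * (indicator {0..L} x * indicator {0..L} y) \<partial>lborel \<partial>lborel)
    \<le> ennreal ((integral {0..L} r0 + integral {0..L} rt) / 2 + \<epsilon>)"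
proof -
  have Lpos: "1 / L > 0" using L by simp
  have dL: "\<delta> \<le> 1 / (100 * L)" using d L by (simp add: field_simps)
  have lo: "99 / (100 * L) \<le> r0 x" "99 / (100 * L) \<le> rt x"
    and up: "r0 x \<le> 101 / (100 * L)" "rt x \<le> 101 / (100 * L)" for x
  proof -
    have e: "99 / (100 * L) = 1 / L - 1 / (100 * L)" "101 / (100 * L) = 1 / L + 1 / (100 * L)"
      using L by (simp_all add: field_simps)
    show "99 / (100 * L) \<le> r0 x" "99 / (100 * L) \<le> rt x" "r0 x \<le> 101 / (100 * L)" "rt x \<le> 101 / (100 * L)"
      using b0[of x] bt[of x] dL unfolding e abs_le_iff by linarith+
  qed
  define \<epsilon>' where "\<epsilon>' = min (\<epsilon> / (8 * L)) (1 / (100 * L))"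
  have e': "\<epsilon>' > 0" "\<epsilon>' \<le> \<epsilon> / (8 * L)" "\<epsilon>' \<le> 1 / (100 * L)" using eps L by (auto simp: \<epsilon>'_def)
  have uc: "uniformly_continuous_on {0..L} r0" "uniformly_continuous_on {0..L} rt"
    using c0 ct continuous_on_subset by (auto intro!: compact_uniformly_continuous)
  then obtain \<omega>0 \<omega>t where w0: "\<omega>0 > 0" "\<And>x y. x \<in> {0..L} \<Longrightarrow> y \<in> {0..L} \<Longrightarrow> dist y x < \<omega>0 \<Longrightarrow> dist (r0 y) (r0 x) < \<epsilon>'"
    and wt: "\<omega>t > 0" "\<And>x y. x \<in> {0..L} \<Longrightarrow> y \<in> {0..L} \<Longrightarrow> dist y x < \<omega>t \<Longrightarrow> dist (rt y) (rt x) < \<epsilon>'"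
    unfolding uniformly_continuous_on_def using e'(1) by metis
  define \<omega> where "\<omega> = min \<omega>0 \<omega>t"
  have w: "\<omega> > 0" "\<And>x y. x \<in> {0..L} \<Longrightarrow> y \<in> {0..L} \<Longrightarrow> \<bar>y - x\<bar> < \<omega> \<Longrightarrow> \<bar>r0 y - r0 x\<bar> \<le> \<epsilon>'"
    "\<And>x y. x \<in> {0..L} \<Longrightarrow> y \<in> {0..L} \<Longrightarrow> \<bar>y - x\<bar> < \<omega> \<Longrightarrow> \<bar>rt y - rt x\<bar> \<le> \<epsilon>'"
    using w0 wt unfolding \<omega>_def dist_real_def by (auto intro: less_imp_le)
  obtain n :: nat where n0: "4 * L / \<omega> < real n" using reals_Archimedean2 by blast
  have n: "n > 0" using n0 L w by (metis less_le_trans not_gr0 of_nat_0 zero_less_divide_iff mult_pos_pos zero_less_numeral less_asym)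
  have nw: "2 * L / n < \<omega> / 2" using n0 n w by (simp add: field_simps)
  have lw: "L / n < \<omega>"
  proof -
    have "2 * L / n = 2 * (L / n)" by simp
    moreover have "L / n > 0" using L n by simp
    ultimately show ?thesis using nw w(1) by linarith
  qed
  \<comment> \<open>the enlargement by \<open>\<eta>\<close> costs \<open>2 * \<eta> / L\<close> for each of the \<open>n\<close> rectangles\<close>
  define \<eta> where "\<eta> = min (\<omega> / 2) (\<epsilon> * L / (8 * n))"
  have eta: "\<eta> > 0" "\<eta> \<le> \<omega> / 2" "\<eta> \<le> \<epsilon> * L / (8 * n)" using w eps L n by (auto simp: \<eta>_def)
  define c where "c = r ^ 3 * \<eta>\<^sup>2 / 4"
  have c: "c > 0" using eta r_eq by (simp add: c_def)
  define h0 where "h0 = (\<epsilon> * c / (8 * L))\<^sup>2"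
  have h0: "h0 > 0" using eps c L by (simp add: h0_def)
  show ?thesis
  proof (intro exI[of _ h0] conjI h0 allI impI)
    fix h T S U V
    assume h: "0 < h" "h < h0" and tr: "transport T S r" and T0: "T 0 = 0" and TL: "T L = L"
      and pot: "transport.potentials T S U V"
    interpret transport T S r by fact
    interpret inv: transport S T r by (rule transport_inverse)
    have dU: "\<And>t. (U has_real_derivative T t) (at t)" and dV: "\<And>t. (V has_real_derivative S t) (at t)"
      using pot by (auto simp: potentials_def)
    note gap = potential_gap_lower[OF pot] potential_gap_nonneg[OF pot]
    have [measurable]: "U \<in> borel_measurable borel" "V \<in> borel_measurable borel"
      by (meson DERIV_isCont continuous_at_imp_continuous_on dU dV borel_measurable_continuous_onI)+
    have [measurable]: "r0 \<in> borel_measurable borel" "rt \<in> borel_measurable borel"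
      using c0 ct by (auto intro: borel_measurable_continuous_onI)
    define x where "x i = real i * L / n" for i :: nat
    define y where "y i = T (x i)" for i
    have x_mono: "x i \<le> x (Suc i)" for i using L n by (simp add: x_def field_simps)
    have x_step: "x (Suc i) - x i = L / n" for i using n by (simp add: x_def field_simps)
    have x_in: "x i \<in> {0..L}" if "i \<le> n" for i using that L n by (auto simp: x_def field_simps)
    have T_in: "T t \<in> {0..L}" if "t \<in> {0..L}" for t
      using T_mono[of 0 t] T_mono[of t L] that T0 TL by auto
    have y_mono: "y i \<le> y (Suc i)" for i unfolding y_def by (intro T_mono x_mono)
    have y_in: "y i \<in> {0..L}" if "i \<le> n" for i unfolding y_def by (intro T_in x_in that)
    have y_step: "y (Suc i) - y i \<le> 2 * L / n" for i
    proof -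
      have "y (Suc i) - y i \<le> (L / n) / r" unfolding y_def using slope_upper[OF x_mono[of i]] x_step[of i] by simp
      also have "\<dots> \<le> 2 * L / n" using L n by (simp add: r_eq field_simps)
      finally show ?thesis .
    qed
    define M where "M i = r0 (x i) + \<epsilon>'" for i
    define N where "N i = rt (y i) + \<epsilon>'" for i
    have MN: "99 / (100 * L) \<le> M i" "M i \<le> 102 / (100 * L)" "99 / (100 * L) \<le> N i" "N i \<le> 102 / (100 * L)" for i
    proof -
      have "102 / (100 * L) = 101 / (100 * L) + 1 / (100 * L)" using L by (simp add: field_simps)
      thus "99 / (100 * L) \<le> M i" "M i \<le> 102 / (100 * L)" "99 / (100 * L) \<le> N i" "N i \<le> 102 / (100 * L)"
        using lo[of "x i"] up[of "x i"] lo[of "y i"] up[of "y i"] e' unfolding M_def N_def by linarith+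
    qed
    have q0: "99 / (100 * L) > 0" using L by simp
    have pos: "0 \<le> r0 t" "0 \<le> rt t" for t using order_trans[OF less_imp_le[OF q0] lo(1)] order_trans[OF less_imp_le[OF q0] lo(2)] by simp_all
    have MN0: "M i > 0" "N i > 0" for i using MN(1,3)[of i] q0 by linarith+
    define \<mu> where "\<mu> i = sqrt (M i / N i)" for i
    have mu: "\<mu> i > 0" "(\<mu> i)\<^sup>2 = M i / N i" for i using MN0[of i] by (auto simp: \<mu>_def)
    define K where "K x y = exp (- ((U x + V y - x * y) / (2 * h)))" for x y
    have [measurable]: "(\<lambda>p. K (fst p) (snd p)) \<in> borel_measurable (borel \<Otimes>\<^sub>M borel)" unfolding K_def by measurable
    define tail where "tail = 2 / L * (exp (- (c / h)) / sqrt (4 * pi * h))"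
    have s0: "sqrt (4 * pi * h) > 0" using h by simp
    have tail0: "tail \<ge> 0" unfolding tail_def using L s0 by (intro mult_nonneg_nonneg divide_nonneg_pos) auto
    define box where "box i x' y' = indicator {x i..x (Suc i)} x' * (indicator {y i - \<eta>..y (Suc i) + \<eta>} y' :: ennreal)" for i x' y'
    define w' where "w' i = sqrt (M i * N i) / sqrt (4 * pi * h)" for i
    have w'0: "w' i \<ge> 0" for i using MN0[of i] h by (simp add: w'_def)
    have pointwise: "ennreal (sqrt (r0 x' * rt y') * K x' y' / sqrt (4 * pi * h)) * (indicator {0..L} x' * indicator {0..L} y')
       \<le> (\<Sum>i<n. ennreal (w' i) * (ennreal (K x' y') * box i x' y')) + ennreal tail * (indicator {0..L} x' * indicator {0..L} y')"
      (is "?lhs \<le> ?rhs") for x' y'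
    proof (cases "x' \<in> {0..L} \<and> y' \<in> {0..L}")
      case True
      hence xy: "x' \<in> {0..L}" "y' \<in> {0..L}" by auto
      obtain i where i: "i < n" "x i \<le> x'" "x' \<le> x (Suc i)"
        using uniform_partition_cover[OF n, of x' L] xy L by (auto simp: x_def)
      have yx: "y i \<le> T x'" "T x' \<le> y (Suc i)" unfolding y_def using i by (auto intro: T_mono)
      show ?thesis
      proof (cases "y' \<in> {y i - \<eta>..y (Suc i) + \<eta>}")
        case y': True
        have "\<bar>x' - x i\<bar> < \<omega>" using i x_step[of i] lw by linarith
        hence "r0 x' \<le> M i" using w(2)[of "x i" x'] xy x_in[of i] i unfolding M_def by auto
        moreover have "\<bar>y' - y i\<bar> < \<omega>"
          using y' y_step[of i] nw eta y_mono[of i] w(1) unfolding atLeastAtMost_iff abs_less_iff by linarith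
        hence "rt y' \<le> N i" using w(3)[of "y i" y'] xy y_in[of i] i unfolding N_def by auto
        ultimately have "r0 x' * rt y' \<le> M i * N i"
          using pos MN0[of i] by (intro mult_mono) auto
        hence "sqrt (r0 x' * rt y') * K x' y' / sqrt (4 * pi * h) \<le> w' i * K x' y'"
          unfolding w'_def using s0 by (auto simp: K_def intro!: divide_right_mono)
        hence "?lhs \<le> ennreal (w' i * K x' y')" using xy by (simp add: ennreal_leI)
        also have "\<dots> = ennreal (w' i) * (ennreal (K x' y') * box i x' y')"
          using w'0 i y' by (simp add: box_def ennreal_mult' K_def)
        also have "\<dots> \<le> (\<Sum>i<n. ennreal (w' i) * (ennreal (K x' y') * box i x' y'))"
          using i(1) by (intro member_le_sum[of i]) auto
        also have "\<dots> \<le> ?rhs" by simp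
        finally show ?thesis .
      next
        case False
        hence "\<eta> \<le> \<bar>y' - T x'\<bar>" using yx by auto
        hence "\<eta>\<^sup>2 \<le> (y' - T x')\<^sup>2" using eta by (metis abs_ge_zero power2_abs power_mono less_imp_le)
        hence "r ^ 3 / 2 * \<eta>\<^sup>2 \<le> r ^ 3 / 2 * (y' - T x')\<^sup>2" using r_eq by (intro mult_left_mono) auto
        also note gap(1)[of y' x']
        finally have "2 * c \<le> U x' + V y' - x' * y'" by (simp add: c_def mult.commute)
        hence "2 * c / (2 * h) \<le> (U x' + V y' - x' * y') / (2 * h)" using h by (intro divide_right_mono) auto
        hence K: "K x' y' \<le> exp (- (c / h))" by (simp add: K_def)
        have "r0 x' * rt y' \<le> (2 / L) * (2 / L)"
          using pos order_trans[OF up(1), of "2 / L" x'] order_trans[OF up(2), of "2 / L" y'] L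
          by (intro mult_mono) (auto simp: field_simps)
        hence "sqrt (r0 x' * rt y') \<le> sqrt ((2 / L)\<^sup>2)" by (simp add: power2_eq_square)
        also have "\<dots> = 2 / L" using L by (subst real_sqrt_abs) simp
        finally have "sqrt (r0 x' * rt y') * K x' y' / sqrt (4 * pi * h) \<le> tail"
          unfolding tail_def times_divide_eq_right using K s0 L
          by (intro divide_right_mono mult_mono) (auto simp: K_def)
        hence "?lhs \<le> ennreal tail * (indicator {0..L} x' * indicator {0..L} y')" using xy by (simp add: ennreal_leI)
        also have "\<dots> \<le> ?rhs" by simp
        finally show ?thesis .
      qed
    qed auto
    \<comment> \<open>\<open>M i\<close> and \<open>N i\<close> are within two per cent of \<open>1 / L\<close>, so the slopes of \<open>T\<close> differ little from \<open>(\<mu> i)\<^sup>2\<close>\<close>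
    have boxint: "(\<integral>\<^sup>+x'. \<integral>\<^sup>+y'. ennreal (K x' y') * box i x' y' \<partial>lborel \<partial>lborel)
        \<le> ennreal (sqrt (pi * h) * (\<mu> i * (x (Suc i) - x i) + (y (Suc i) - y i + 2 * \<eta>) / \<mu> i))" for i
    proof -
      have ratio: "99/102 \<le> (\<mu> i)\<^sup>2" "(\<mu> i)\<^sup>2 \<le> 102/99"
      proof -
        have "99/102 * N i \<le> 99/102 * (102 / (100 * L))" "99/102 * M i \<le> 99/102 * (102 / (100 * L))"
          using MN[of i] by (intro mult_left_mono; simp)+
        hence "99/102 * N i \<le> M i" "99/102 * M i \<le> N i" using MN[of i] by simp_all
        thus "99/102 \<le> (\<mu> i)\<^sup>2" "(\<mu> i)\<^sup>2 \<le> 102/99" unfolding mu(2) using MN0[of i] by (simp_all add: field_simps)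
      qed
      have eq: "(y (Suc i) - y i + 2 * \<eta>) = (y (Suc i) + \<eta>) - (y i - \<eta>)" by simp
      show ?thesis unfolding eq K_def box_def
      proof (rule box_integral_le[OF dU dV _ _ gap(2) mu(1) h(1) x_mono])
        show "\<bar>T s - T t - (\<mu> i)\<^sup>2 * (s - t)\<bar> \<le> (\<mu> i)\<^sup>2 / 10 * \<bar>s - t\<bar>" for s t
          using ratio by (intro slope_near_square mu) (auto simp: r_eq)
        have inv2: "(1 / \<mu> i)\<^sup>2 = 1 / (\<mu> i)\<^sup>2" by (simp add: power_divide)
        have "99/102 \<le> 1 / (\<mu> i)\<^sup>2" "1 / (\<mu> i)\<^sup>2 \<le> 102/99"
          using ratio mu(1)[of i] by (simp_all add: field_simps)
        hence "\<bar>S s - S t - (1 / \<mu> i)\<^sup>2 * (s - t)\<bar> \<le> (1 / \<mu> i)\<^sup>2 / 10 * \<bar>s - t\<bar>" for s t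
          using mu(1)[of i] by (intro inv.slope_near_square) (auto simp: r_eq inv2)
        thus "\<bar>S s - S t - (s - t) / (\<mu> i)\<^sup>2\<bar> \<le> 1 / (10 * (\<mu> i)\<^sup>2) * \<bar>s - t\<bar>" for s t
          by (simp add: inv2 mult.commute)
        show "y i - \<eta> \<le> y (Suc i) + \<eta>" using y_mono[of i] eta by simp
      qed
    qed
    have term_eq: "w' i * (sqrt (pi * h) * (\<mu> i * a + b / \<mu> i)) = (M i * a + N i * b) / 2" for i a b
    proof -
      have "sqrt (4 * pi * h) = 2 * sqrt (pi * h)" by (simp add: real_sqrt_mult)
      moreover have "sqrt (pi * h) \<noteq> 0" using h by simp
      ultimately have w1: "w' i * (sqrt (pi * h) * z) = sqrt (M i * N i) * z / 2" for z unfolding w'_def by simp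
      have m1: "sqrt (M i * N i) * \<mu> i = M i"
        using MN0[of i] by (simp add: \<mu>_def real_sqrt_mult real_sqrt_divide)
      have m2: "sqrt (M i * N i) / \<mu> i = N i"
        using MN0[of i] by (simp add: \<mu>_def real_sqrt_mult real_sqrt_divide)
      have "sqrt (M i * N i) * (\<mu> i * a + b / \<mu> i) = sqrt (M i * N i) * \<mu> i * a + sqrt (M i * N i) / \<mu> i * b"
        by (simp add: algebra_simps)
      thus ?thesis unfolding w1 m1 m2 by simp
    qed
    have I0: "M i * (x (Suc i) - x i) \<le> integral {x i..x (Suc i)} r0 + 2 * \<epsilon>' * (x (Suc i) - x i)" if "i < n" for i
    proof -
      have "(M i - 2 * \<epsilon>') * (x (Suc i) - x i) \<le> integral {x i..x (Suc i)} r0"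
      proof (rule integral_const_lower[OF c0 x_mono])
        fix t assume t: "x i \<le> t" "t \<le> x (Suc i)"
        have "\<bar>t - x i\<bar> < \<omega>" using t x_step[of i] lw by linarith
        moreover have "t \<in> {0..L}" using t x_in[of i] x_in[of "Suc i"] that by auto
        ultimately show "M i - 2 * \<epsilon>' \<le> r0 t" using w(2)[of "x i" t] x_in[of i] that unfolding M_def by auto
      qed
      thus ?thesis by (simp add: algebra_simps)
    qed
    have It: "N i * (y (Suc i) - y i) \<le> integral {y i..y (Suc i)} rt + 2 * \<epsilon>' * (y (Suc i) - y i)" if "i < n" for i
    proof -
      have "(N i - 2 * \<epsilon>') * (y (Suc i) - y i) \<le> integral {y i..y (Suc i)} rt"
      proof (rule integral_const_lower[OF ct y_mono])
        fix t assume t: "y i \<le> t" "t \<le> y (Suc i)"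
        have "\<bar>t - y i\<bar> < \<omega>" using t y_step[of i] nw w(1) by linarith
        moreover have "t \<in> {0..L}" using t y_in[of i] y_in[of "Suc i"] that by auto
        ultimately show "N i - 2 * \<epsilon>' \<le> rt t" using w(3)[of "y i" t] y_in[of i] that unfolding N_def by auto
      qed
      thus ?thesis by (simp add: algebra_simps)
    qed
    have xn: "x 0 = 0" "x n = L" "y 0 = 0" "y n = L" using n T0 TL by (auto simp: x_def y_def)
    have "(\<integral>\<^sup>+x'. \<integral>\<^sup>+y'. ennreal (sqrt (r0 x' * rt y') * K x' y' / sqrt (4 * pi * h)) * (indicator {0..L} x' * indicator {0..L} y') \<partial>lborel \<partial>lborel)
      \<le> (\<integral>\<^sup>+x'. \<integral>\<^sup>+y'. (\<Sum>i<n. ennreal (w' i) * (ennreal (K x' y') * box i x' y')) + ennreal tail * (indicator {0..L} x' * indicator {0..L} y') \<partial>lborel \<partial>lborel)"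
      by (intro nn_integral_mono pointwise)
    also have "\<dots> = (\<Sum>i<n. ennreal (w' i) * (\<integral>\<^sup>+x'. \<integral>\<^sup>+y'. ennreal (K x' y') * box i x' y' \<partial>lborel \<partial>lborel)) + ennreal tail * (ennreal L * ennreal L)"
      unfolding box_def using L
      by (simp add: nn_integral_add nn_integral_sum nn_integral_cmult nn_integral_multc K_def mult.assoc)
    also have "\<dots> \<le> (\<Sum>i<n. ennreal (w' i) * ennreal (sqrt (pi * h) * (\<mu> i * (x (Suc i) - x i) + (y (Suc i) - y i + 2 * \<eta>) / \<mu> i))) + ennreal tail * (ennreal L * ennreal L)"
      by (intro add_right_mono sum_mono mult_left_mono boxint) auto
    also have "\<dots> = ennreal ((\<Sum>i<n. w' i * (sqrt (pi * h) * (\<mu> i * (x (Suc i) - x i) + (y (Suc i) - y i + 2 * \<eta>) / \<mu> i))) + tail * (L * L))"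
    proof -
      define bx where "bx i = sqrt (pi * h) * (\<mu> i * (x (Suc i) - x i) + (y (Suc i) - y i + 2 * \<eta>) / \<mu> i)" for i
      have bx: "bx i \<ge> 0" for i
        unfolding bx_def using mu(1)[of i] x_mono[of i] y_mono[of i] eta(1) h by (intro mult_nonneg_nonneg add_nonneg_nonneg divide_nonneg_pos) auto
      have "(\<Sum>i<n. ennreal (w' i) * ennreal (bx i)) = ennreal (\<Sum>i<n. w' i * bx i)"
        using w'0 bx by (subst sum_ennreal[symmetric]) (auto simp: ennreal_mult')
      moreover have "ennreal tail * (ennreal L * ennreal L) = ennreal (tail * (L * L))"
        using tail0 L by (simp add: ennreal_mult')
      moreover have "0 \<le> (\<Sum>i<n. w' i * bx i)" using w'0 bx by (intro sum_nonneg mult_nonneg_nonneg) auto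
      ultimately show ?thesis unfolding bx_def[symmetric] using tail0 L by (simp add: ennreal_plus)
    qed
    also have "\<dots> \<le> ennreal ((integral {0..L} r0 + integral {0..L} rt) / 2 + \<epsilon>)"
    proof (rule ennreal_leI)
      have "(\<Sum>i<n. w' i * (sqrt (pi * h) * (\<mu> i * (x (Suc i) - x i) + (y (Suc i) - y i + 2 * \<eta>) / \<mu> i)))
        = (\<Sum>i<n. (M i * (x (Suc i) - x i) + N i * (y (Suc i) - y i + 2 * \<eta>)) / 2)"
        by (simp only: term_eq)
      also have "\<dots> \<le> (\<Sum>i<n. (integral {x i..x (Suc i)} r0 + 2 * \<epsilon>' * (x (Suc i) - x i)
           + (integral {y i..y (Suc i)} rt + 2 * \<epsilon>' * (y (Suc i) - y i)) + 2 / L * (2 * \<eta>)) / 2)"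
      proof (rule sum_mono)
        fix i assume i: "i \<in> {..<n}"
        have "N i \<le> 2 / L" using MN(4)[of i] L by (simp add: field_simps)
        hence "N i * (2 * \<eta>) \<le> 2 / L * (2 * \<eta>)" using eta by (intro mult_right_mono) auto
        moreover have "N i * (y (Suc i) - y i + 2 * \<eta>) = N i * (y (Suc i) - y i) + N i * (2 * \<eta>)" by (simp add: algebra_simps)
        ultimately show "(M i * (x (Suc i) - x i) + N i * (y (Suc i) - y i + 2 * \<eta>)) / 2
          \<le> (integral {x i..x (Suc i)} r0 + 2 * \<epsilon>' * (x (Suc i) - x i)
           + (integral {y i..y (Suc i)} rt + 2 * \<epsilon>' * (y (Suc i) - y i)) + 2 / L * (2 * \<eta>)) / 2"
          using I0[of i] It[of i] i by simp
      qed
      also have "\<dots> = (integral {0..L} r0 + integral {0..L} rt) / 2 + 2 * \<epsilon>' * L + real n * (2 * \<eta> / L)"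
      proof -
        have t: "(\<Sum>i<n. x (Suc i) - x i) = L" "(\<Sum>i<n. y (Suc i) - y i) = L"
          using xn by (simp_all add: sum_lessThan_telescope)
        have "(\<Sum>i<n. integral {x i..x (Suc i)} r0) = integral {0..L} r0" "(\<Sum>i<n. integral {y i..y (Suc i)} rt) = integral {0..L} rt"
          using sum_integral_partition[OF c0, of x n] sum_integral_partition[OF ct, of y n] x_mono y_mono xn by simp_all
        thus ?thesis
          by (simp add: sum_divide_distrib[symmetric] sum.distrib sum_distrib_left[symmetric] t) (simp add: field_simps)
      qed
      also have "\<dots> \<le> (integral {0..L} r0 + integral {0..L} rt) / 2 + \<epsilon> / 4 + \<epsilon> / 4"
      proof -
        have "2 * \<epsilon>' * L \<le> \<epsilon> / 4" using e'(2) L by (simp add: field_simps)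
        moreover have "real n * (2 * \<eta> / L) \<le> \<epsilon> / 4" using eta(3) L n by (simp add: field_simps)
        ultimately show ?thesis by linarith
      qed
      also have "\<dots> = (integral {0..L} r0 + integral {0..L} rt) / 2 + \<epsilon> / 2" by simp
      finally have 1: "(\<Sum>i<n. w' i * (sqrt (pi * h) * (\<mu> i * (x (Suc i) - x i) + (y (Suc i) - y i + 2 * \<eta>) / \<mu> i)))
         \<le> (integral {0..L} r0 + integral {0..L} rt) / 2 + \<epsilon> / 2" .
      have "sqrt h \<le> \<epsilon> * c / (8 * L)"
        using real_sqrt_less_mono[OF h(2)] eps c L unfolding h0_def by (simp add: abs_mult)
      hence "sqrt h / c \<le> (\<epsilon> * c / (8 * L)) / c" using c by (intro divide_right_mono) auto
      hence "exp (- (c / h)) / sqrt (4 * pi * h) \<le> \<epsilon> / (8 * L)"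
        using exp_gauss_tail_le[OF c h(1)] c by simp
      hence "tail \<le> 2 / L * (\<epsilon> / (8 * L))" unfolding tail_def using L by (intro mult_left_mono) auto
      hence "tail * (L * L) \<le> 2 / L * (\<epsilon> / (8 * L)) * (L * L)" using L by (intro mult_right_mono) auto
      also have "\<dots> = \<epsilon> / 4" using L by simp
      finally show "(\<Sum>i<n. w' i * (sqrt (pi * h) * (\<mu> i * (x (Suc i) - x i) + (y (Suc i) - y i + 2 * \<eta>) / \<mu> i))) + tail * (L * L)
          \<le> (integral {0..L} r0 + integral {0..L} rt) / 2 + \<epsilon>" using 1 eps by linarith
    qed
    finally show "(\<integral>\<^sup>+x. \<integral>\<^sup>+y. ennreal (sqrt (r0 x * rt y) * exp (- ((U x + V y - x * y) / (2 * h))) / sqrt (4 * pi * h))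
        * (indicator {0..L} x * indicator {0..L} y) \<partial>lborel \<partial>lborel)
      \<le> ennreal ((integral {0..L} r0 + integral {0..L} rt) / 2 + \<epsilon>)" by (simp add: K_def)
  qed
qed

section \<open>Relative entropy\<close>

lemma mult_ln_ge_neg_one:
  fixes x :: real assumes "x \<ge> 0" shows "- (x * ln x) \<le> 1"
proof (cases "x = 0")
  case False
  with assms have "ln (1 / x) \<le> 1 / x - 1" by (intro ln_le_minus_one) auto
  hence "x * ln (1 / x) \<le> x * (1 / x - 1)" using assms by (intro mult_left_mono) auto
  thus ?thesis using False assms by (simp add: ln_div algebra_simps)
qed simp

lemma relative_entropy_eq_integral:
  fixes q p :: "'a measure"
  assumes ac: "absolutely_continuous p q"
    and int: "integrable p (\<lambda>z. enn2real (RN_deriv p q z) * ln (enn2real (RN_deriv p q z)))"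
  shows "relative_entropy q p = ereal (\<integral>z. enn2real (RN_deriv p q z) * ln (enn2real (RN_deriv p q z)) \<partial>p)"
proof -
  define g where "g z = enn2real (RN_deriv p q z) * ln (enn2real (RN_deriv p q z))" for z
  have "(\<integral>\<^sup>+z. ennreal (g z) \<partial>p) \<noteq> \<infinity>" "(\<integral>\<^sup>+z. ennreal (- g z) \<partial>p) \<noteq> \<infinity>"
    using int unfolding g_def[symmetric] real_integrable_def by auto
  then obtain a b where ab: "(\<integral>\<^sup>+z. ennreal (g z) \<partial>p) = ennreal a" "a \<ge> 0" "(\<integral>\<^sup>+z. ennreal (- g z) \<partial>p) = ennreal b" "b \<ge> 0"
    by (metis ennreal_cases infinity_ennreal_def)
  have "integral\<^sup>L p g = a - b" using int unfolding g_def[symmetric] by (subst real_lebesgue_integral_def) (auto simp: ab)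
  thus ?thesis using ac unfolding relative_entropy_def Let_def g_def[symmetric] ab by (simp add: ab)
qed

lemma relative_entropy_density:
  fixes p :: "'a measure" and \<phi> :: "'a \<Rightarrow> real"
  assumes p: "sigma_finite_measure p" and [measurable]: "\<phi> \<in> borel_measurable p" and nn: "\<And>z. \<phi> z \<ge> 0"
    and int: "integrable p (\<lambda>z. \<phi> z * ln (\<phi> z))"
  shows "relative_entropy (density p (\<lambda>z. ennreal (\<phi> z))) p = ereal (\<integral>z. \<phi> z * ln (\<phi> z) \<partial>p)"
proof -
  let ?q = "density p (\<lambda>z. ennreal (\<phi> z))"
  interpret p: sigma_finite_measure p by fact
  have "AE z in p. ennreal (\<phi> z) = RN_deriv p ?q z" by (rule p.RN_deriv_unique) auto
  hence eq: "AE z in p. \<phi> z * ln (\<phi> z) = enn2real (RN_deriv p ?q z) * ln (enn2real (RN_deriv p ?q z))"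
  proof eventually_elim
    case (elim z)
    show ?case unfolding elim[symmetric] using nn by simp
  qed
  have ac: "absolutely_continuous p ?q"
    by (rule absolutely_continuousI_density) auto
  have "integrable p (\<lambda>z. enn2real (RN_deriv p ?q z) * ln (enn2real (RN_deriv p ?q z)))"
    using int by (rule integrable_cong_AE_imp) (use eq in auto)
  thus ?thesis using relative_entropy_eq_integral[OF ac] integral_cong_AE[OF _ _ eq] by simp
qed

text \<open>
  The Fenchel-Young inequality for \<open>x ln x\<close>, with the normalising constant \<open>Z\<close> split off.
\<close>

lemma mult_ln_young:
  fixes x f Z :: real assumes "x \<ge> 0" "Z > 0"
  shows "x * (f - ln Z) + x - exp f / Z \<le> x * ln x"
proof (cases "x = 0")
  case False
  with assms have x: "x > 0" by simp
  have "ln (exp f / (Z * x)) \<le> exp f / (Z * x) - 1" using x assms by (intro ln_le_minus_one) auto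
  hence "x * ln (exp f / (Z * x)) \<le> x * (exp f / (Z * x) - 1)" using x by (intro mult_left_mono) auto
  also have "\<dots> = exp f / Z - x" using x assms by (simp add: field_simps)
  also have "ln (exp f / (Z * x)) = f - ln Z - ln x" using x assms by (simp add: ln_div ln_mult)
  finally show ?thesis by (simp add: algebra_simps)
qed (use assms in auto)

text \<open>
  One half of the Donsker-Varadhan formula. As \<open>D\<close> carries \<open>q\<close>, the exponential only has to be
  integrated over \<open>D\<close>; this is how the restriction of the second variable to \<open>[0, L]\<close>, invisible to
  the heat kernel, is taken into account.
\<close>

lemma relative_entropy_ge:
  fixes p q :: "'a measure" and f :: "'a \<Rightarrow> real"
  assumes p: "finite_measure p" and q: "prob_space q" and sets: "sets q = sets p"
    and f[measurable]: "f \<in> borel_measurable p" and D[measurable]: "D \<in> sets p"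
    and bnd: "\<And>z. z \<in> D \<Longrightarrow> \<bar>f z\<bar> \<le> B" and qD: "AE z in q. z \<in> D"
    and Z: "(\<integral>\<^sup>+z. ennreal (exp (f z)) * indicator D z \<partial>p) \<le> ennreal Z" and Zpos: "Z > 0"
  shows "ereal ((\<integral>z. f z \<partial>q) - ln Z) \<le> relative_entropy q p"
proof (cases "absolutely_continuous p q")
  case False
  thus ?thesis by (simp add: relative_entropy_def)
next
  case ac: True
  interpret p: finite_measure p by fact
  interpret q: prob_space q by fact
  define \<phi> where "\<phi> z = enn2real (RN_deriv p q z)" for z
  define g where "g z = \<phi> z * ln (\<phi> z)" for z
  have [measurable]: "\<phi> \<in> borel_measurable p" unfolding \<phi>_def by simp
  have [measurable]: "g \<in> borel_measurable p" unfolding g_def by measurable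
  have phi0: "\<phi> z \<ge> 0" for z by (simp add: \<phi>_def)
  have "AE z in p. RN_deriv p q z \<noteq> \<infinity>"
    by (rule p.RN_deriv_finite[OF q.sigma_finite_measure ac sets])
  hence RN: "AE z in p. RN_deriv p q z = ennreal (\<phi> z)"
    by eventually_elim (simp add: \<phi>_def ennreal_enn2real less_top)
  hence qd: "q = density p (\<lambda>z. ennreal (\<phi> z))"
    by (subst p.density_RN_deriv[OF ac sets, symmetric], intro density_cong) (use RN in auto)
  have neg: "(\<integral>\<^sup>+z. ennreal (- g z) \<partial>p) < \<infinity>"
  proof -
    have "(\<integral>\<^sup>+z. ennreal (- g z) \<partial>p) \<le> (\<integral>\<^sup>+z. 1 \<partial>p)"
      unfolding g_def using mult_ln_ge_neg_one[OF phi0] by (intro nn_integral_mono) (simp add: ennreal_le_1)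
    also have "\<dots> < \<infinity>" using p.emeasure_finite[of "space p"] by (simp add: less_top[symmetric])
    finally show ?thesis .
  qed
  show ?thesis
  proof (cases "(\<integral>\<^sup>+z. ennreal (g z) \<partial>p) = \<infinity>")
    case True
    have "relative_entropy q p = \<infinity> - enn2ereal (\<integral>\<^sup>+z. ennreal (- g z) \<partial>p)"
      using ac True by (simp add: relative_entropy_def Let_def g_def \<phi>_def)
    also have "\<dots> = \<infinity>" using neg by (cases "\<integral>\<^sup>+z. ennreal (- g z) \<partial>p") (auto simp: top_ereal_def)
    finally show ?thesis by simp
  next
    case False
    have gi: "integrable p g"
      using False neg by (subst real_integrable_def) (auto simp: less_top)
    have re: "relative_entropy q p = ereal (\<integral>z. g z \<partial>p)"
      using relative_entropy_eq_integral[OF ac] gi unfolding g_def \<phi>_def by simp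
    have "AE z in p. 0 < ennreal (\<phi> z) \<longrightarrow> z \<in> D"
      using qD unfolding qd by (subst (asm) AE_density) auto
    hence zero: "AE z in p. z \<notin> D \<longrightarrow> \<phi> z = 0"
    proof eventually_elim
      case (elim z)
      show ?case
      proof
        assume "z \<notin> D"
        with elim have "\<phi> z \<le> 0" by simp
        thus "\<phi> z = 0" using phi0[of z] by simp
      qed
    qed
    have ed: "integrable p (\<lambda>z. exp (f z) * indicator D z)"
    proof (rule integrableI_bounded)
      have "(\<integral>\<^sup>+z. ennreal (norm (exp (f z) * indicator D z)) \<partial>p) = (\<integral>\<^sup>+z. ennreal (exp (f z)) * indicator D z \<partial>p)"
        by (rule nn_integral_cong) (simp add: indicator_def)
      also have "\<dots> < \<infinity>" using order_le_less_trans[OF Z] by simp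
      finally show "(\<integral>\<^sup>+z. ennreal (norm (exp (f z) * indicator D z)) \<partial>p) < \<infinity>" .
    qed measurable
    have ez: "(\<integral>z. exp (f z) * indicator D z \<partial>p) \<le> Z"
    proof -
      have "ennreal (\<integral>z. exp (f z) * indicator D z \<partial>p) = (\<integral>\<^sup>+z. ennreal (exp (f z)) * indicator D z \<partial>p)"
        by (subst nn_integral_eq_integral[symmetric, OF ed]) (auto simp: indicator_def intro!: nn_integral_cong)
      hence "ennreal (\<integral>z. exp (f z) * indicator D z \<partial>p) \<le> ennreal Z" using Z by simp
      thus ?thesis using Zpos by (subst (asm) ennreal_le_iff) auto
    qed
    define f' where "f' z = f z * indicator D z" for z
    have [measurable]: "f' \<in> borel_measurable p" unfolding f'_def by measurable
    have meas_q: "h \<in> borel_measurable q" if "h \<in> borel_measurable p" for h :: "'a \<Rightarrow> real"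
      using that unfolding measurable_cong_sets[OF sets refl] .
    have fq: "integrable q f'"
    proof (rule q.integrable_const_bound[where B = "\<bar>B\<bar>"])
      have "norm (f' z) \<le> \<bar>B\<bar>" for z
        using bnd[of z] by (cases "z \<in> D") (auto simp: f'_def)
      thus "AE z in q. norm (f' z) \<le> \<bar>B\<bar>" by simp
      show "f' \<in> borel_measurable q" by (rule meas_q) simp
    qed
    have fp: "integrable p (\<lambda>z. \<phi> z * f' z)" "(\<integral>z. f' z \<partial>q) = (\<integral>z. \<phi> z * f' z \<partial>p)"
      using fq unfolding qd by (auto simp: integrable_real_density integral_real_density phi0)
    have one: "integrable p \<phi>" "(\<integral>z. \<phi> z \<partial>p) = 1"
    proof -
      have "integrable q (\<lambda>z. 1 :: real)" by simp
      thus "integrable p \<phi>" unfolding qd by (simp add: integrable_real_density phi0)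
      have "(\<integral>z. 1 \<partial>q) = (\<integral>z. \<phi> z * 1 \<partial>p)" unfolding qd by (intro integral_real_density) (auto simp: phi0)
      thus "(\<integral>z. \<phi> z \<partial>p) = 1" using q.prob_space by simp
    qed
    have "(\<integral>z. f z \<partial>q) = (\<integral>z. f' z \<partial>q)"
    proof (rule integral_cong_AE)
      show "AE z in q. f z = f' z" using qD by eventually_elim (simp add: f'_def)
    qed (rule meas_q, simp)+
    moreover have "(\<integral>z. exp (f z) * indicator D z \<partial>p) / Z \<le> 1" using ez Zpos by (simp only: divide_le_eq_1_pos)
    ultimately have "(\<integral>z. f z \<partial>q) - ln Z \<le> (\<integral>z. \<phi> z * f' z \<partial>p) - ln Z * (\<integral>z. \<phi> z \<partial>p) + (\<integral>z. \<phi> z \<partial>p) - (\<integral>z. exp (f z) * indicator D z \<partial>p) / Z"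
      unfolding one(2) fp(2) by linarith
    also have "\<dots> = (\<integral>z. \<phi> z * f' z - ln Z * \<phi> z + \<phi> z - exp (f z) * indicator D z / Z \<partial>p)"
      using fp one ed by simp
    also have "\<dots> \<le> (\<integral>z. g z \<partial>p)"
    proof (rule integral_mono_AE)
      show "AE z in p. \<phi> z * f' z - ln Z * \<phi> z + \<phi> z - exp (f z) * indicator D z / Z \<le> g z"
        using zero
      proof eventually_elim
        case (elim z)
        show ?case
        proof (cases "z \<in> D")
          case True
          thus ?thesis using mult_ln_young[OF phi0[of z] Zpos, of "f z"] by (simp add: g_def f'_def algebra_simps)
        next
          case False
          with elim show ?thesis by (simp add: g_def)
        qed
      qed
    qed (use fp one ed gi in auto)
    finally show ?thesis unfolding re by simp
  qed
qed

section \<open>Densities close to the uniform one\<close>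

text \<open>
  The closed interval is more convenient than \<open>(0, L)\<close> for continuity arguments and differs from it by a
  null set.
\<close>

definition law :: "real \<Rightarrow> (real \<Rightarrow> real) \<Rightarrow> real measure" where
  "law L r = density lborel (\<lambda>x. ennreal (indicator {0..L} x * r x))"

lemma integrable_indicator_const:
  fixes c :: real
  assumes "X \<in> sets borel" "bounded X"
  shows "integrable lborel (\<lambda>t::real. indicator X t * c)"
  using assms by (intro integrable_mult_left integrable_real_indicator emeasure_bounded_finite) auto

lemma integrable_indicator_Icc_mult:
  assumes [measurable]: "f \<in> borel_measurable borel" and B: "\<And>x. x \<in> {a..b} \<Longrightarrow> \<bar>f x\<bar> \<le> B"
  shows "integrable lborel (\<lambda>x::real. indicator {a..b} x * f x :: real)"
proof (rule Bochner_Integration.integrable_bound)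
  show "integrable lborel (\<lambda>x. indicator {a..b} x * \<bar>B\<bar>)" by (rule integrable_indicator_const) auto
  have "norm (indicator {a..b} x * f x) \<le> norm (indicator {a..b} x * \<bar>B\<bar>)" for x
    using B[of x] by (auto simp: indicator_def)
  thus "AE x in lborel. norm (indicator {a..b} x * f x) \<le> norm (indicator {a..b} x * \<bar>B\<bar>)" by simp
qed simp

text \<open>
  Everywhere defined representatives of the elements of \<open>A L \<delta>\<close>: here the bound holds at every point
  of the line, not only almost everywhere on \<open>(0, L)\<close>. The restriction on \<open>\<delta>\<close> makes the ratio of any two
  such densities lie between \<open>99/101\<close> and \<open>101/99\<close>.
\<close>

locale near_uniform =
  fixes L \<delta> :: real and \<rho> :: "real \<Rightarrow> real"
  assumes L: "L > 0" and d: "\<delta> > 0" "\<delta> * L \<le> 1/100"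
    and meas[measurable]: "\<rho> \<in> borel_measurable borel"
    and near: "\<And>x. \<bar>\<rho> x - 1 / L\<bar> \<le> \<delta>"
    and mass: "(\<integral>x. indicator {0..L} x * \<rho> x \<partial>lborel) = 1"
begin

lemma dL: "\<delta> \<le> 1 / (100 * L)" using d L by (simp add: field_simps)

lemma near_bounds:
  assumes "\<bar>z - 1 / L\<bar> \<le> \<delta>"
  shows "99 / (100 * L) \<le> z" "z \<le> 101 / (100 * L)" "0 < z" "z \<le> 2 / L"
proof -
  have e: "99 / (100 * L) = 1 / L - 1 / (100 * L)" "101 / (100 * L) = 1 / L + 1 / (100 * L)"
    using L by (simp_all add: field_simps)
  show 1: "99 / (100 * L) \<le> z" "z \<le> 101 / (100 * L)"
    using assms dL unfolding e abs_le_iff by linarith+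
  have "0 < 99 / (100 * L)" "101 / (100 * L) \<le> 2 / L" using L by (simp_all add: field_simps)
  thus "0 < z" "z \<le> 2 / L" using 1 by linarith+
qed

lemma near_ln_bound:
  assumes "\<bar>z - 1 / L\<bar> \<le> \<delta>"
  shows "\<bar>ln z\<bar> \<le> \<bar>ln (99 / (100 * L))\<bar> + \<bar>ln (101 / (100 * L))\<bar>"
proof -
  have "ln (99 / (100 * L)) \<le> ln z" "ln z \<le> ln (101 / (100 * L))"
    using near_bounds[OF assms] L by (simp_all add: ln_mono)
  thus ?thesis by linarith
qed

lemmas bounds = near_bounds[OF near]
lemmas ln_bound = near_ln_bound[OF near]

lemma sets_law [measurable_cong, simp]: "sets (law L \<rho>) = sets borel" by (simp add: law_def)
lemma space_law [simp]: "space (law L \<rho>) = UNIV" by (simp add: law_def)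

lemma integrable_dens: "integrable lborel (\<lambda>x. indicator {0..L} x * \<rho> x)"
  by (rule integrable_indicator_Icc_mult[where B = "2 / L"]) (use bounds less_imp_le[OF bounds(3)] in simp_all)

sublocale prob: prob_space "law L \<rho>"
proof
  have "emeasure (law L \<rho>) (space (law L \<rho>)) = (\<integral>\<^sup>+x. ennreal (indicator {0..L} x * \<rho> x) \<partial>lborel)"
    unfolding law_def by (subst emeasure_density) auto
  also have "\<dots> = ennreal (\<integral>x. indicator {0..L} x * \<rho> x \<partial>lborel)"
    using bounds(3) by (intro nn_integral_eq_integral integrable_dens) (auto simp: indicator_def intro: less_imp_le)
  finally show "emeasure (law L \<rho>) (space (law L \<rho>)) = 1" by (simp add: mass)
qed

lemma real_dist: "real_distribution (law L \<rho>)"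
  by unfold_locales simp_all

lemma integral_law:
  assumes [measurable]: "f \<in> borel_measurable borel"
  shows "(\<integral>x. f x \<partial>law L \<rho>) = (\<integral>x. indicator {0..L} x * \<rho> x * f x \<partial>lborel)"
  unfolding law_def using bounds(3) by (subst integral_real_density) (auto simp: indicator_def intro: less_imp_le)

lemma AE_law: "AE x in law L \<rho>. x \<in> {0..L}"
  unfolding law_def by (subst AE_density) (auto simp: indicator_def)

lemma integrable_law:
  assumes [measurable]: "f \<in> borel_measurable borel" and B: "\<And>x. x \<in> {0..L} \<Longrightarrow> \<bar>f x\<bar> \<le> B"
  shows "integrable (law L \<rho>) (f :: real \<Rightarrow> real)"
proof (rule prob.integrable_const_bound[where B = B])
  show "AE x in law L \<rho>. norm (f x) \<le> B" using AE_law by eventually_elim (simp add: B)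
qed simp

definition "g t = indicator {0..L} t * (\<rho> t - 1 / L)"

text \<open>
  The distribution function, multiplied by \<open>L\<close> so that it maps \<open>[0, L]\<close> to itself, and continued by the
  identity. As a homeomorphism of the line it can be composed and inverted without case distinctions.
\<close>

definition "F x = x + L * (\<integral>t. indicator {..x} t * g t \<partial>lborel)"

lemma g_meas [measurable]: "g \<in> borel_measurable borel" unfolding g_def by measurable

lemma g_int: "integrable lborel g"
  unfolding g_def by (rule integrable_indicator_Icc_mult[where B = \<delta>]) (use near in auto)

lemma g_int_set: "X \<in> sets borel \<Longrightarrow> integrable lborel (\<lambda>t. indicator X t * g t)"
  using integrable_mult_indicator[of X lborel g] g_int by simp

lemma g_total: "(\<integral>t. g t \<partial>lborel) = 0"
proof -
  have "(\<integral>t. g t \<partial>lborel) = (\<integral>t. indicator {0..L} t * \<rho> t - indicator {0..L} t * (1 / L) \<partial>lborel)"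
    by (simp add: g_def algebra_simps)
  also have "\<dots> = 1 - (\<integral>t. indicator {0..L} t * (1 / L) \<partial>lborel)"
    by (subst Bochner_Integration.integral_diff[OF integrable_dens integrable_indicator_const]) (auto simp: mass)
  also have "\<dots> = 0" using L by simp
  finally show ?thesis .
qed

lemma F_diff: "x \<le> y \<Longrightarrow> F y - F x = (y - x) + L * (\<integral>t. indicator {x<..y} t * g t \<partial>lborel)"
proof -
  assume xy: "x \<le> y"
  have "(\<integral>t. indicator {..y} t * g t \<partial>lborel) = (\<integral>t. indicator {..x} t * g t + indicator {x<..y} t * g t \<partial>lborel)"
    using xy by (intro Bochner_Integration.integral_cong) (auto simp: indicator_def)
  also have "\<dots> = (\<integral>t. indicator {..x} t * g t \<partial>lborel) + (\<integral>t. indicator {x<..y} t * g t \<partial>lborel)"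
    by (intro Bochner_Integration.integral_add g_int_set) auto
  finally show ?thesis by (simp add: F_def algebra_simps)
qed

text \<open>
  The alternative in the last hypothesis accounts for the slope one of \<open>F\<close> outside \<open>[0, L]\<close>.
\<close>

lemma F_lower:
  assumes xy: "x \<le> y" and m: "\<And>t. t \<in> {x..y} \<Longrightarrow> t \<in> {0..L} \<Longrightarrow> m \<le> L * \<rho> t" and m1: "m \<le> 1 \<or> 0 \<le> x \<and> y \<le> L"
  shows "m * (y - x) \<le> F y - F x"
proof -
  have "(m - 1) / L * (y - x) = (\<integral>t. indicator {x<..y} t * ((m - 1) / L) \<partial>lborel)" using xy by simp
  also have "\<dots> \<le> (\<integral>t. indicator {x<..y} t * g t \<partial>lborel)"
  proof (rule integral_mono)
    show "integrable lborel (\<lambda>t. indicator {x<..y} t * ((m - 1) / L))"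
      by (rule integrable_indicator_const) auto
    show "integrable lborel (\<lambda>t. indicator {x<..y} t * g t)" by (rule g_int_set) simp
    fix t
    show "indicator {x<..y} t * ((m - 1) / L) \<le> indicator {x<..y} t * g t"
      using m[of t] m1 L by (auto simp: indicator_def g_def field_simps)
  qed
  finally have "(m - 1) * (y - x) \<le> L * (\<integral>t. indicator {x<..y} t * g t \<partial>lborel)" using L by (simp add: field_simps)
  thus ?thesis using F_diff[OF xy] by (simp add: algebra_simps)
qed

lemma F_upper:
  assumes xy: "x \<le> y" and m: "\<And>t. t \<in> {x..y} \<Longrightarrow> t \<in> {0..L} \<Longrightarrow> L * \<rho> t \<le> m" and m1: "m \<ge> 1"
  shows "F y - F x \<le> m * (y - x)"
proof -
  have "(\<integral>t. indicator {x<..y} t * g t \<partial>lborel) \<le> (\<integral>t. indicator {x<..y} t * ((m - 1) / L) \<partial>lborel)"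
  proof (rule integral_mono)
    show "integrable lborel (\<lambda>t. indicator {x<..y} t * ((m - 1) / L))"
      by (rule integrable_indicator_const) auto
    show "integrable lborel (\<lambda>t. indicator {x<..y} t * g t)" by (rule g_int_set) simp
    fix t
    show "indicator {x<..y} t * g t \<le> indicator {x<..y} t * ((m - 1) / L)"
      using m[of t] m1 L by (auto simp: indicator_def g_def field_simps)
  qed
  also have "\<dots> = (m - 1) / L * (y - x)" using xy by simp
  finally have "L * (\<integral>t. indicator {x<..y} t * g t \<partial>lborel) \<le> (m - 1) * (y - x)" using L by (simp add: field_simps)
  thus ?thesis using F_diff[OF xy] by (simp add: algebra_simps)
qed

lemma L_rho: "99/100 \<le> L * \<rho> x" "L * \<rho> x \<le> 101/100"
  using bounds(1,2)[of x] L by (simp_all add: field_simps)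

lemma F_slope: "x \<le> y \<Longrightarrow> 99/100 * (y - x) \<le> F y - F x" "x \<le> y \<Longrightarrow> F y - F x \<le> 101/100 * (y - x)"
  using L_rho by (intro F_lower F_upper; simp)+

lemma F_outside: "x \<le> 0 \<or> L \<le> x \<Longrightarrow> F x = x"
proof (elim disjE)
  assume "x \<le> 0"
  have "AE t in lborel. t \<noteq> (0::real)" by (rule AE_lborel_singleton)
  hence "AE t in lborel. indicator {..x} t * g t = 0"
    by eventually_elim (use \<open>x \<le> 0\<close> in \<open>auto simp: g_def indicator_def\<close>)
  hence "(\<integral>t. indicator {..x} t * g t \<partial>lborel) = 0"
    by (rule integral_eq_zero_AE)
  thus ?thesis by (simp add: F_def)
next
  assume "L \<le> x"
  hence "(\<integral>t. indicator {..x} t * g t \<partial>lborel) = (\<integral>t. g t \<partial>lborel)"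
    by (intro Bochner_Integration.integral_cong) (auto simp: g_def indicator_def)
  thus ?thesis by (simp add: F_def g_total)
qed

lemma F_0 [simp]: "F 0 = 0" and F_L [simp]: "F L = L" by (auto simp: F_outside)

lemma F_strict_mono: "x < y \<Longrightarrow> F x < F y"
  using F_slope(1)[of x y] by simp

lemma F_le_iff: "F x \<le> F y \<longleftrightarrow> x \<le> y"
  using F_strict_mono by (metis linorder_not_le order_less_imp_le order_le_less)

lemma F_continuous: "continuous_on X F"
proof (rule lipschitz_on_continuous_on[of "101/100"], rule lipschitz_onI)
  show "dist (F x) (F y) \<le> 101/100 * dist x y" for x y
    using F_slope[of x y] F_slope[of y x] by (cases "x \<le> y") (auto simp: dist_real_def abs_if)
qed simp

lemma F_surj: "\<exists>x. F x = y"
proof -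
  define b where "b = max \<bar>y\<bar> L"
  have "F (- b) = - b" "F b = b" "- b \<le> y" "y \<le> b" "- b \<le> b"
    using L by (auto simp: b_def intro!: F_outside)
  thus ?thesis using IVT'[of F "-b" y b] F_continuous by metis
qed

definition "X y = (THE x. F x = y)"

lemma FX [simp]: "F (X y) = y" and XF [simp]: "X (F x) = x"
proof -
  have inj: "F x = F x' \<Longrightarrow> x = x'" for x x' using F_le_iff by (metis order_antisym order_refl)
  have "\<exists>!x. F x = y" using F_surj inj by blast
  thus "F (X y) = y" unfolding X_def by (rule theI')
  show "X (F x) = x" unfolding X_def by (rule the_equality) (use inj in auto)
qed

lemma transport_F: "transport F X (99/101)"
proof
  fix x y :: real assume xy: "x \<le> y"
  show "99/101 * (y - x) \<le> F y - F x" "F y - F x \<le> (y - x) / (99/101)"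
    using F_slope[OF xy] xy by (simp_all add: field_simps)
qed simp_all

interpretation FX: transport F X "99/101" by (rule transport_F)
interpretation XF: transport X F "99/101" by (rule FX.transport_inverse)

lemma F_measurable [measurable]: "F \<in> borel_measurable borel" by (rule FX.T_measurable)
lemma X_measurable [measurable]: "X \<in> borel_measurable borel" by (rule XF.T_measurable)
lemma X_continuous: "continuous_on Y X" by (rule XF.T_continuous)
lemma X_0 [simp]: "X 0 = 0" and X_L [simp]: "X L = L" using XF[of 0] XF[of L] by simp_all
lemma X_le_iff: "X x \<le> X y \<longleftrightarrow> x \<le> y" by (rule XF.T_le_iff)

lemma X_slope: "x \<le> y \<Longrightarrow> 100/101 * (y - x) \<le> X y - X x" "x \<le> y \<Longrightarrow> X y - X x \<le> 100/99 * (y - x)"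
  using F_slope[of "X x" "X y"] by (simp_all add: X_le_iff field_simps)

lemma cdf_law: "measure (law L \<rho>) {..x} = (F x - x + max 0 (min x L)) / L"
proof -
  have "measure (law L \<rho>) {..x} = (\<integral>t. indicator {..x} t \<partial>law L \<rho>)" by simp
  also have "\<dots> = (\<integral>t. indicator {0..L} t * \<rho> t * indicator {..x} t \<partial>lborel)" by (rule integral_law) simp
  also have "\<dots> = (\<integral>t. indicator {..x} t * g t + indicator ({..x} \<inter> {0..L}) t * (1 / L) \<partial>lborel)"
    using L by (intro Bochner_Integration.integral_cong) (auto simp: g_def indicator_def)
  also have "\<dots> = (\<integral>t. indicator {..x} t * g t \<partial>lborel) + (\<integral>t. indicator ({..x} \<inter> {0..L}) t * (1 / L) \<partial>lborel)"
  proof (intro Bochner_Integration.integral_add g_int_set integrable_mult_left integrable_real_indicator)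
    have "emeasure lborel ({..x} \<inter> {0..L}) \<le> emeasure lborel {0..L}" by (intro emeasure_mono) auto
    also have "\<dots> < \<infinity>" by (simp add: emeasure_lborel_Icc_eq)
    finally show "emeasure lborel ({..x} \<inter> {0..L}) < \<infinity>" .
  qed auto
  also have "{..x} \<inter> {0..L} = {0..min x L}" by auto
  also have "(\<integral>t. indicator {0..min x L} t * (1 / L) \<partial>lborel) = max 0 (min x L) / L"
    by (simp add: max_def min_def)
  finally show ?thesis using L by (simp add: F_def field_simps)
qed

end

lemma near_uniform_const:
  assumes "L > 0" "\<delta> > 0" "\<delta> * L \<le> 1/100" shows "near_uniform L \<delta> (\<lambda>_. 1 / L)"
  by unfold_locales (use assms in auto)

context near_uniform
begin

abbreviation "unif \<equiv> law L (\<lambda>_. 1 / L)"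

interpretation uni: near_uniform L \<delta> "\<lambda>_. 1 / L" by (rule near_uniform_const[OF L d])

lemma uni_F: "uni.F x = x" by (simp add: uni.F_def uni.g_def)

lemma distr_F: "distr (law L \<rho>) borel F = unif"
proof (rule cdf_unique)
  show "real_distribution (distr (law L \<rho>) borel F)"
    by (rule prob.real_distribution_distr) simp
  show "real_distribution unif" by (rule uni.real_dist)
  show "cdf (distr (law L \<rho>) borel F) = cdf unif"
  proof
    fix y
    have "F -` {..y} = {..X y}" using F_le_iff[of _ "X y"] by auto
    hence "cdf (distr (law L \<rho>) borel F) y = measure (law L \<rho>) {..X y}"
      by (simp add: cdf_def measure_distr)
    also have "\<dots> = (y - X y + max 0 (min (X y) L)) / L" by (simp add: cdf_law)
    also have "y - X y + max 0 (min (X y) L) = max 0 (min y L)"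
    proof -
      consider "X y \<le> 0" | "0 \<le> X y" "X y \<le> L" | "L \<le> X y" by linarith
      thus ?thesis
      proof cases
        case 1 hence "X y = y" using F_outside[of "X y"] by simp
        thus ?thesis by simp
      next
        case 2 hence "0 \<le> y" "y \<le> L" using X_le_iff[of 0 y] X_le_iff[of y L] by simp_all
        thus ?thesis using 2 by simp
      next
        case 3 hence "X y = y" using F_outside[of "X y"] by simp
        thus ?thesis by simp
      qed
    qed
    also have "max 0 (min y L) / L = cdf unif y" by (simp add: cdf_def uni.cdf_law uni_F)
    finally show "cdf (distr (law L \<rho>) borel F) y = cdf unif y" .
  qed
qed

lemma distr_X: "distr unif borel X = law L \<rho>"
proof -
  have "distr unif borel X = distr (distr (law L \<rho>) borel F) borel X" by (simp add: distr_F)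
  also have "\<dots> = distr (law L \<rho>) borel (X \<circ> F)" by (rule distr_distr) auto
  also have "\<dots> = distr (law L \<rho>) (law L \<rho>) id" by (rule distr_cong) auto
  also have "\<dots> = law L \<rho>" by (simp add: id_def)
  finally show ?thesis .
qed

end

section \<open>Duality for the two functionals\<close>

lemma heat_kernel_eq_normal_density: "h > 0 \<Longrightarrow> heat_kernel h x y = normal_density x (sqrt (2 * h)) y"
  by (simp add: heat_kernel_def normal_density_def power2_commute)

lemma heat_kernel_pos: "h > 0 \<Longrightarrow> heat_kernel h x y > 0"
  by (simp add: heat_kernel_def)

lemma heat_kernel_measurable [measurable]: "(\<lambda>z. heat_kernel h (fst z) (snd z)) \<in> borel_measurable (borel \<Otimes>\<^sub>M borel)"
  unfolding heat_kernel_def by measurable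

lemma sets_heat_joint [simp]: "sets \<mu> = sets borel \<Longrightarrow> sets (heat_joint h \<mu>) = sets (borel \<Otimes>\<^sub>M borel)"
  unfolding heat_joint_def by (simp cong: sets_pair_measure_cong)

lemma nn_integral_heat_joint:
  fixes f :: "real \<times> real \<Rightarrow> ennreal"
  assumes [measurable_cong]: "sets \<mu> = sets borel" and [measurable]: "f \<in> borel_measurable (borel \<Otimes>\<^sub>M borel)"
  shows "(\<integral>\<^sup>+z. f z \<partial>heat_joint h \<mu>) = (\<integral>\<^sup>+x. \<integral>\<^sup>+y. ennreal (heat_kernel h x y) * f (x, y) \<partial>lborel \<partial>\<mu>)"
proof -
  have "(\<integral>\<^sup>+z. f z \<partial>heat_joint h \<mu>) = (\<integral>\<^sup>+z. ennreal (heat_kernel h (fst z) (snd z)) * f z \<partial>(\<mu> \<Otimes>\<^sub>M lborel))"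
    unfolding heat_joint_def by (subst nn_integral_density) (auto simp: split_beta')
  also have "\<dots> = (\<integral>\<^sup>+x. \<integral>\<^sup>+y. ennreal (heat_kernel h x y) * f (x, y) \<partial>lborel \<partial>\<mu>)"
    by (subst lborel.nn_integral_fst[symmetric]) auto
  finally show ?thesis .
qed

lemma prob_space_heat_joint:
  assumes "h > 0" "prob_space \<mu>" and s: "sets \<mu> = sets borel"
  shows "prob_space (heat_joint h \<mu>)"
proof
  interpret prob_space \<mu> by fact
  have "(\<integral>\<^sup>+y. ennreal (heat_kernel h x y) \<partial>lborel) = 1" for x
  proof -
    interpret n: prob_space "density lborel (normal_density x (sqrt (2 * h)))"
      by (rule prob_space_normal_density) (use assms in simp)
    show ?thesis using n.emeasure_space_1 assms(1) by (simp add: emeasure_density heat_kernel_eq_normal_density)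
  qed
  hence "(\<integral>\<^sup>+z. 1 \<partial>heat_joint h \<mu>) = 1"
    using nn_integral_heat_joint[OF s, of "\<lambda>_. 1" h] by (simp add: emeasure_space_1)
  thus "emeasure (heat_joint h \<mu>) (space (heat_joint h \<mu>)) = 1" by simp
qed

lemma couplings_sets:
  assumes "q \<in> couplings \<mu> \<nu>" shows "prob_space q" "sets q = sets (borel \<Otimes>\<^sub>M borel)"
  using assms unfolding couplings_def mem_Collect_eq space_prob_algebra borel_prod by blast+

lemma couplings_AE:
  assumes q: "q \<in> couplings \<mu> \<nu>"
  shows "AE x in \<mu>. P x \<Longrightarrow> AE z in q. P (fst z)" "AE y in \<nu>. Q y \<Longrightarrow> AE z in q. Q (snd z)"
proof -
  note [measurable_cong] = couplings_sets(2)[OF q]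
  have m: "fst \<in> q \<rightarrow>\<^sub>M borel" "snd \<in> q \<rightarrow>\<^sub>M borel" by measurable
  have e: "distr q borel fst = \<mu>" "distr q borel snd = \<nu>" using q by (auto simp: couplings_def)
  show "AE x in \<mu>. P x \<Longrightarrow> AE z in q. P (fst z)" unfolding e(1)[symmetric] by (rule AE_distrD[OF m(1)])
  show "AE y in \<nu>. Q y \<Longrightarrow> AE z in q. Q (snd z)" unfolding e(2)[symmetric] by (rule AE_distrD[OF m(2)])
qed

lemma couplings_integral:
  fixes f :: "real \<Rightarrow> real"
  assumes q: "q \<in> couplings \<mu> \<nu>" and [measurable]: "f \<in> borel_measurable borel"
  shows "(\<integral>z. f (fst z) \<partial>q) = (\<integral>x. f x \<partial>\<mu>)" "(\<integral>z. f (snd z) \<partial>q) = (\<integral>x. f x \<partial>\<nu>)"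
    "integrable \<mu> f \<Longrightarrow> integrable q (\<lambda>z. f (fst z))" "integrable \<nu> f \<Longrightarrow> integrable q (\<lambda>z. f (snd z))"
proof -
  note [measurable_cong] = couplings_sets(2)[OF q]
  have m: "fst \<in> q \<rightarrow>\<^sub>M borel" "snd \<in> q \<rightarrow>\<^sub>M borel" by measurable
  have e: "distr q borel fst = \<mu>" "distr q borel snd = \<nu>" using q by (auto simp: couplings_def)
  show "(\<integral>z. f (fst z) \<partial>q) = (\<integral>x. f x \<partial>\<mu>)" "(\<integral>z. f (snd z) \<partial>q) = (\<integral>x. f x \<partial>\<nu>)"
    unfolding e[symmetric] by (subst integral_distr; simp add: m)+
  show "integrable \<mu> f \<Longrightarrow> integrable q (\<lambda>z. f (fst z))" "integrable \<nu> f \<Longrightarrow> integrable q (\<lambda>z. f (snd z))"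
    unfolding e[symmetric] by (subst (asm) integrable_distr_eq; simp add: m)+
qed

lemma ennreal_integral_le_nn_integral:
  assumes "integrable N f" shows "ennreal (\<integral>x. f x \<partial>N) \<le> (\<integral>\<^sup>+x. ennreal (f x) \<partial>N)"
proof -
  have "(\<integral>x. f x \<partial>N) \<le> enn2real (\<integral>\<^sup>+x. ennreal (f x) \<partial>N)"
    using assms by (subst real_lebesgue_integral_def) auto
  hence "ennreal (\<integral>x. f x \<partial>N) \<le> ennreal (enn2real (\<integral>\<^sup>+x. ennreal (f x) \<partial>N))" by (rule ennreal_leI)
  also have "\<dots> = (\<integral>\<^sup>+x. ennreal (f x) \<partial>N)"
    using assms unfolding real_integrable_def by (intro ennreal_enn2real) (auto simp: less_top)
  finally show ?thesis .
qed

lemma abs_add_half_le: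
  fixes a b :: real
  assumes "\<bar>a\<bar> \<le> B" "\<bar>b\<bar> \<le> C" shows "\<bar>a + b / 2\<bar> \<le> B + C / 2" "\<bar>a - b / 2\<bar> \<le> B + C / 2"
  using assms unfolding abs_le_iff by argo+

text \<open>
  \<open>a\<close> is the initial density and \<open>b\<close> the final one; the monotone map from one to the other is
  the distribution function of the first followed by the quantile function of the second.
\<close>

locale two_densities = a: near_uniform L \<delta> r0 + b: near_uniform L \<delta> r1
  for L \<delta> :: real and r0 r1 :: "real \<Rightarrow> real"
begin

definition "T x = b.X (a.F x)"
definition "S y = a.X (b.F y)"

lemma transport_T: "transport T S (99/101)"
proof
  fix x y :: real assume xy: "x \<le> y"
  hence F: "a.F x \<le> a.F y" by (simp add: a.F_le_iff)
  show "99/101 * (y - x) \<le> T y - T x"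
    using mult_left_mono[OF a.F_slope(1)[OF xy], of "100/101"] b.X_slope(1)[OF F] unfolding T_def by simp
  show "T y - T x \<le> (y - x) / (99/101)"
    using mult_left_mono[OF a.F_slope(2)[OF xy], of "100/99"] b.X_slope(2)[OF F] unfolding T_def by simp
qed (simp_all add: T_def S_def)

sublocale tr: transport T S "99/101" by (rule transport_T)
sublocale inv: transport S T "99/101" by (rule tr.transport_inverse)

lemma T_ends: "T 0 = 0" "T L = L" by (simp_all add: T_def)

lemma distr_S: "distr (law L r1) borel S = law L r0"
proof -
  have "distr (law L r1) borel S = distr (distr (law L r1) borel b.F) borel a.X"
    by (subst distr_distr) (auto simp: S_def[abs_def] comp_def)
  thus ?thesis by (simp add: b.distr_F a.distr_X)
qed

text \<open>
  The dual Kantorovich value of the potentials.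
\<close>

definition "w U V = (\<integral>x. x\<^sup>2 - 2 * U x \<partial>law L r0) + (\<integral>y. y\<^sup>2 - 2 * V y \<partial>law L r1)"

context
  fixes U V assumes pot: "tr.potentials U V"
begin

lemma dU: "(U has_real_derivative T t) (at t)" and dV: "(V has_real_derivative S t) (at t)"
  and pot_eq: "U x + V (T x) = x * T x"
  using pot by (auto simp: tr.potentials_def)

lemma pot_cont: "continuous_on Y U" "continuous_on Y V"
  by (meson DERIV_isCont continuous_at_imp_continuous_on dU dV)+

lemma pot_meas: "U \<in> borel_measurable borel" "V \<in> borel_measurable borel"
  by (intro borel_measurable_continuous_onI pot_cont)+

lemma continuous_bounded_Icc:
  fixes f :: "real \<Rightarrow> real"
  assumes "continuous_on UNIV f" shows "\<exists>B. \<forall>x\<in>{0..L}. \<bar>f x\<bar> \<le> B"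
proof -
  have "compact (f ` {0..L})" using assms by (intro compact_continuous_image continuous_on_subset[OF assms]) auto
  hence "bounded (f ` {0..L})" by (rule compact_imp_bounded)
  thus ?thesis unfolding bounded_iff by auto
qed

lemma pot_sq_cont: "continuous_on UNIV (\<lambda>x. x\<^sup>2 - 2 * U x)" "continuous_on UNIV (\<lambda>y. y\<^sup>2 - 2 * V y)"
  by (intro continuous_intros pot_cont)+

lemma pot_integrable: "integrable (law L r0) (\<lambda>x. x\<^sup>2 - 2 * U x)" "integrable (law L r1) (\<lambda>y. y\<^sup>2 - 2 * V y)"
proof -
  note c = pot_sq_cont and pot_meas [measurable]
  obtain B where "\<And>x. x \<in> {0..L} \<Longrightarrow> \<bar>x\<^sup>2 - 2 * U x\<bar> \<le> B" using continuous_bounded_Icc[OF c(1)] by blast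
  thus "integrable (law L r0) (\<lambda>x. x\<^sup>2 - 2 * U x)" by (intro a.integrable_law) auto
  obtain B where "\<And>x. x \<in> {0..L} \<Longrightarrow> \<bar>x\<^sup>2 - 2 * V x\<bar> \<le> B" using continuous_bounded_Icc[OF c(2)] by blast
  thus "integrable (law L r1) (\<lambda>y. y\<^sup>2 - 2 * V y)" by (intro b.integrable_law) auto
qed

text \<open>
  The difference between the cost \<open>(x - y)\<^sup>2\<close> and the separable function that integrates to \<open>w U V\<close> is twice
  the gap. It is nonnegative and vanishes on the graph of \<open>S\<close>, so the coupling carried by that graph
  is optimal.
\<close>

lemma wasserstein_eq: "wasserstein_sq (law L r1) (law L r0) = ennreal (w U V)" and w_nonneg: "w U V \<ge> 0"
proof -
  note pot_meas [measurable]
  define \<gamma> where "\<gamma> = distr (law L r1) borel (\<lambda>y. (y, S y))"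
  have [measurable]: "S \<in> borel_measurable borel" by (rule inv.T_measurable)
  have m: "(\<lambda>y. (y, S y)) \<in> law L r1 \<rightarrow>\<^sub>M borel" by (simp flip: borel_prod)
  have g: "\<gamma> \<in> couplings (law L r1) (law L r0)"
  proof -
    have "prob_space \<gamma>" unfolding \<gamma>_def by (rule b.prob.prob_space_distr[OF m])
    moreover have "distr \<gamma> borel fst = law L r1"
    proof -
      have "distr \<gamma> borel fst = distr (law L r1) borel (\<lambda>y. y)" unfolding \<gamma>_def
        by (subst distr_distr) (auto simp: m comp_def simp flip: borel_prod)
      also have "\<dots> = distr (law L r1) (law L r1) (\<lambda>y. y)" by (rule distr_cong) auto
      finally show ?thesis by simp
    qed
    moreover have "distr \<gamma> borel snd = law L r0" unfolding \<gamma>_def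
      by (subst distr_distr) (auto simp: m comp_def distr_S simp flip: borel_prod)
    ultimately show ?thesis by (simp add: couplings_def space_prob_algebra \<gamma>_def)
  qed
  have iS: "integrable (law L r1) (\<lambda>y. (S y)\<^sup>2 - 2 * U (S y))" "(\<integral>y. (S y)\<^sup>2 - 2 * U (S y) \<partial>law L r1) = (\<integral>x. x\<^sup>2 - 2 * U x \<partial>law L r0)"
    using pot_integrable(1) unfolding distr_S[symmetric] by (simp_all add: integrable_distr_eq integral_distr)
  have eq: "(y - S y)\<^sup>2 = (y\<^sup>2 - 2 * V y) + ((S y)\<^sup>2 - 2 * U (S y))" for y
    using pot_eq[of "S y"] by (simp add: tr.TS power2_diff mult.commute)
  have wd: "w U V = (\<integral>y. (y - S y)\<^sup>2 \<partial>law L r1)"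
    unfolding eq w_def using pot_integrable(2) iS by (subst Bochner_Integration.integral_add) auto
  show "w U V \<ge> 0" unfolding wd by simp
  have "(\<integral>\<^sup>+(x, y). ennreal ((x - y)\<^sup>2) \<partial>\<gamma>) = (\<integral>\<^sup>+y. ennreal ((y - S y)\<^sup>2) \<partial>law L r1)"
    unfolding \<gamma>_def by (subst nn_integral_distr[OF m]) (auto simp: split_beta' simp flip: borel_prod)
  also have "\<dots> = ennreal (w U V)" unfolding wd
  proof (rule nn_integral_eq_integral)
    show "integrable (law L r1) (\<lambda>y. (y - S y)\<^sup>2)"
      unfolding eq by (intro Bochner_Integration.integrable_add pot_integrable(2) iS)
  qed simp
  finally have le: "wasserstein_sq (law L r1) (law L r0) \<le> ennreal (w U V)"
    unfolding wasserstein_sq_def using g by (metis INF_lower)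
  have ge: "ennreal (w U V) \<le> (\<integral>\<^sup>+(x, y). ennreal ((x - y)\<^sup>2) \<partial>\<gamma>)" if g: "\<gamma> \<in> couplings (law L r1) (law L r0)" for \<gamma>
  proof -
    note [measurable_cong] = couplings_sets(2)[OF g]
    define f where "f z = ((fst z)\<^sup>2 - 2 * V (fst z)) + ((snd z)\<^sup>2 - 2 * U (snd z))" for z
    have fi: "integrable \<gamma> f" "(\<integral>z. f z \<partial>\<gamma>) = w U V"
      unfolding f_def w_def
      using couplings_integral[OF g, of "\<lambda>y. y\<^sup>2 - 2 * V y"] couplings_integral[OF g, of "\<lambda>y. y\<^sup>2 - 2 * U y"] pot_integrable
      by (simp_all add: Bochner_Integration.integral_add)
    have "ennreal (w U V) = ennreal (\<integral>z. f z \<partial>\<gamma>)" by (simp add: fi)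
    also have "\<dots> \<le> (\<integral>\<^sup>+z. ennreal (f z) \<partial>\<gamma>)"
      using fi(1) by (rule ennreal_integral_le_nn_integral)
    also have "\<dots> \<le> (\<integral>\<^sup>+(x, y). ennreal ((x - y)\<^sup>2) \<partial>\<gamma>)"
    proof (rule nn_integral_mono)
      fix z :: "real \<times> real"
      have "f z \<le> (fst z - snd z)\<^sup>2"
      proof -
        have "(fst z - snd z)\<^sup>2 = (fst z)\<^sup>2 + (snd z)\<^sup>2 - 2 * (snd z * fst z)" by (simp add: power2_diff)
        thus ?thesis using tr.potential_gap_nonneg[OF pot, of "snd z" "fst z"] unfolding f_def by linarith
      qed
      thus "ennreal (f z) \<le> (case z of (x, y) \<Rightarrow> ennreal ((x - y)\<^sup>2))" by (simp add: split_beta' ennreal_leI)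
    qed
    finally show ?thesis .
  qed
  show "wasserstein_sq (law L r1) (law L r0) = ennreal (w U V)"
    by (rule antisym[OF le]) (simp add: wasserstein_sq_def INF_greatest ge)
qed

text \<open>
  The entropy inequality for \<open>f = ((x - y)\<^sup>2 - 2 \<Delta>) / 4h - ln r0 / 2 + ln rt / 2\<close>, where \<open>\<Delta>\<close> is the gap of
  the potentials. The function \<open>f\<close> is separable, so its integral depends on the marginals only;
  multiplied by the heat kernel, \<open>exp f\<close> loses the quadratic cost and keeps \<open>\<Delta>\<close>.
\<close>

lemma J_ge:
  assumes h: "h > 0" and [measurable]: "rt \<in> borel_measurable borel" and rt: "\<And>x. \<bar>rt x - 1 / L\<bar> \<le> \<delta>"
    and Z: "(\<integral>\<^sup>+x. \<integral>\<^sup>+y. ennreal (sqrt (r0 x * rt y) * exp (- ((U x + V y - x * y) / (2 * h))) / sqrt (4 * pi * h))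
        * (indicator {0..L} x * indicator {0..L} y) \<partial>lborel \<partial>lborel) \<le> ennreal Z" and Zpos: "Z > 0"
  shows "ereal (w U V / (4 * h) - (\<integral>x. ln (r0 x) \<partial>law L r0) / 2 + (\<integral>y. ln (rt y) \<partial>law L r1) / 2 - ln Z) \<le> J h (law L r1) (law L r0)"
  unfolding J_def
proof (rule INF_greatest)
  fix q assume q: "q \<in> couplings (law L r0) (law L r1)"
  note [measurable_cong] = couplings_sets(2)[OF q]
  note pot_meas [measurable]
  interpret q: prob_space q by (rule couplings_sets(1)[OF q])
  interpret hj: prob_space "heat_joint h (law L r0)" by (rule prob_space_heat_joint[OF h a.prob.prob_space_axioms a.sets_law])
  note rtpos = a.near_bounds(3)[OF rt] and rtln = a.near_ln_bound[OF rt]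
  define fa where "fa x = (x\<^sup>2 - 2 * U x) / (4 * h) - ln (r0 x) / 2" for x
  define fb where "fb y = (y\<^sup>2 - 2 * V y) / (4 * h) + ln (rt y) / 2" for y
  have [measurable]: "fa \<in> borel_measurable borel" "fb \<in> borel_measurable borel"
    unfolding fa_def fb_def by measurable
  obtain B1 where B1: "\<And>x. x \<in> {0..L} \<Longrightarrow> \<bar>x\<^sup>2 - 2 * U x\<bar> \<le> B1"
    using continuous_bounded_Icc[OF pot_sq_cont(1)] by blast
  obtain B2 where B2: "\<And>x. x \<in> {0..L} \<Longrightarrow> \<bar>x\<^sup>2 - 2 * V x\<bar> \<le> B2"
    using continuous_bounded_Icc[OF pot_sq_cont(2)] by blast
  obtain Ba where Ba: "\<And>x. x \<in> {0..L} \<Longrightarrow> \<bar>fa x\<bar> \<le> Ba"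
  proof
    fix x assume "x \<in> {0..L}"
    hence "\<bar>(x\<^sup>2 - 2 * U x) / (4 * h)\<bar> \<le> B1 / (4 * h)" unfolding abs_divide using B1 h by (intro divide_mono) auto
    thus "\<bar>fa x\<bar> \<le> B1 / (4 * h) + (\<bar>ln (99 / (100 * L))\<bar> + \<bar>ln (101 / (100 * L))\<bar>) / 2"
      unfolding fa_def using a.ln_bound[of x] by (intro abs_add_half_le)
  qed
  obtain Bb where Bb: "\<And>x. x \<in> {0..L} \<Longrightarrow> \<bar>fb x\<bar> \<le> Bb"
  proof
    fix x assume "x \<in> {0..L}"
    hence "\<bar>(x\<^sup>2 - 2 * V x) / (4 * h)\<bar> \<le> B2 / (4 * h)" unfolding abs_divide using B2 h by (intro divide_mono) auto
    thus "\<bar>fb x\<bar> \<le> B2 / (4 * h) + (\<bar>ln (99 / (100 * L))\<bar> + \<bar>ln (101 / (100 * L))\<bar>) / 2"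
      unfolding fb_def using rtln[of x] by (intro abs_add_half_le)
  qed
  define f where "f z = fa (fst z) + fb (snd z)" for z
  have int: "integrable (law L r0) fa" "integrable (law L r1) fb"
    by (rule a.integrable_law[OF _ Ba], simp_all, rule b.integrable_law[OF _ Bb], simp_all)
  have lni: "integrable (law L r0) (\<lambda>x. ln (r0 x))" "integrable (law L r1) (\<lambda>y. ln (rt y))"
    by (rule a.integrable_law[OF _ a.ln_bound], simp, rule b.integrable_law[OF _ rtln], simp)
  have "(\<integral>z. f z \<partial>q) = (\<integral>x. fa x \<partial>law L r0) + (\<integral>y. fb y \<partial>law L r1)"
    unfolding f_def using couplings_integral[OF q, of fa] couplings_integral[OF q, of fb] int by simp
  also have "(\<integral>x. fa x \<partial>law L r0) = (\<integral>x. x\<^sup>2 - 2 * U x \<partial>law L r0) / (4 * h) - (\<integral>x. ln (r0 x) \<partial>law L r0) / 2"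
    unfolding fa_def by (subst Bochner_Integration.integral_diff) (auto simp only: intro!: integrable_divide lni pot_integrable, simp only: integral_divide_zero)
  also have "(\<integral>y. fb y \<partial>law L r1) = (\<integral>x. x\<^sup>2 - 2 * V x \<partial>law L r1) / (4 * h) + (\<integral>x. ln (rt x) \<partial>law L r1) / 2"
    unfolding fb_def by (subst Bochner_Integration.integral_add) (auto simp only: intro!: integrable_divide lni pot_integrable, simp only: integral_divide_zero)
  finally have fint: "(\<integral>z. f z \<partial>q) - ln Z = w U V / (4 * h) - (\<integral>x. ln (r0 x) \<partial>law L r0) / 2 + (\<integral>y. ln (rt y) \<partial>law L r1) / 2 - ln Z"
    by (simp add: w_def add_divide_distrib)
  show "ereal (w U V / (4 * h) - (\<integral>x. ln (r0 x) \<partial>law L r0) / 2 + (\<integral>y. ln (rt y) \<partial>law L r1) / 2 - ln Z)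
      \<le> relative_entropy q (heat_joint h (law L r0))"
    unfolding fint[symmetric]
  proof (rule relative_entropy_ge[where D = "{0..L} \<times> {0..L}" and B = "Ba + Bb"])
    show "finite_measure (heat_joint h (law L r0))" by unfold_locales
    show "prob_space q" by unfold_locales
    show "sets q = sets (heat_joint h (law L r0))" by (simp add: couplings_sets(2)[OF q])
    show "f \<in> borel_measurable (heat_joint h (law L r0))"
      unfolding f_def by (subst measurable_cong_sets[OF sets_heat_joint[OF a.sets_law] refl]) measurable
    show "{0..L} \<times> {0..L} \<in> sets (heat_joint h (law L r0))" by simp
    show "\<bar>f z\<bar> \<le> Ba + Bb" if "z \<in> {0..L} \<times> {0..L}" for z
      using Ba[of "fst z"] Bb[of "snd z"] that unfolding f_def by fastforce
    have "AE z in q. fst z \<in> {0..L}" by (rule couplings_AE(1)[OF q]) (rule a.AE_law)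
    moreover have "AE z in q. snd z \<in> {0..L}" by (rule couplings_AE(2)[OF q]) (rule b.AE_law)
    ultimately show "AE z in q. z \<in> {0..L} \<times> {0..L}" by eventually_elim (auto simp: mem_Times_iff)
    have "(\<integral>\<^sup>+z. ennreal (exp (f z)) * indicator ({0..L} \<times> {0..L}) z \<partial>heat_joint h (law L r0))
      = (\<integral>\<^sup>+x. \<integral>\<^sup>+y. ennreal (heat_kernel h x y) * (ennreal (exp (f (x, y))) * indicator ({0..L} \<times> {0..L}) (x, y)) \<partial>lborel \<partial>law L r0)"
      by (rule nn_integral_heat_joint) (auto simp: f_def)
    also have "\<dots> = (\<integral>\<^sup>+x. ennreal (indicator {0..L} x * r0 x) * (\<integral>\<^sup>+y. ennreal (heat_kernel h x y) * (ennreal (exp (f (x, y))) * indicator ({0..L} \<times> {0..L}) (x, y)) \<partial>lborel) \<partial>lborel)"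
      unfolding law_def f_def by (rule nn_integral_density) auto
    also have "\<dots> = (\<integral>\<^sup>+x. \<integral>\<^sup>+y. ennreal (sqrt (r0 x * rt y) * exp (- ((U x + V y - x * y) / (2 * h))) / sqrt (4 * pi * h))
        * (indicator {0..L} x * indicator {0..L} y) \<partial>lborel \<partial>lborel)"
    proof (rule nn_integral_cong)
      fix x :: real
      have pw: "r0 x * (heat_kernel h x y * exp (f (x, y))) = sqrt (r0 x * rt y) * exp (- ((U x + V y - x * y) / (2 * h))) / sqrt (4 * pi * h)" for y
      proof -
        have e1: "exp (ln z / 2) = sqrt z" if "z > 0" for z :: real
          using that by (subst ln_sqrt[symmetric]) simp_all
        have "f (x, y) = ((x\<^sup>2 - 2 * U x) + (y\<^sup>2 - 2 * V y)) / (4 * h) - ln (r0 x) / 2 + ln (rt y) / 2"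
          by (simp add: f_def fa_def fb_def add_divide_distrib)
        hence ef: "exp (f (x, y)) = exp (((x\<^sup>2 - 2 * U x) + (y\<^sup>2 - 2 * V y)) / (4 * h)) / sqrt (r0 x) * sqrt (rt y)"
          by (simp add: exp_add exp_diff e1 rtpos a.bounds(3))
        have ex: "exp (- (y - x)\<^sup>2 / (4 * h)) * exp (((x\<^sup>2 - 2 * U x) + (y\<^sup>2 - 2 * V y)) / (4 * h))
           = exp (- ((U x + V y - x * y) / (2 * h)))"
        proof -
          have "- (y - x)\<^sup>2 + ((x\<^sup>2 - 2 * U x) + (y\<^sup>2 - 2 * V y)) = - 2 * (U x + V y - x * y)"
            by (simp add: power2_eq_square algebra_simps)
          hence "- (y - x)\<^sup>2 / (4 * h) + ((x\<^sup>2 - 2 * U x) + (y\<^sup>2 - 2 * V y)) / (4 * h) = (- 2 * (U x + V y - x * y)) / (4 * h)"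
            unfolding add_divide_distrib[symmetric] by simp
          also have "\<dots> = - ((U x + V y - x * y) / (2 * h))"
          proof -
            have "- 2 * z / (4 * h) = - (z / (2 * h))" for z using h by (simp add: field_simps)
            thus ?thesis .
          qed
          finally show ?thesis by (simp only: exp_add[symmetric])
        qed
        have sq: "r0 x / sqrt (r0 x) = sqrt (r0 x)" using a.bounds(3)[of x] by (simp add: real_div_sqrt)
        have "c1 * ((E1 / c3) * (E2 / c2 * t)) = (c1 / c2) * t * (E1 * E2) / c3" for c1 c2 c3 E1 E2 t :: real
          by (simp add: mult_ac)
        hence "r0 x * (heat_kernel h x y * exp (f (x, y)))
          = (r0 x / sqrt (r0 x)) * sqrt (rt y) * (exp (- (y - x)\<^sup>2 / (4 * h)) * exp (((x\<^sup>2 - 2 * U x) + (y\<^sup>2 - 2 * V y)) / (4 * h))) / sqrt (4 * pi * h)"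
          unfolding heat_kernel_def ef .
        also have "\<dots> = sqrt (r0 x) * sqrt (rt y) * exp (- ((U x + V y - x * y) / (2 * h))) / sqrt (4 * pi * h)"
          unfolding sq ex by simp
        finally show ?thesis by (simp add: real_sqrt_mult)
      qed
      have "ennreal (indicator {0..L} x * r0 x) * (\<integral>\<^sup>+y. ennreal (heat_kernel h x y) * (ennreal (exp (f (x, y))) * indicator ({0..L} \<times> {0..L}) (x, y)) \<partial>lborel)
        = (\<integral>\<^sup>+y. ennreal (indicator {0..L} x * r0 x) * (ennreal (heat_kernel h x y) * (ennreal (exp (f (x, y))) * indicator ({0..L} \<times> {0..L}) (x, y))) \<partial>lborel)"
        by (rule nn_integral_cmult[symmetric]) (simp add: f_def heat_kernel_def)
      also have "\<dots> = (\<integral>\<^sup>+y. ennreal (sqrt (r0 x * rt y) * exp (- ((U x + V y - x * y) / (2 * h))) / sqrt (4 * pi * h))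
        * (indicator {0..L} x * indicator {0..L} y) \<partial>lborel)"
      proof (rule nn_integral_cong)
        fix y :: real
        show "ennreal (indicator {0..L} x * r0 x) * (ennreal (heat_kernel h x y) * (ennreal (exp (f (x, y))) * indicator ({0..L} \<times> {0..L}) (x, y)))
          = ennreal (sqrt (r0 x * rt y) * exp (- ((U x + V y - x * y) / (2 * h))) / sqrt (4 * pi * h)) * (indicator {0..L} x * indicator {0..L} y)"
          unfolding pw[symmetric] using a.bounds(3)[of x] heat_kernel_pos[OF h, of x y]
          by (auto simp: indicator_def ennreal_mult less_imp_le)
      qed
      finally show "ennreal (indicator {0..L} x * r0 x) * (\<integral>\<^sup>+y. ennreal (heat_kernel h x y) * (ennreal (exp (f (x, y))) * indicator ({0..L} \<times> {0..L}) (x, y)) \<partial>lborel)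
        = (\<integral>\<^sup>+y. ennreal (sqrt (r0 x * rt y) * exp (- ((U x + V y - x * y) / (2 * h))) / sqrt (4 * pi * h))
        * (indicator {0..L} x * indicator {0..L} y) \<partial>lborel)" .
    qed
    also note Z
    finally show "(\<integral>\<^sup>+z. ennreal (exp (f z)) * indicator ({0..L} \<times> {0..L}) z \<partial>heat_joint h (law L r0)) \<le> ennreal Z" .
  qed (rule Zpos)
qed

end

end

section \<open>The lower bound\<close>

text \<open>
  Clamping to the prescribed bounds changes \<open>\<rho>\<close> on a null set only, and it preserves continuity. In
  the continuous case \<open>\<rho>\<close> is first continued by its boundary values.
\<close>

lemma A_near_uniform:
  assumes L: "L > 0" and d: "\<delta> > 0" "\<delta> * L \<le> 1/100" and r: "\<rho> \<in> A L \<delta>"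
  shows "\<exists>r. near_uniform L \<delta> r \<and> meas L \<rho> = law L r
    \<and> entropy_fun (zero_ext L \<rho>) = (\<integral>x. ln (r x) \<partial>law L r) \<and> (continuous_on {0..L} \<rho> \<longrightarrow> continuous_on UNIV r)"
proof -
  define clamp where "clamp z = max (1 / L - \<delta>) (min (1 / L + \<delta>) z)" for z :: real
  have clamp: "\<bar>clamp z - 1 / L\<bar> \<le> \<delta>" for z unfolding clamp_def using d by (auto simp: abs_le_iff)
  have clamp_id: "clamp z = z" if "\<bar>z - 1 / L\<bar> \<le> \<delta>" for z using that unfolding clamp_def by (auto simp: abs_le_iff)
  have clamp_cont: "continuous_on UNIV clamp" unfolding clamp_def by (intro continuous_intros)
  have rm: "\<rho> \<in> borel_measurable (restrict_space lborel {0<..<L})" and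
    one: "(\<integral>x. indicator {0<..<L} x * \<rho> x \<partial>lborel) = 1" and
    ess: "esssup (restrict_space lborel {0<..<L}) (\<lambda>x. ereal \<bar>\<rho> x - 1 / L\<bar>) < ereal \<delta>"
    using r by (auto simp: A_def Linf_def Linf_norm_def set_lebesgue_integral_def)
  have "AE x in restrict_space lborel {0<..<L}. ereal \<bar>\<rho> x - 1 / L\<bar> \<le> esssup (restrict_space lborel {0<..<L}) (\<lambda>x. ereal \<bar>\<rho> x - 1 / L\<bar>)"
    by (rule esssup_AE)
  hence "AE x in restrict_space lborel {0<..<L}. \<bar>\<rho> x - 1 / L\<bar> \<le> \<delta>"
  proof eventually_elim
    case (elim x)
    hence "ereal \<bar>\<rho> x - 1 / L\<bar> < ereal \<delta>" using ess by (rule order_le_less_trans)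
    thus ?case by simp
  qed
  hence ae: "AE x in lborel. x \<in> {0<..<L} \<longrightarrow> \<bar>\<rho> x - 1 / L\<bar> \<le> \<delta>"
    by (subst (asm) AE_restrict_space_iff) auto
  have ends: "AE x in lborel. x \<noteq> 0 \<and> x \<noteq> L"
    using AE_lborel_singleton[of 0] AE_lborel_singleton[of L] by eventually_elim auto
  obtain r where rmeas[measurable]: "r \<in> borel_measurable borel" and near: "\<And>x. \<bar>r x - 1 / L\<bar> \<le> \<delta>"
    and req: "\<And>x. x \<in> {0<..<L} \<Longrightarrow> r x = clamp (\<rho> x)" and rc: "continuous_on {0..L} \<rho> \<longrightarrow> continuous_on UNIV r"
  proof (cases "continuous_on {0..L} \<rho>")
    case True
    define r where "r x = clamp (\<rho> (max 0 (min L x)))" for x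
    have "continuous_on UNIV (\<lambda>x. \<rho> (max 0 (min L x)))"
      by (rule continuous_on_compose2[OF True]) (use L in \<open>auto intro!: continuous_intros\<close>)
    hence c: "continuous_on UNIV r" unfolding r_def by (intro continuous_on_compose2[OF clamp_cont]) auto
    show ?thesis
      by (rule that[of r]) (use c clamp in \<open>auto simp: r_def borel_measurable_continuous_onI\<close>)
  next
    case False
    define r where "r x = clamp (if x \<in> {0<..<L} then \<rho> x else 1 / L)" for x
    have "(\<lambda>x. if x \<in> {0<..<L} then \<rho> x else 1 / L) \<in> borel_measurable lborel"
      using rm by (subst (asm) measurable_restrict_space_iff[where c = "1 / L"]) auto
    hence "r \<in> borel_measurable borel" unfolding r_def clamp_def by simp
    thus ?thesis by (intro that[of r]) (use False clamp in \<open>auto simp: r_def\<close>)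
  qed
  have eq: "AE x in lborel. zero_ext L \<rho> x = indicator {0..L} x * r x"
    using ae ends by eventually_elim (auto simp: zero_ext_def req clamp_id indicator_def)
  have zm[measurable]: "zero_ext L \<rho> \<in> borel_measurable borel"
  proof -
    have "(\<lambda>x. if x \<in> {0<..<L} then \<rho> x else 0) \<in> borel_measurable lborel"
      using rm by (subst (asm) measurable_restrict_space_iff[where c = 0]) auto
    thus ?thesis by (simp add: zero_ext_def[abs_def])
  qed
  have nu: "near_uniform L \<delta> r"
  proof
    have "(\<integral>x. indicator {0..L} x * r x \<partial>lborel) = (\<integral>x. zero_ext L \<rho> x \<partial>lborel)"
      by (rule integral_cong_AE) (use eq in \<open>auto elim!: eventually_mono\<close>)
    also have "\<dots> = (\<integral>x. indicator {0<..<L} x * \<rho> x \<partial>lborel)"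
      by (rule Bochner_Integration.integral_cong) (auto simp: zero_ext_def)
    finally show "(\<integral>x. indicator {0..L} x * r x \<partial>lborel) = 1" by (simp add: one)
  qed (use L d near rmeas in auto)
  interpret near_uniform L \<delta> r by (rule nu)
  have "meas L \<rho> = law L r" unfolding meas_def law_def
    by (rule density_cong) (use eq in \<open>auto elim!: eventually_mono\<close>)
  moreover have "entropy_fun (zero_ext L \<rho>) = (\<integral>x. ln (r x) \<partial>law L r)"
  proof -
    have "(\<integral>x. ln (r x) \<partial>law L r) = (\<integral>x. indicator {0..L} x * r x * ln (r x) \<partial>lborel)" by (rule integral_law) simp
    also have "\<dots> = (\<integral>x. zero_ext L \<rho> x * ln (zero_ext L \<rho> x) \<partial>lborel)"
    proof (rule integral_cong_AE)
      show "AE x in lborel. indicator {0..L} x * r x * ln (r x) = zero_ext L \<rho> x * ln (zero_ext L \<rho> x)"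
        using eq by eventually_elim (auto simp: indicator_def)
    qed measurable
    finally show ?thesis by (simp add: entropy_fun_def)
  qed
  ultimately show ?thesis using nu rc by blast
qed

context near_uniform
begin

text \<open>
  A measurable function is almost everywhere a limit of continuous ones; clamping keeps the
  approximations within the bounds, and dominated convergence applies. The approximations are not
  normalised exactly.
\<close>

lemma continuous_approximation:
  assumes e: "\<epsilon> > 0"
  shows "\<exists>rt. continuous_on UNIV rt \<and> (\<forall>x. \<bar>rt x - 1 / L\<bar> \<le> \<delta>)
    \<and> \<bar>(\<integral>x. ln (rt x) \<partial>law L \<rho>) - (\<integral>x. ln (\<rho> x) \<partial>law L \<rho>)\<bar> < \<epsilon> \<and> \<bar>integral {0..L} rt - 1\<bar> < \<epsilon>"
proof -
  define clamp where "clamp z = max (1 / L - \<delta>) (min (1 / L + \<delta>) z)" for z :: real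
  have clamp: "\<bar>clamp z - 1 / L\<bar> \<le> \<delta>" for z unfolding clamp_def using d by (auto simp: abs_le_iff)
  have clamp_id: "clamp z = z" if "\<bar>z - 1 / L\<bar> \<le> \<delta>" for z using that unfolding clamp_def by (auto simp: abs_le_iff)
  have clamp_cont: "continuous_on UNIV clamp" unfolding clamp_def by (intro continuous_intros)
  have "\<rho> \<in> borel_measurable lebesgue" by (rule measurable_completion) simp
  hence "\<rho> measurable_on UNIV" by (rule lebesgue_measurable_imp_measurable_on) auto
  then obtain N g where N: "negligible N" and g: "\<And>n. continuous_on UNIV (g n)"
    and lim: "\<And>x. x \<notin> N \<Longrightarrow> (\<lambda>n. g n x) \<longlonglongrightarrow> \<rho> x"
    unfolding measurable_on_def by (auto split: if_splits)
  define rt where "rt n x = clamp (g n x)" for n x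
  have rc: "continuous_on UNIV (rt n)" for n
    unfolding rt_def by (rule continuous_on_compose2[OF clamp_cont g]) simp
  have [measurable]: "rt n \<in> borel_measurable borel" for n by (rule borel_measurable_continuous_onI[OF rc])
  have rb: "\<bar>rt n x - 1 / L\<bar> \<le> \<delta>" for n x unfolding rt_def by (rule clamp)
  have rlim: "(\<lambda>n. rt n x) \<longlonglongrightarrow> \<rho> x" if "x \<notin> N" for x
  proof -
    have "isCont clamp (\<rho> x)" using clamp_cont by (simp add: continuous_on_eq_continuous_at)
    hence "(\<lambda>n. clamp (g n x)) \<longlonglongrightarrow> clamp (\<rho> x)" by (rule isCont_tendsto_compose[OF _ lim[OF that]])
    thus ?thesis by (simp add: rt_def[abs_def] clamp_id near)
  qed
  note bnd = near_bounds[OF rb] and lnb = near_ln_bound[OF rb]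
  have N0: "AE x in lborel. x \<notin> N"
  proof -
    have "AE x in lebesgue. x \<notin> N" using N by (simp add: negligible_iff_null_sets AE_not_in)
    thus ?thesis by (simp add: AE_completion_iff)
  qed
  have "(\<lambda>n. \<integral>x. ln (rt n x) \<partial>law L \<rho>) \<longlonglongrightarrow> (\<integral>x. ln (\<rho> x) \<partial>law L \<rho>)"
  proof (rule integral_dominated_convergence[where w = "\<lambda>_. \<bar>ln (99 / (100 * L))\<bar> + \<bar>ln (101 / (100 * L))\<bar>"])
    have "AE x in law L \<rho>. x \<notin> N" unfolding law_def by (subst AE_density) (use N0 in auto)
    thus "AE x in law L \<rho>. (\<lambda>n. ln (rt n x)) \<longlonglongrightarrow> ln (\<rho> x)"
    proof eventually_elim
      case (elim x)
      have "\<rho> x \<noteq> 0" using bounds(3)[of x] by simp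
      thus ?case using rlim[OF elim] by (intro tendsto_ln)
    qed
    show "AE x in law L \<rho>. norm (ln (rt n x)) \<le> \<bar>ln (99 / (100 * L))\<bar> + \<bar>ln (101 / (100 * L))\<bar>" for n
      using lnb by simp
  qed simp_all
  hence ev1: "eventually (\<lambda>n. \<bar>(\<integral>x. ln (rt n x) \<partial>law L \<rho>) - (\<integral>x. ln (\<rho> x) \<partial>law L \<rho>)\<bar> < \<epsilon>) sequentially"
    using e by (auto simp: tendsto_iff dist_real_def)
  have "(\<lambda>n. \<integral>x. indicator {0..L} x * rt n x \<partial>lborel) \<longlonglongrightarrow> (\<integral>x. indicator {0..L} x * \<rho> x \<partial>lborel)"
  proof (rule integral_dominated_convergence[where w = "\<lambda>x. indicator {0..L} x * (2 / L)"])
    show "integrable lborel (\<lambda>x. indicator {0..L} x * (2 / L))" by (rule integrable_indicator_const) auto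
    show "AE x in lborel. (\<lambda>n. indicator {0..L} x * rt n x) \<longlonglongrightarrow> indicator {0..L} x * \<rho> x"
      using N0 by eventually_elim (intro tendsto_intros rlim)
    have "\<bar>rt n x\<bar> \<le> 2 / L" for n x using bnd(3,4)[of n x] by simp
    thus "AE x in lborel. norm (indicator {0..L} x * rt n x) \<le> indicator {0..L} x * (2 / L)" for n
      by (auto simp: indicator_def)
  qed simp_all
  moreover have "(\<integral>x. indicator {0..L} x * rt n x \<partial>lborel) = integral {0..L} (rt n)" for n
  proof -
    have "set_integrable lborel {0..L} (rt n)"
      by (rule borel_integrable_atLeastAtMost') (rule continuous_on_subset[OF rc], simp)
    from set_borel_integral_eq_integral(2)[OF this] show ?thesis by (simp add: set_lebesgue_integral_def)
  qed
  ultimately have ev2: "eventually (\<lambda>n. \<bar>integral {0..L} (rt n) - 1\<bar> < \<epsilon>) sequentially"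
    using e by (auto simp: tendsto_iff dist_real_def mass)
  obtain n where "\<bar>(\<integral>x. ln (rt n x) \<partial>law L \<rho>) - (\<integral>x. ln (\<rho> x) \<partial>law L \<rho>)\<bar> < \<epsilon>" "\<bar>integral {0..L} (rt n) - 1\<bar> < \<epsilon>"
    using eventually_happens[OF eventually_conj[OF ev1 ev2]] by auto
  thus ?thesis using rc rb by blast
qed

end

text \<open>
  The quantity whose limit is sought, in terms of everywhere defined densities.
\<close>

definition "gap L h r r0 = J h (law L r) (law L r0) - ereal (1 / (4 * h)) * enn2ereal (wasserstein_sq (law L r) (law L r0))"

text \<open>
  The test function is built from a continuous approximation of the limit density instead of the
  densities \<open>rh h\<close>. Narrow convergence then suffices, and lower semicontinuity of the entropy is
  implicit.
\<close>

lemma gap_liminf: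
  assumes n0: "near_uniform L \<delta> r0" and c0: "continuous_on UNIV r0" and n: "near_uniform L \<delta> r"
    and nh: "\<And>h. h > 0 \<Longrightarrow> near_uniform L \<delta> (rh h)"
    and conv: "narrow_conv (\<lambda>h. law L (rh h)) (law L r) (at_right 0)" and e: "\<epsilon> > 0"
  shows "eventually (\<lambda>h. ereal ((\<integral>x. ln (r x) \<partial>law L r) / 2 - (\<integral>x. ln (r0 x) \<partial>law L r0) / 2 - \<epsilon>) \<le> gap L h (rh h) r0) (at_right 0)"
proof -
  interpret n0: near_uniform L \<delta> r0 by fact
  interpret n: near_uniform L \<delta> r by fact
  \<comment> \<open>half of \<open>\<eta>\<close> is lost by each of the approximation and the convergence, and \<open>3/2 * \<eta>\<close> by \<open>ln Z\<close>\<close>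
  define \<eta> where "\<eta> = \<epsilon> / 3"
  have eta: "\<eta> > 0" using e by (simp add: \<eta>_def)
  obtain rt where rc: "continuous_on UNIV rt" and rb: "\<And>x. \<bar>rt x - 1 / L\<bar> \<le> \<delta>"
    and r1: "\<bar>(\<integral>x. ln (rt x) \<partial>law L r) - (\<integral>x. ln (r x) \<partial>law L r)\<bar> < \<eta>" and r2: "\<bar>integral {0..L} rt - 1\<bar> < \<eta>"
    using n.continuous_approximation[OF eta] by blast
  have rm: "rt \<in> borel_measurable borel" by (rule borel_measurable_continuous_onI[OF rc])
  note bnd = n.near_bounds[OF rb]
  have "((\<lambda>h. \<integral>x. ln (rt x) \<partial>law L (rh h)) \<longlongrightarrow> (\<integral>x. ln (rt x) \<partial>law L r)) (at_right 0)"
  proof -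
    have "continuous_on UNIV (\<lambda>x. ln (rt x))" by (intro continuous_on_ln rc) (metis bnd(3) less_irrefl)
    moreover have "bounded (range (\<lambda>x. ln (rt x)))"
      by (rule boundedI[where B = "\<bar>ln (99 / (100 * L))\<bar> + \<bar>ln (101 / (100 * L))\<bar>"]) (use n.near_ln_bound[OF rb] in auto)
    ultimately show ?thesis using conv unfolding narrow_conv_def by blast
  qed
  hence ev: "eventually (\<lambda>h. \<bar>(\<integral>x. ln (rt x) \<partial>law L (rh h)) - (\<integral>x. ln (rt x) \<partial>law L r)\<bar> < \<eta>) (at_right 0)"
    using eta by (auto simp: tendsto_iff dist_real_def)
  have i0: "integral {0..L} r0 = 1"
  proof -
    have "set_integrable lborel {0..L} r0"
      by (rule borel_integrable_atLeastAtMost') (rule continuous_on_subset[OF c0], simp)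
    from set_borel_integral_eq_integral(2)[OF this] show ?thesis by (simp add: set_lebesgue_integral_def n0.mass)
  qed
  obtain h0 where h0: "h0 > 0" "\<And>h T S U V. 0 < h \<Longrightarrow> h < h0 \<Longrightarrow> transport T S (99/101) \<Longrightarrow> T 0 = 0 \<Longrightarrow> T L = L \<Longrightarrow> transport.potentials T S U V \<Longrightarrow>
    (\<integral>\<^sup>+x. \<integral>\<^sup>+y. ennreal (sqrt (r0 x * rt y) * exp (- ((U x + V y - x * y) / (2 * h))) / sqrt (4 * pi * h))
        * (indicator {0..L} x * indicator {0..L} y) \<partial>lborel \<partial>lborel)
    \<le> ennreal ((integral {0..L} r0 + integral {0..L} rt) / 2 + \<eta>)"
    using kernel_mass_le[OF n.L n.d(2) eta c0 rc n0.near rb refl] by blast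
  have "eventually (\<lambda>h. 0 < h \<and> h < h0) (at_right (0::real))"
    using eventually_at_right_less[of 0] eventually_at_right_field[of "\<lambda>h. h < h0" 0] h0(1) by (auto intro: eventually_conj)
  with ev show ?thesis
  proof eventually_elim
    case (elim h)
    hence h: "0 < h" "h < h0" by auto
    interpret nh: near_uniform L \<delta> "rh h" by (rule nh[OF h(1)])
    interpret two_densities L \<delta> r0 "rh h" ..
    obtain U V where pot: "tr.potentials U V" using tr.potentials_exist by blast
    define Z where "Z = (integral {0..L} r0 + integral {0..L} rt) / 2 + \<eta>"
    have "integral {0..L} rt < 1 + \<eta>" "1 - \<eta> < integral {0..L} rt" using r2 by linarith+
    hence Z: "0 < Z" "Z \<le> 1 + 3/2 * \<eta>" using eta by (simp_all add: Z_def i0 field_simps)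
    have lnZ: "ln Z \<le> 3/2 * \<eta>" using ln_le_minus_one[OF Z(1)] Z(2) by linarith
    have J: "ereal (w U V / (4 * h) - (\<integral>x. ln (r0 x) \<partial>law L r0) / 2 + (\<integral>y. ln (rt y) \<partial>law L (rh h)) / 2 - ln Z) \<le> J h (law L (rh h)) (law L r0)"
      by (rule J_ge[OF pot h(1) rm rb _ Z(1)]) (use h0(2)[OF h transport_T T_ends pot] in \<open>simp add: Z_def\<close>)
    have W: "ereal (1 / (4 * h)) * enn2ereal (wasserstein_sq (law L (rh h)) (law L r0)) = ereal (w U V / (4 * h))"
      using w_nonneg[OF pot] by (simp add: wasserstein_eq[OF pot])
    have "ereal ((\<integral>x. ln (r x) \<partial>law L r) / 2 - (\<integral>x. ln (r0 x) \<partial>law L r0) / 2 - \<epsilon>)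
      \<le> ereal ((w U V / (4 * h) - (\<integral>x. ln (r0 x) \<partial>law L r0) / 2 + (\<integral>y. ln (rt y) \<partial>law L (rh h)) / 2 - ln Z) - w U V / (4 * h))"
      using elim(1) r1 lnZ e unfolding \<eta>_def ereal_less_eq abs_less_iff by linarith
    also have "\<dots> \<le> gap L h (rh h) r0"
      unfolding gap_def W using J by (cases "J h (law L (rh h)) (law L r0)") auto
    finally show ?case .
  qed
qed

section \<open>Couplings from kernels in mass coordinates\<close>

lemma abs_mult_ln_le:
  fixes x B :: real assumes "0 \<le> x" "x \<le> B" shows "\<bar>x * ln x\<bar> \<le> 1 + B\<^sup>2"
proof (cases "x = 0")
  case False
  with assms have x: "x > 0" by simp
  have "x * ln x \<le> x * x"
    using ln_le_minus_one[OF x] x by (intro mult_left_mono) auto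
  also have "\<dots> \<le> B\<^sup>2" using assms by (simp add: power2_eq_square mult_mono)
  finally show ?thesis using mult_ln_ge_neg_one[OF assms(1)] zero_le_power2[of B] unfolding abs_le_iff by linarith
qed simp

context two_densities
begin

interpretation uni: near_uniform L \<delta> "\<lambda>_. 1 / L" by (rule near_uniform_const[OF a.L a.d])

lemma nn_integral_unif:
  assumes [measurable]: "f \<in> borel_measurable borel"
  shows "(\<integral>\<^sup>+s. f s \<partial>a.unif) = ennreal (1 / L) * (\<integral>\<^sup>+s. f s * indicator {0..L} s \<partial>lborel)"
proof -
  have "(\<integral>\<^sup>+s. f s \<partial>a.unif) = (\<integral>\<^sup>+s. ennreal (indicator {0..L} s * (1 / L)) * f s \<partial>lborel)"
    unfolding law_def by (subst nn_integral_density) auto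
  also have "\<dots> = (\<integral>\<^sup>+s. ennreal (1 / L) * (f s * indicator {0..L} s) \<partial>lborel)"
    by (rule nn_integral_cong) (auto simp: indicator_def)
  also have "\<dots> = ennreal (1 / L) * (\<integral>\<^sup>+s. f s * indicator {0..L} s \<partial>lborel)" by (rule nn_integral_cmult) simp
  finally show ?thesis .
qed

text \<open>
  Entropy density of a kernel relative to the Gaussian normalisation, plus its transport cost beyond the
  optimal one, in mass coordinates.
\<close>

definition excess :: "(real \<Rightarrow> real) \<Rightarrow> (real \<Rightarrow> real) \<Rightarrow> real \<Rightarrow> (real \<Rightarrow> real \<Rightarrow> real) \<Rightarrow> real \<Rightarrow> real \<Rightarrow> real" where
  "excess U V h \<kappa> s t = \<kappa> s t * (ln (L * \<kappa> s t) + ln (4 * pi * h) / 2 + (U (a.X s) + V (b.X t) - a.X s * b.X t) / (2 * h))"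

context
  fixes U V :: "real \<Rightarrow> real" and h C :: real and \<kappa> :: "real \<Rightarrow> real \<Rightarrow> real"
  assumes pot: "tr.potentials U V" and h: "h > 0"
    and km[measurable]: "(\<lambda>z. \<kappa> (fst z) (snd z)) \<in> borel_measurable (borel \<Otimes>\<^sub>M borel)"
    and k0: "\<And>s t. \<kappa> s t \<ge> 0" and kC: "\<And>s t. \<kappa> s t \<le> C" and ksym: "\<And>s t. \<kappa> s t = \<kappa> t s"
    and ksupp: "\<And>s t. \<kappa> s t \<noteq> 0 \<Longrightarrow> s \<in> {0..L}"
    and kone: "\<And>s. s \<in> {0..<L} \<Longrightarrow> (\<integral>\<^sup>+t. ennreal (\<kappa> s t) \<partial>lborel) = 1"
begin

lemma ksupp2: "\<kappa> s t \<noteq> 0 \<Longrightarrow> t \<in> {0..L}" using ksupp[of t s] ksym[of s t] by simp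

definition "k z = L * \<kappa> (a.F (fst z)) (b.F (snd z))"
definition "q = density (law L r0 \<Otimes>\<^sub>M law L r1) (\<lambda>z. ennreal (k z))"

lemma k_meas [measurable]: "k \<in> borel_measurable (borel \<Otimes>\<^sub>M borel)"
proof -
  have "(\<lambda>z. (a.F (fst z), b.F (snd z))) \<in> borel \<Otimes>\<^sub>M borel \<rightarrow>\<^sub>M borel \<Otimes>\<^sub>M borel" by measurable
  from measurable_compose[OF this km] show ?thesis unfolding k_def by simp
qed

lemma k_nonneg: "k z \<ge> 0" using k0 a.L by (simp add: k_def)

lemma q_sets [measurable_cong]: "sets q = sets (borel \<Otimes>\<^sub>M borel)"
  unfolding q_def by (simp cong: sets_pair_measure_cong)

lemma F_meas: "a.F \<in> law L r0 \<rightarrow>\<^sub>M borel" "b.F \<in> law L r1 \<rightarrow>\<^sub>M borel"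
  unfolding measurable_cong_sets[OF a.sets_law refl] measurable_cong_sets[OF b.sets_law refl]
  by (rule a.F_measurable b.F_measurable)+

lemma k_sec: "(\<lambda>y. ennreal (k (x, y))) \<in> borel_measurable (law L r1)" "(\<lambda>x. ennreal (k (x, y))) \<in> borel_measurable (law L r0)"
  by measurable

lemma k_row: "a.F x \<in> {0..<L} \<Longrightarrow> (\<integral>\<^sup>+y. ennreal (k (x, y)) \<partial>law L r1) = 1"
proof -
  assume x: "a.F x \<in> {0..<L}"
  have [measurable]: "(\<lambda>t. \<kappa> (a.F x) t) \<in> borel_measurable borel"
    using measurable_compose[OF measurable_Pair1' km, of "a.F x"] by simp
  have "(\<integral>\<^sup>+y. ennreal (k (x, y)) \<partial>law L r1) = (\<integral>\<^sup>+t. ennreal (L * \<kappa> (a.F x) t) \<partial>distr (law L r1) borel b.F)"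
    by (subst nn_integral_distr[OF F_meas(2)]) (auto simp: k_def)
  also have "\<dots> = ennreal (1 / L) * (\<integral>\<^sup>+t. ennreal (L * \<kappa> (a.F x) t) * indicator {0..L} t \<partial>lborel)"
    unfolding b.distr_F by (rule nn_integral_unif) simp
  also have "(\<integral>\<^sup>+t. ennreal (L * \<kappa> (a.F x) t) * indicator {0..L} t \<partial>lborel) = (\<integral>\<^sup>+t. ennreal L * ennreal (\<kappa> (a.F x) t) \<partial>lborel)"
    using a.L ksupp2[of "a.F x"] k0 by (intro nn_integral_cong) (auto simp: indicator_def ennreal_mult')
  also have "\<dots> = ennreal L" by (subst nn_integral_cmult) (auto simp: kone[OF x])
  finally show ?thesis using a.L by (simp add: ennreal_mult[symmetric])
qed

lemma k_col: "b.F y \<in> {0..<L} \<Longrightarrow> (\<integral>\<^sup>+x. ennreal (k (x, y)) \<partial>law L r0) = 1"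
proof -
  assume y: "b.F y \<in> {0..<L}"
  have [measurable]: "(\<lambda>t. \<kappa> (b.F y) t) \<in> borel_measurable borel"
    using measurable_compose[OF measurable_Pair1' km, of "b.F y"] by simp
  have "(\<integral>\<^sup>+x. ennreal (k (x, y)) \<partial>law L r0) = (\<integral>\<^sup>+t. ennreal (L * \<kappa> (b.F y) t) \<partial>distr (law L r0) borel a.F)"
    by (subst nn_integral_distr[OF F_meas(1)]) (auto simp: k_def ksym[of "a.F _"])
  also have "\<dots> = ennreal (1 / L) * (\<integral>\<^sup>+t. ennreal (L * \<kappa> (b.F y) t) * indicator {0..L} t \<partial>lborel)"
    unfolding a.distr_F by (rule nn_integral_unif) simp
  also have "(\<integral>\<^sup>+t. ennreal (L * \<kappa> (b.F y) t) * indicator {0..L} t \<partial>lborel) = (\<integral>\<^sup>+t. ennreal L * ennreal (\<kappa> (b.F y) t) \<partial>lborel)"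
    using a.L ksupp2[of "b.F y"] k0 by (intro nn_integral_cong) (auto simp: indicator_def ennreal_mult')
  also have "\<dots> = ennreal L" by (subst nn_integral_cmult) (auto simp: kone[OF y])
  finally show ?thesis using a.L by (simp add: ennreal_mult[symmetric])
qed

lemma AE_F: "AE x in law L r0. a.F x \<in> {0..<L}" "AE y in law L r1. b.F y \<in> {0..<L}"
proof -
  have "AE x in law L r0. x \<noteq> L" unfolding law_def
    by (subst AE_density) (use AE_lborel_singleton[of L] in \<open>auto elim!: eventually_mono\<close>)
  with a.AE_law show "AE x in law L r0. a.F x \<in> {0..<L}"
  proof eventually_elim
    case (elim x)
    thus ?case using a.F_le_iff[of 0 x] a.F_le_iff[of L x] by auto
  qed
  have "AE x in law L r1. x \<noteq> L" unfolding law_def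
    by (subst AE_density) (use AE_lborel_singleton[of L] in \<open>auto elim!: eventually_mono\<close>)
  with b.AE_law show "AE x in law L r1. b.F x \<in> {0..<L}"
  proof eventually_elim
    case (elim x)
    thus ?case using b.F_le_iff[of 0 x] b.F_le_iff[of L x] by auto
  qed
qed

lemma nn_integral_q:
  assumes [measurable]: "f \<in> borel_measurable (borel \<Otimes>\<^sub>M borel)"
  shows "(\<integral>\<^sup>+z. f z \<partial>q) = (\<integral>\<^sup>+z. ennreal (k z) * f z \<partial>(law L r0 \<Otimes>\<^sub>M law L r1))"
  unfolding q_def by (rule nn_integral_density) auto

lemma q_coupling: "q \<in> couplings (law L r0) (law L r1)"
proof -
  interpret P: pair_prob_space "law L r0" "law L r1" ..
  have m: "fst \<in> q \<rightarrow>\<^sub>M borel" "snd \<in> q \<rightarrow>\<^sub>M borel" by measurable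
  \<comment> \<open>unit row sums give the first marginal, unit column sums the second\<close>
  have f: "distr q borel fst = law L r0"
  proof (rule measure_eqI)
    fix B assume "B \<in> sets (distr q borel fst)"
    hence B[measurable]: "B \<in> sets borel" by simp
    have "emeasure (distr q borel fst) B = (\<integral>\<^sup>+x. indicator B x \<partial>distr q borel fst)" by simp
    also have "\<dots> = (\<integral>\<^sup>+z. indicator B (fst z) \<partial>q)" by (subst nn_integral_distr[OF m(1)]) auto
    also have "\<dots> = (\<integral>\<^sup>+z. ennreal (k z) * indicator B (fst z) \<partial>(law L r0 \<Otimes>\<^sub>M law L r1))" by (rule nn_integral_q) simp
    also have "\<dots> = (\<integral>\<^sup>+x. \<integral>\<^sup>+y. ennreal (k (x, y)) * indicator B x \<partial>law L r1 \<partial>law L r0)"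
      by (subst b.prob.nn_integral_fst[symmetric]) auto
    also have "\<dots> = (\<integral>\<^sup>+x. indicator B x \<partial>law L r0)"
    proof (rule nn_integral_cong_AE)
      show "AE x in law L r0. (\<integral>\<^sup>+y. ennreal (k (x, y)) * indicator B x \<partial>law L r1) = indicator B x"
        using AE_F(1) by eventually_elim (simp add: nn_integral_multc[OF k_sec(1)] k_row)
    qed
    also have "\<dots> = emeasure (law L r0) B" by simp
    finally show "emeasure (distr q borel fst) B = emeasure (law L r0) B" .
  qed simp
  have s: "distr q borel snd = law L r1"
  proof (rule measure_eqI)
    fix B assume "B \<in> sets (distr q borel snd)"
    hence B[measurable]: "B \<in> sets borel" by simp
    have "emeasure (distr q borel snd) B = (\<integral>\<^sup>+x. indicator B x \<partial>distr q borel snd)" by simp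
    also have "\<dots> = (\<integral>\<^sup>+z. indicator B (snd z) \<partial>q)" by (subst nn_integral_distr[OF m(2)]) auto
    also have "\<dots> = (\<integral>\<^sup>+z. ennreal (k z) * indicator B (snd z) \<partial>(law L r0 \<Otimes>\<^sub>M law L r1))" by (rule nn_integral_q) simp
    also have "\<dots> = (\<integral>\<^sup>+x. \<integral>\<^sup>+y. ennreal (k (x, y)) * indicator B y \<partial>law L r1 \<partial>law L r0)"
      by (subst b.prob.nn_integral_fst[symmetric]) auto
    also have "\<dots> = (\<integral>\<^sup>+y. \<integral>\<^sup>+x. ennreal (k (x, y)) * indicator B y \<partial>law L r0 \<partial>law L r1)"
      by (rule P.Fubini'[symmetric]) (simp add: split_beta')
    also have "\<dots> = (\<integral>\<^sup>+x. indicator B x \<partial>law L r1)"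
    proof (rule nn_integral_cong_AE)
      show "AE y in law L r1. (\<integral>\<^sup>+x. ennreal (k (x, y)) * indicator B y \<partial>law L r0) = indicator B y"
        using AE_F(2) by eventually_elim (simp add: nn_integral_multc[OF k_sec(2)] k_col)
    qed
    also have "\<dots> = emeasure (law L r1) B" by simp
    finally show "emeasure (distr q borel snd) B = emeasure (law L r1) B" .
  qed simp
  have "emeasure q (space q) = emeasure (distr q borel fst) UNIV"
    by (subst emeasure_distr[OF m(1)]) (auto)
  also have "\<dots> = 1" unfolding f using a.prob.emeasure_space_1 by simp
  finally have "prob_space q" by (rule prob_spaceI)
  moreover have "sets q = sets borel" unfolding q_sets borel_prod ..
  ultimately show ?thesis using f s unfolding couplings_def space_prob_algebra by blast
qed

definition "\<phi> z = indicator {0..L} (snd z) * r1 (snd z) * k z / heat_kernel h (fst z) (snd z)"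

lemma phi_meas [measurable]: "\<phi> \<in> borel_measurable (borel \<Otimes>\<^sub>M borel)"
  unfolding \<phi>_def by measurable

lemma phi_nonneg: "\<phi> z \<ge> 0"
  unfolding \<phi>_def using b.bounds(3)[of "snd z"] k_nonneg[of z] heat_kernel_pos[OF h, of "fst z" "snd z"]
  by (auto simp: indicator_def intro!: divide_nonneg_pos)

lemma q_density: "q = density (heat_joint h (law L r0)) (\<lambda>z. ennreal (\<phi> z))"
proof -
  have sb: "sets (law L r0 \<Otimes>\<^sub>M lborel) = sets (borel \<Otimes>\<^sub>M borel)" by (simp cong: sets_pair_measure_cong)
  note [measurable_cong] = sb
  have "law L r0 \<Otimes>\<^sub>M law L r1 = density (law L r0) (\<lambda>_. 1) \<Otimes>\<^sub>M density lborel (\<lambda>y. ennreal (indicator {0..L} y * r1 y))"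
    by (simp add: density_1 flip: law_def)
  also have "\<dots> = density (law L r0 \<Otimes>\<^sub>M lborel) (\<lambda>(x, y). 1 * ennreal (indicator {0..L} y * r1 y))"
    by (rule pair_measure_density) (auto intro: lborel.sigma_finite_measure_axioms b.prob.sigma_finite_measure_axioms simp flip: law_def)
  finally have e: "law L r0 \<Otimes>\<^sub>M law L r1 = density (law L r0 \<Otimes>\<^sub>M lborel) (\<lambda>z. ennreal (indicator {0..L} (snd z) * r1 (snd z)))"
    by (simp add: split_beta')
  have "q = density (law L r0 \<Otimes>\<^sub>M lborel) (\<lambda>z. ennreal (indicator {0..L} (snd z) * r1 (snd z)) * ennreal (k z))"
    unfolding q_def e by (rule density_density_eq) auto
  also have "\<dots> = density (law L r0 \<Otimes>\<^sub>M lborel) (\<lambda>z. ennreal (heat_kernel h (fst z) (snd z)) * ennreal (\<phi> z))"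
  proof (rule density_cong)
    have "ennreal (indicator {0..L} (snd z) * r1 (snd z)) * ennreal (k z) = ennreal (heat_kernel h (fst z) (snd z)) * ennreal (\<phi> z)" for z
      using b.bounds(3)[of "snd z"] k_nonneg[of z] heat_kernel_pos[OF h, of "fst z" "snd z"]
      by (auto simp: \<phi>_def indicator_def ennreal_mult[symmetric] less_imp_le)
    thus "AE z in law L r0 \<Otimes>\<^sub>M lborel. ennreal (indicator {0..L} (snd z) * r1 (snd z)) * ennreal (k z) = ennreal (heat_kernel h (fst z) (snd z)) * ennreal (\<phi> z)"
      by simp
  qed auto
  also have "\<dots> = density (heat_joint h (law L r0)) (\<lambda>z. ennreal (\<phi> z))"
    unfolding heat_joint_def by (subst density_density_eq) (auto simp: split_beta')
  finally show ?thesis .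
qed

lemma phi_bounded: "\<exists>B. \<forall>z. \<phi> z \<le> B"
proof -
  define m where "m = exp (- (L\<^sup>2 / (4 * h))) / sqrt (4 * pi * h)"
  have m: "m > 0" using h by (simp add: m_def)
  have C: "C \<ge> 0" using k0[of 0 0] kC[of 0 0] by simp
  have "\<phi> z \<le> (2 / L) * (L * C) / m" for z
  proof (cases "k z = 0 \<or> snd z \<notin> {0..L}")
    case True
    hence "\<phi> z = 0" by (auto simp: \<phi>_def)
    thus ?thesis using a.L C m by simp
  next
    case False
    hence z: "snd z \<in> {0..L}" "k z \<noteq> 0" by auto
    have "a.F (fst z) \<in> {0..L}" using ksupp[of "a.F (fst z)"] z(2) by (auto simp: k_def)
    hence "fst z \<in> {0..L}" using a.F_le_iff[of 0 "fst z"] a.F_le_iff[of "fst z" L] by simp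
    hence "\<bar>snd z - fst z\<bar> \<le> L" using z(1) by auto
    hence "(snd z - fst z)\<^sup>2 \<le> L\<^sup>2" using a.L by (metis abs_le_square_iff abs_of_pos)
    hence "- (L\<^sup>2 / (4 * h)) \<le> - (snd z - fst z)\<^sup>2 / (4 * h)" using h by (simp add: divide_right_mono)
    hence "m \<le> heat_kernel h (fst z) (snd z)"
      unfolding m_def heat_kernel_def using h by (intro divide_right_mono) auto
    moreover have "r1 (snd z) * k z \<le> 2 / L * (L * C)"
      using b.bounds(3,4)[of "snd z"] kC[of "a.F (fst z)" "b.F (snd z)"] k0[of "a.F (fst z)" "b.F (snd z)"] a.L
      unfolding k_def by (intro mult_mono mult_nonneg_nonneg) auto
    ultimately show ?thesis
      using z m a.L C b.bounds(3)[of "snd z"] k_nonneg[of z] unfolding \<phi>_def by (intro frac_le) auto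
  qed
  thus ?thesis by blast
qed

lemma excess_meas [measurable]: "(\<lambda>z. excess U V h \<kappa> (fst z) (snd z)) \<in> borel_measurable (borel \<Otimes>\<^sub>M borel)"
proof -
  have [measurable]: "U \<in> borel_measurable borel" "V \<in> borel_measurable borel" by (rule pot_meas[OF pot])+
  show ?thesis unfolding excess_def by measurable
qed

text \<open>
  The logarithm of the density of the coupling splits into \<open>ln r1\<close>, a separable quadratic part and the
  excess. The quadratic part integrates to \<open>w U V / 4h\<close>, which is exactly the Wasserstein term that is
  subtracted.
\<close>

lemma gap_le_excess:
  "gap L h r1 r0 \<le> ereal ((\<integral>y. ln (r1 y) \<partial>law L r1) + (\<integral>z. excess U V h \<kappa> (fst z) (snd z) \<partial>(lborel \<Otimes>\<^sub>M lborel)) / L)"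
proof -
  interpret P: pair_prob_space "law L r0" "law L r1" ..
  interpret hj: prob_space "heat_joint h (law L r0)" by (rule prob_space_heat_joint[OF h a.prob.prob_space_axioms a.sets_law])
  have [measurable_cong]: "sets (heat_joint h (law L r0)) = sets (borel \<Otimes>\<^sub>M borel)" by simp
  have [measurable]: "U \<in> borel_measurable borel" "V \<in> borel_measurable borel" by (rule pot_meas[OF pot])+
  obtain B where B: "\<And>z. \<phi> z \<le> B" using phi_bounded by blast
  have pint: "integrable (heat_joint h (law L r0)) (\<lambda>z. \<phi> z * ln (\<phi> z))"
    by (rule hj.integrable_const_bound[where B = "1 + B\<^sup>2"]) (use abs_mult_ln_le[OF phi_nonneg B] in auto)
  have re: "relative_entropy q (heat_joint h (law L r0)) = ereal (\<integral>z. \<phi> z * ln (\<phi> z) \<partial>heat_joint h (law L r0))"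
    unfolding q_density by (rule relative_entropy_density) (auto intro: hj.sigma_finite_measure_axioms phi_nonneg pint)
  have lint: "integrable q (\<lambda>z. ln (\<phi> z))" and leq: "(\<integral>z. ln (\<phi> z) \<partial>q) = (\<integral>z. \<phi> z * ln (\<phi> z) \<partial>heat_joint h (law L r0))"
    unfolding q_density using pint by (auto simp: integrable_real_density integral_real_density phi_nonneg)
  note ci = couplings_integral[OF q_coupling]
  have i1: "integrable (law L r1) (\<lambda>y. ln (r1 y))" by (rule b.integrable_law[OF _ b.ln_bound]) simp
  define A1 where "A1 z = ln (r1 (snd z))" for z :: "real \<times> real"
  define A2 where "A2 z = ((fst z)\<^sup>2 - 2 * U (fst z)) / (4 * h) + ((snd z)\<^sup>2 - 2 * V (snd z)) / (4 * h)" for z :: "real \<times> real"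
  define A3 where "A3 z = ln (k z) + ln (4 * pi * h) / 2 + (U (fst z) + V (snd z) - fst z * snd z) / (2 * h)" for z :: "real \<times> real"
  have A1: "integrable q A1" "(\<integral>z. A1 z \<partial>q) = (\<integral>y. ln (r1 y) \<partial>law L r1)"
    unfolding A1_def using ci(2,4)[of "\<lambda>y. ln (r1 y)"] i1 by auto
  have A2: "integrable q A2" "(\<integral>z. A2 z \<partial>q) = w U V / (4 * h)"
    unfolding A2_def w_def
    using ci(1,3)[of "\<lambda>x. x\<^sup>2 - 2 * U x"] ci(2,4)[of "\<lambda>x. x\<^sup>2 - 2 * V x"] pot_integrable[OF pot]
    by (auto simp: add_divide_distrib)
  have split: "AE z in q. ln (\<phi> z) = A1 z + A2 z + A3 z"
  proof -
    have "AE z in q. 0 < k z" unfolding q_def by (subst AE_density) (auto simp: k_nonneg less_le)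
    moreover have "AE z in q. snd z \<in> {0..L}" by (rule couplings_AE(2)[OF q_coupling]) (rule b.AE_law)
    ultimately show ?thesis
    proof eventually_elim
      case (elim z)
      have hk: "ln (heat_kernel h (fst z) (snd z)) = - (snd z - fst z)\<^sup>2 / (4 * h) - ln (4 * pi * h) / 2"
        unfolding heat_kernel_def using h by (simp add: ln_div ln_sqrt)
      have "ln (\<phi> z) = ln (r1 (snd z)) + ln (k z) - ln (heat_kernel h (fst z) (snd z))"
        unfolding \<phi>_def using elim b.bounds(3)[of "snd z"] heat_kernel_pos[OF h, of "fst z" "snd z"]
        by (simp add: ln_div ln_mult)
      moreover have "(snd z - fst z)\<^sup>2 / (4 * h) = A2 z + (U (fst z) + V (snd z) - fst z * snd z) / (2 * h)"
      proof -
        have "(snd z - fst z)\<^sup>2 = (((fst z)\<^sup>2 - 2 * U (fst z)) + ((snd z)\<^sup>2 - 2 * V (snd z))) + 2 * (U (fst z) + V (snd z) - fst z * snd z)"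
          by (simp add: power2_diff)
        hence "(snd z - fst z)\<^sup>2 / (4 * h) = A2 z + 2 * (U (fst z) + V (snd z) - fst z * snd z) / (4 * h)"
          by (simp only: A2_def add_divide_distrib)
        moreover have "2 * c / (4 * h) = c / (2 * h)" for c by simp
        ultimately show ?thesis by (simp only:)
      qed
      ultimately show ?case unfolding hk A1_def A3_def by simp
    qed
  qed
  have [measurable]: "A1 \<in> borel_measurable q" "A2 \<in> borel_measurable q" "A3 \<in> borel_measurable q"
    unfolding A1_def A2_def A3_def by measurable
  have A3i: "integrable q A3"
  proof (rule integrable_cong_AE_imp)
    show "integrable q (\<lambda>z. ln (\<phi> z) - A1 z - A2 z)" using lint A1 A2 by simp
    show "AE z in q. ln (\<phi> z) - A1 z - A2 z = A3 z" using split by eventually_elim simp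
  qed simp
  have "(\<integral>z. ln (\<phi> z) \<partial>q) = (\<integral>z. A1 z + A2 z + A3 z \<partial>q)"
    by (rule integral_cong_AE) (use split in auto)
  also have "\<dots> = (\<integral>y. ln (r1 y) \<partial>law L r1) + w U V / (4 * h) + (\<integral>z. A3 z \<partial>q)"
    using A1 A2 A3i by simp
  also have "(\<integral>z. A3 z \<partial>q) = (\<integral>z. excess U V h \<kappa> (fst z) (snd z) \<partial>(lborel \<Otimes>\<^sub>M lborel)) / L"
  proof -
    define G where "G z = L * excess U V h \<kappa> (fst z) (snd z)" for z
    have [measurable]: "G \<in> borel_measurable (borel \<Otimes>\<^sub>M borel)" unfolding G_def by measurable
    have mF: "(\<lambda>(x, y). (a.F x, b.F y)) \<in> law L r0 \<Otimes>\<^sub>M law L r1 \<rightarrow>\<^sub>M borel \<Otimes>\<^sub>M borel" by measurable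
    have "(\<integral>z. A3 z \<partial>q) = (\<integral>z. k z * A3 z \<partial>(law L r0 \<Otimes>\<^sub>M law L r1))"
      unfolding q_def A3_def by (rule integral_real_density) (auto simp: k_nonneg)
    also have "\<dots> = (\<integral>z. G (a.F (fst z), b.F (snd z)) \<partial>(law L r0 \<Otimes>\<^sub>M law L r1))"
      by (simp add: G_def excess_def k_def A3_def mult.assoc)
    also have "\<dots> = (\<integral>z. G z \<partial>distr (law L r0 \<Otimes>\<^sub>M law L r1) (borel \<Otimes>\<^sub>M borel) (\<lambda>(x, y). (a.F x, b.F y)))"
      by (subst integral_distr[OF mF]) (auto simp: split_beta')
    also have "distr (law L r0 \<Otimes>\<^sub>M law L r1) (borel \<Otimes>\<^sub>M borel) (\<lambda>(x, y). (a.F x, b.F y)) = a.unif \<Otimes>\<^sub>M a.unif"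
      using pair_measure_distr[of a.F "law L r0" borel b.F "law L r1" borel] uni.prob.sigma_finite_measure_axioms
      by (simp add: a.distr_F b.distr_F)
    also have "a.unif \<Otimes>\<^sub>M a.unif = density (lborel \<Otimes>\<^sub>M lborel) (\<lambda>(s, t). ennreal (indicator {0..L} s * (1 / L)) * ennreal (indicator {0..L} t * (1 / L)))"
      unfolding law_def
      by (rule pair_measure_density) (use uni.prob.sigma_finite_measure_axioms in \<open>auto intro: lborel.sigma_finite_measure_axioms simp: law_def\<close>)
    also have "\<dots> = density (lborel \<Otimes>\<^sub>M lborel) (\<lambda>z. ennreal (indicator ({0..L} \<times> {0..L}) z / L\<^sup>2))"
      by (rule arg_cong[where f = "density _"]) (use a.L in \<open>auto simp: fun_eq_iff indicator_def ennreal_mult[symmetric] power2_eq_square\<close>)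
    also have "(\<integral>z. G z \<partial>\<dots>) = (\<integral>z. indicator ({0..L} \<times> {0..L}) z / L\<^sup>2 * G z \<partial>(lborel \<Otimes>\<^sub>M lborel))"
      by (rule integral_real_density) auto
    also have "\<dots> = (\<integral>z. excess U V h \<kappa> (fst z) (snd z) / L \<partial>(lborel \<Otimes>\<^sub>M lborel))"
    proof (rule Bochner_Integration.integral_cong[OF refl])
      fix z :: "real \<times> real"
      show "indicator ({0..L} \<times> {0..L}) z / L\<^sup>2 * G z = excess U V h \<kappa> (fst z) (snd z) / L"
        using a.L ksupp[of "fst z" "snd z"] ksupp2[of "fst z" "snd z"]
        by (cases "\<kappa> (fst z) (snd z) = 0") (auto simp: G_def excess_def indicator_def mem_Times_iff power2_eq_square)
    qed
    finally show ?thesis by simp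
  qed
  finally have E: "relative_entropy q (heat_joint h (law L r0))
     = ereal ((\<integral>y. ln (r1 y) \<partial>law L r1) + w U V / (4 * h) + (\<integral>z. excess U V h \<kappa> (fst z) (snd z) \<partial>(lborel \<Otimes>\<^sub>M lborel)) / L)"
    unfolding re leq[symmetric] by simp
  have J: "J h (law L r1) (law L r0) \<le> relative_entropy q (heat_joint h (law L r0))"
    unfolding J_def by (rule INF_lower[OF q_coupling])
  have W: "ereal (1 / (4 * h)) * enn2ereal (wasserstein_sq (law L r1) (law L r0)) = ereal (w U V / (4 * h))"
    using w_nonneg[OF pot] by (simp add: wasserstein_eq[OF pot])
  show ?thesis
    unfolding gap_def W using J unfolding E by (cases "J h (law L r1) (law L r0)") auto
qed

end

end

section \<open>Reflected kernels on an interval\<close>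

lemma integrable_box:
  fixes f :: "real \<times> real \<Rightarrow> real"
  assumes [measurable]: "f \<in> borel_measurable (borel \<Otimes>\<^sub>M borel)"
    and B: "\<And>z. \<bar>f z\<bar> \<le> B" and supp: "\<And>z. f z \<noteq> 0 \<Longrightarrow> z \<in> {a..b} \<times> {a..b}"
  shows "integrable (lborel \<Otimes>\<^sub>M lborel) f"
proof (rule Bochner_Integration.integrable_bound)
  have "emeasure (lborel \<Otimes>\<^sub>M lborel) ({a..b} \<times> {a..b}) < \<infinity>"
    by (subst lborel.emeasure_pair_measure_Times) (auto simp: emeasure_lborel_Icc_eq ennreal_mult_less_top)
  thus "integrable (lborel \<Otimes>\<^sub>M lborel) (\<lambda>z. indicator ({a..b} \<times> {a..b}) z * B)"
    by (intro integrable_mult_left integrable_real_indicator) auto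
  have "norm (f z) \<le> norm (indicator ({a..b} \<times> {a..b}) z * B)" for z
    using B[of z] supp[of z] by (cases "f z = 0") auto
  thus "AE z in lborel \<Otimes>\<^sub>M lborel. norm (f z) \<le> norm (indicator ({a..b} \<times> {a..b}) z * B)" by simp
qed simp

lemma mult_ln_le_bound:
  fixes x c B :: real assumes "0 \<le> x" "x \<le> B" "c > 0"
  shows "\<bar>x * ln (c * x)\<bar> \<le> (1 + (c * B)\<^sup>2) / c"
proof -
  have "\<bar>c * x * ln (c * x)\<bar> \<le> 1 + (c * B)\<^sup>2" using assms by (intro abs_mult_ln_le) auto
  hence "c * \<bar>x * ln (c * x)\<bar> \<le> 1 + (c * B)\<^sup>2" using assms by (simp add: abs_mult mult.assoc)
  thus ?thesis using assms by (simp add: field_simps)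
qed

text \<open>
  One step of a random walk with step density \<open>g\<close>, reflected at the two ends of \<open>[b, b + l)\<close>. Reflection
  keeps the uniform measure invariant and changes nothing further than the range \<open>\<rho>\<close> from the ends.
\<close>

locale block_kernel =
  fixes g :: "real \<Rightarrow> real" and b l \<rho> gm :: real
  assumes rho: "\<rho> > 0" and l: "2 * \<rho> \<le> l"
    and gmeas [measurable]: "g \<in> borel_measurable borel"
    and g0: "\<And>u. g u \<ge> 0" and ggm: "\<And>u. g u \<le> gm" and geven: "\<And>u. g (- u) = g u"
    and gsupp: "\<And>u. g u \<noteq> 0 \<Longrightarrow> \<bar>u\<bar> \<le> \<rho>" and gone: "(\<integral>\<^sup>+u. ennreal (g u) \<partial>lborel) = 1"
begin

definition "kb s t = indicator {b..<b + l} s * indicator {b..<b + l} t * (g (t - s) + g (s + t - 2 * b) + g (2 * b + 2 * l - s - t))"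

lemma kb_meas [measurable]: "(\<lambda>z. kb (fst z) (snd z)) \<in> borel_measurable (borel \<Otimes>\<^sub>M borel)"
  unfolding kb_def by measurable

lemma kb_nonneg: "kb s t \<ge> 0" unfolding kb_def using g0 by simp

lemma kb_le: "kb s t \<le> 3 * gm"
proof -
  have "gm \<ge> 0" using g0[of 0] ggm[of 0] by simp
  thus ?thesis using ggm[of "t - s"] ggm[of "s + t - 2 * b"] ggm[of "2 * b + 2 * l - s - t"]
    unfolding kb_def by (auto simp: indicator_def)
qed

lemma kb_sym: "kb s t = kb t s"
  using geven[of "t - s"] unfolding kb_def by (simp add: algebra_simps)

lemma kb_supp: "kb s t \<noteq> 0 \<Longrightarrow> s \<in> {b..<b + l} \<and> t \<in> {b..<b + l} \<and> \<bar>s - t\<bar> \<le> \<rho>"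
proof -
  assume *: "kb s t \<noteq> 0"
  hence B: "s \<in> {b..<b + l}" "t \<in> {b..<b + l}" unfolding kb_def by (auto simp: indicator_def split: if_splits)
  have "g (t - s) \<noteq> 0 \<or> g (s + t - 2 * b) \<noteq> 0 \<or> g (2 * b + 2 * l - s - t) \<noteq> 0"
    using * unfolding kb_def by auto
  hence "\<bar>t - s\<bar> \<le> \<rho> \<or> \<bar>s + t - 2 * b\<bar> \<le> \<rho> \<or> \<bar>2 * b + 2 * l - s - t\<bar> \<le> \<rho>" using gsupp by blast
  thus ?thesis using B by auto
qed

lemma kb_interior: "s \<in> {b + \<rho><..<b + l - \<rho>} \<Longrightarrow> kb s t = g (t - s)"
proof -
  assume s: "s \<in> {b + \<rho><..<b + l - \<rho>}"
  have sB: "s \<in> {b..<b + l}" using s rho by auto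
  show ?thesis
  proof (cases "t \<in> {b..<b + l}")
    case True
    have "g (s + t - 2 * b) = 0" "g (2 * b + 2 * l - s - t) = 0"
    proof -
      have "\<not> \<bar>s + t - 2 * b\<bar> \<le> \<rho>" "\<not> \<bar>2 * b + 2 * l - s - t\<bar> \<le> \<rho>" using s True by auto
      thus "g (s + t - 2 * b) = 0" "g (2 * b + 2 * l - s - t) = 0" using gsupp by blast+
    qed
    thus ?thesis unfolding kb_def using sB True by simp
  next
    case False
    have "\<not> \<bar>t - s\<bar> \<le> \<rho>" using s False by auto
    hence "g (t - s) = 0" using gsupp by blast
    thus ?thesis unfolding kb_def using False by simp
  qed
qed

lemma g_shift: "(\<integral>\<^sup>+t. ennreal (g (t - s)) \<partial>lborel) = 1"
  using nn_integral_real_affine[of "\<lambda>t. ennreal (g (t - s))" 1 s] gone by simp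

text \<open>
  Undoing the reflections moves the three summands to three adjacent intervals, which together contain the
  support of \<open>g\<close> around \<open>s\<close>.
\<close>

lemma kb_one: "s \<in> {b..<b + l} \<Longrightarrow> (\<integral>\<^sup>+t. ennreal (kb s t) \<partial>lborel) = 1"
proof -
  assume s: "s \<in> {b..<b + l}"
  define E where "E t = ennreal (g (t - s))" for t
  have [measurable]: "E \<in> borel_measurable borel" unfolding E_def by measurable
  have "(\<integral>\<^sup>+t. ennreal (kb s t) \<partial>lborel) = (\<integral>\<^sup>+t. E t * indicator {b..<b + l} t
      + (E (2 * b - t) * indicator {b..<b + l} t + E (2 * b + 2 * l - t) * indicator {b..<b + l} t) \<partial>lborel)"
  proof (rule nn_integral_cong)
    fix t
    have "g (s + t - 2 * b) = g (2 * b - t - s)" using geven[of "s + t - 2 * b"] by (simp add: algebra_simps)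
    moreover have "g (2 * b + 2 * l - s - t) = g (2 * b + 2 * l - t - s)" by (simp add: algebra_simps)
    ultimately show "ennreal (kb s t) = E t * indicator {b..<b + l} t
      + (E (2 * b - t) * indicator {b..<b + l} t + E (2 * b + 2 * l - t) * indicator {b..<b + l} t)"
      using s g0 by (simp add: kb_def E_def indicator_def add.assoc ennreal_plus)
  qed
  also have "\<dots> = (\<integral>\<^sup>+t. E t * indicator {b..<b + l} t \<partial>lborel)
     + ((\<integral>\<^sup>+t. E (2 * b - t) * indicator {b..<b + l} t \<partial>lborel) + (\<integral>\<^sup>+t. E (2 * b + 2 * l - t) * indicator {b..<b + l} t \<partial>lborel))"
    by (subst nn_integral_add; simp add: nn_integral_add)
  also have "(\<integral>\<^sup>+t. E (2 * b - t) * indicator {b..<b + l} t \<partial>lborel) = (\<integral>\<^sup>+t. E t * indicator {b - l<..b} t \<partial>lborel)"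
    by (subst (2) nn_integral_real_affine[where c = "-1" and t = "2 * b"]) (auto intro!: nn_integral_cong simp: indicator_def)
  also have "(\<integral>\<^sup>+t. E (2 * b + 2 * l - t) * indicator {b..<b + l} t \<partial>lborel) = (\<integral>\<^sup>+t. E t * indicator {b + l<..b + 2 * l} t \<partial>lborel)"
    by (subst (2) nn_integral_real_affine[where c = "-1" and t = "2 * b + 2 * l"]) (auto intro!: nn_integral_cong simp: indicator_def)
  also have "(\<integral>\<^sup>+t. E t * indicator {b..<b + l} t \<partial>lborel)
     + ((\<integral>\<^sup>+t. E t * indicator {b - l<..b} t \<partial>lborel) + (\<integral>\<^sup>+t. E t * indicator {b + l<..b + 2 * l} t \<partial>lborel))
     = (\<integral>\<^sup>+t. E t * indicator {b..<b + l} t + (E t * indicator {b - l<..b} t + E t * indicator {b + l<..b + 2 * l} t) \<partial>lborel)"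
    by (subst nn_integral_add; simp add: nn_integral_add)
  also have "\<dots> = (\<integral>\<^sup>+t. E t \<partial>lborel)"
  proof (rule nn_integral_cong_AE)
    show "AE t in lborel. E t * indicator {b..<b + l} t + (E t * indicator {b - l<..b} t + E t * indicator {b + l<..b + 2 * l} t) = E t"
      using AE_lborel_singleton[of b] AE_lborel_singleton[of "b + l"]
    proof eventually_elim
      case (elim t)
      show ?case
      proof (cases "E t = 0")
        case False
        hence "g (t - s) \<noteq> 0" by (auto simp: E_def)
        hence "\<bar>t - s\<bar> \<le> \<rho>" by (rule gsupp)
        hence "b - l < t" "t < b + 2 * l" using s l rho by auto
        thus ?thesis using elim l rho by (auto simp: indicator_def)
      qed simp
    qed
  qed
  also have "\<dots> = 1" unfolding E_def by (rule g_shift)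
  finally show ?thesis .
qed

lemma g_integrable: "integrable lborel g" "(\<integral>u. g u \<partial>lborel) = 1"
proof -
  have "has_bochner_integral lborel g 1"
    by (rule has_bochner_integral_nn_integral) (use g0 gone in auto)
  thus "integrable lborel g" "(\<integral>u. g u \<partial>lborel) = 1" by (auto simp: has_bochner_integral_iff)
qed

lemma gm_pos: "gm > 0"
proof (rule ccontr)
  assume "\<not> gm > 0"
  hence "g u = 0" for u using g0[of u] ggm[of u] by linarith
  thus False using gone by simp
qed

text \<open>
  Rows that start further than \<open>\<rho>\<close> from the ends are translates of \<open>g\<close> and contribute the entropy of
  \<open>g\<close>. The other starting points have total length \<open>2 * \<rho>\<close>; there it is enough that each row has mass
  one, that its density is at most \<open>3 * gm\<close>, and that its range is \<open>\<rho>\<close>.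
\<close>

lemma block_excess_le:
  fixes D :: "real \<Rightarrow> real \<Rightarrow> real" and c h Q :: real
  assumes c: "c > 0" and h: "h > 0"
    and Dm [measurable]: "(\<lambda>z. D (fst z) (snd z)) \<in> borel_measurable (borel \<Otimes>\<^sub>M borel)"
    and D0: "\<And>s t. D s t \<ge> 0" and D2: "\<And>s t. D s t \<le> 2 * (s - t)\<^sup>2"
    and Q: "(\<integral>\<^sup>+s. \<integral>\<^sup>+t. ennreal (g (t - s) * D s t) * (indicator {b..<b + l} s * indicator {b..<b + l} t) \<partial>lborel \<partial>lborel) \<le> ennreal Q"
    and Q0: "Q \<ge> 0"
  shows "integrable (lborel \<Otimes>\<^sub>M lborel) (\<lambda>z. kb (fst z) (snd z) * (ln (c * kb (fst z) (snd z)) + D (fst z) (snd z) / (2 * h)))"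
    and "(\<integral>z. kb (fst z) (snd z) * (ln (c * kb (fst z) (snd z)) + D (fst z) (snd z) / (2 * h)) \<partial>(lborel \<Otimes>\<^sub>M lborel))
     \<le> (l - 2 * \<rho>) * (\<integral>u. g u * ln (c * g u) \<partial>lborel) + 2 * \<rho> * (ln (c * (3 * gm)) + \<rho>\<^sup>2 / h) + Q / (2 * h)"
proof -
  define K where "K = ln (c * (3 * gm)) + \<rho>\<^sup>2 / h"
  define B1 where "B1 = (1 + (c * (3 * gm))\<^sup>2) / c"
  have gp: "gm > 0" by (rule gm_pos)
  define int where "int = {b + \<rho><..<b + l - \<rho>}"
  define bd where "bd = {b..<b + l} - int"
  have [measurable]: "int \<in> sets borel" "bd \<in> sets borel" by (auto simp: int_def bd_def)
  define f where "f z = kb (fst z) (snd z) * (ln (c * kb (fst z) (snd z)) + D (fst z) (snd z) / (2 * h))" for z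
  \<comment> \<open>rows in the interior, rows near the ends, and the transport cost of the unreflected part\<close>
  define f1 where "f1 z = indicator int (fst z) * (g (snd z - fst z) * ln (c * g (snd z - fst z)))" for z
  define f2 where "f2 z = indicator bd (fst z) * kb (fst z) (snd z) * K" for z
  define f3 where "f3 z = indicator {b..<b + l} (fst z) * indicator {b..<b + l} (snd z) * (g (snd z - fst z) * D (fst z) (snd z) / (2 * h))" for z
  have [measurable]: "f \<in> borel_measurable (borel \<Otimes>\<^sub>M borel)" "f1 \<in> borel_measurable (borel \<Otimes>\<^sub>M borel)"
    "f2 \<in> borel_measurable (borel \<Otimes>\<^sub>M borel)" "f3 \<in> borel_measurable (borel \<Otimes>\<^sub>M borel)"
    unfolding f_def f1_def f2_def f3_def by measurable
  have kDle: "kb s t * (D s t / (2 * h)) \<le> kb s t * (\<rho>\<^sup>2 / h)" for s t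
  proof (cases "kb s t = 0")
    case False
    hence "\<bar>s - t\<bar> \<le> \<rho>" using kb_supp by blast
    hence "(s - t)\<^sup>2 \<le> \<rho>\<^sup>2" by (metis abs_ge_zero power2_abs power_mono)
    hence "D s t \<le> 2 * \<rho>\<^sup>2" using D2[of s t] by linarith
    hence "D s t / (2 * h) \<le> (2 * \<rho>\<^sup>2) / (2 * h)" using h by (intro divide_right_mono) auto
    thus ?thesis using kb_nonneg by (intro mult_left_mono) auto
  qed simp
  have kln: "\<bar>kb s t * ln (c * kb s t)\<bar> \<le> B1" for s t
    unfolding B1_def by (rule mult_ln_le_bound[OF kb_nonneg kb_le c])
  have gln: "\<bar>g u * ln (c * g u)\<bar> \<le> B1" for u
    unfolding B1_def by (rule mult_ln_le_bound[OF g0 _ c]) (use ggm[of u] gp in linarith)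
  have kDb: "\<bar>kb s t * (D s t / (2 * h))\<bar> \<le> 3 * gm * (\<rho>\<^sup>2 / h)" for s t
  proof -
    have "0 \<le> kb s t * (D s t / (2 * h))" using kb_nonneg D0 h by simp
    moreover have "kb s t * (\<rho>\<^sup>2 / h) \<le> 3 * gm * (\<rho>\<^sup>2 / h)" using kb_le h by (intro mult_right_mono) auto
    ultimately show ?thesis using kDle[of s t] by linarith
  qed
  show fi: "integrable (lborel \<Otimes>\<^sub>M lborel) f"
  proof (rule integrable_box[where B = "B1 + 3 * gm * (\<rho>\<^sup>2 / h)" and a = b and b = "b + l"])
    show "\<bar>f z\<bar> \<le> B1 + 3 * gm * (\<rho>\<^sup>2 / h)" for z
      using kln[of "fst z" "snd z"] kDb[of "fst z" "snd z"] unfolding f_def distrib_left by linarith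
    show "f z \<noteq> 0 \<Longrightarrow> z \<in> {b..b + l} \<times> {b..b + l}" for z
      using kb_supp[of "fst z" "snd z"] by (auto simp: f_def mem_Times_iff)
  qed simp
  have i1: "integrable (lborel \<Otimes>\<^sub>M lborel) f1"
  proof (rule integrable_box[where B = B1 and a = b and b = "b + l"])
    show "\<bar>f1 z\<bar> \<le> B1" for z using gln[of "snd z - fst z"] order_trans[OF abs_ge_zero gln[of 0]] by (auto simp: f1_def indicator_def)
    show "f1 z \<noteq> 0 \<Longrightarrow> z \<in> {b..b + l} \<times> {b..b + l}" for z
      using gsupp[of "snd z - fst z"] rho by (auto simp: f1_def mem_Times_iff int_def indicator_def split: if_splits)
  qed simp
  have i2: "integrable (lborel \<Otimes>\<^sub>M lborel) f2"
  proof (rule integrable_box[where B = "3 * gm * \<bar>K\<bar>" and a = b and b = "b + l"])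
    show "\<bar>f2 z\<bar> \<le> 3 * gm * \<bar>K\<bar>" for z
      using kb_le[of "fst z" "snd z"] kb_nonneg[of "fst z" "snd z"] gp
      by (auto simp: f2_def abs_mult indicator_def intro!: mult_right_mono)
    show "f2 z \<noteq> 0 \<Longrightarrow> z \<in> {b..b + l} \<times> {b..b + l}" for z
      using kb_supp[of "fst z" "snd z"] by (auto simp: f2_def mem_Times_iff)
  qed simp
  have f30: "f3 z \<ge> 0" for z using g0 D0 h by (simp add: f3_def)
  have n3: "(\<integral>\<^sup>+z. ennreal (f3 z) \<partial>(lborel \<Otimes>\<^sub>M lborel)) \<le> ennreal (Q / (2 * h))"
  proof -
    have "(\<integral>\<^sup>+z. ennreal (f3 z) \<partial>(lborel \<Otimes>\<^sub>M lborel)) = (\<integral>\<^sup>+z. ennreal (1 / (2 * h)) * (ennreal (g (snd z - fst z) * D (fst z) (snd z)) * (indicator {b..<b + l} (fst z) * indicator {b..<b + l} (snd z))) \<partial>(lborel \<Otimes>\<^sub>M lborel))"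
      using g0 D0 h by (intro nn_integral_cong) (auto simp: f3_def indicator_def ennreal_mult[symmetric])
    also have "\<dots> = ennreal (1 / (2 * h)) * (\<integral>\<^sup>+z. ennreal (g (snd z - fst z) * D (fst z) (snd z)) * (indicator {b..<b + l} (fst z) * indicator {b..<b + l} (snd z)) \<partial>(lborel \<Otimes>\<^sub>M lborel))"
      by (rule nn_integral_cmult) simp
    also have "(\<integral>\<^sup>+z. ennreal (g (snd z - fst z) * D (fst z) (snd z)) * (indicator {b..<b + l} (fst z) * indicator {b..<b + l} (snd z)) \<partial>(lborel \<Otimes>\<^sub>M lborel))
      = (\<integral>\<^sup>+s. \<integral>\<^sup>+t. ennreal (g (t - s) * D s t) * (indicator {b..<b + l} s * indicator {b..<b + l} t) \<partial>lborel \<partial>lborel)"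
      by (subst lborel.nn_integral_fst[symmetric]) auto
    also have "ennreal (1 / (2 * h)) * \<dots> \<le> ennreal (1 / (2 * h)) * ennreal Q" by (rule mult_left_mono[OF Q]) simp
    also have "\<dots> = ennreal (Q / (2 * h))" using h Q0 by (simp add: ennreal_mult[symmetric])
    finally show ?thesis .
  qed
  have i3: "integrable (lborel \<Otimes>\<^sub>M lborel) f3"
    by (rule integrableI_bounded) (use n3 f30 in \<open>auto intro: order_le_less_trans\<close>)
  have I3: "(\<integral>z. f3 z \<partial>(lborel \<Otimes>\<^sub>M lborel)) \<le> Q / (2 * h)"
  proof -
    have "ennreal (\<integral>z. f3 z \<partial>(lborel \<Otimes>\<^sub>M lborel)) \<le> ennreal (Q / (2 * h))"
      using n3 nn_integral_eq_integral[OF i3] f30 by simp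
    thus ?thesis using h Q0 by (subst (asm) ennreal_le_iff) auto
  qed
  have I1: "(\<integral>z. f1 z \<partial>(lborel \<Otimes>\<^sub>M lborel)) = (l - 2 * \<rho>) * (\<integral>u. g u * ln (c * g u) \<partial>lborel)"
  proof -
    have "(\<integral>z. f1 z \<partial>(lborel \<Otimes>\<^sub>M lborel)) = (\<integral>s. \<integral>t. f1 (s, t) \<partial>lborel \<partial>lborel)"
      by (rule lborel_pair.integral_fst'[OF i1, symmetric])
    also have "\<dots> = (\<integral>s. indicator int s * (\<integral>u. g u * ln (c * g u) \<partial>lborel) \<partial>lborel)"
    proof (rule Bochner_Integration.integral_cong[OF refl])
      fix s :: real
      have "(\<integral>t. f1 (s, t) \<partial>lborel) = indicator int s * (\<integral>t. g (t - s) * ln (c * g (t - s)) \<partial>lborel)"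
        by (simp add: f1_def)
      also have "(\<integral>t. g (t - s) * ln (c * g (t - s)) \<partial>lborel) = (\<integral>u. g u * ln (c * g u) \<partial>lborel)"
        using lborel_integral_real_affine[of 1 "\<lambda>t. g (t - s) * ln (c * g (t - s))" s] by simp
      finally show "(\<integral>t. f1 (s, t) \<partial>lborel) = indicator int s * (\<integral>u. g u * ln (c * g u) \<partial>lborel)" .
    qed
    also have "\<dots> = (l - 2 * \<rho>) * (\<integral>u. g u * ln (c * g u) \<partial>lborel)"
      using l by (simp add: int_def)
    finally show ?thesis .
  qed
  have I2: "(\<integral>z. f2 z \<partial>(lborel \<Otimes>\<^sub>M lborel)) = 2 * \<rho> * K"
  proof -
    have "(\<integral>z. f2 z \<partial>(lborel \<Otimes>\<^sub>M lborel)) = (\<integral>s. \<integral>t. f2 (s, t) \<partial>lborel \<partial>lborel)"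
      by (rule lborel_pair.integral_fst'[OF i2, symmetric])
    also have "\<dots> = (\<integral>s. indicator bd s * K \<partial>lborel)"
    proof (rule Bochner_Integration.integral_cong[OF refl])
      fix s :: real
      have "(\<integral>t. kb s t \<partial>lborel) = 1" if "s \<in> {b..<b + l}"
      proof -
        have "(\<lambda>t. kb s t) \<in> borel_measurable lborel" unfolding kb_def by measurable
        hence "has_bochner_integral lborel (kb s) 1"
          by (intro has_bochner_integral_nn_integral) (use kb_nonneg kb_one[OF that] in auto)
        thus ?thesis by (simp add: has_bochner_integral_iff)
      qed
      thus "(\<integral>t. f2 (s, t) \<partial>lborel) = indicator bd s * K"
        by (cases "s \<in> bd") (auto simp: f2_def bd_def)
    qed
    also have "\<dots> = measure lborel bd * K" by simp
    also have "measure lborel bd = 2 * \<rho>"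
    proof -
      have "measure lborel bd = measure lborel {b..<b + l} - measure lborel int"
        unfolding bd_def by (rule measure_Diff) (use rho l in \<open>auto simp: int_def\<close>)
      thus ?thesis using l rho by (simp add: int_def)
    qed
    finally show ?thesis .
  qed
  have pw: "f z \<le> f1 z + f2 z + f3 z" for z
  proof -
    define s t where "s = fst z" and "t = snd z"
    show ?thesis
    proof (cases "kb s t = 0")
      case True
      have "0 = f1 z"
      proof (cases "s \<in> int")
        case True
        thus ?thesis using kb_interior[of s t] \<open>kb s t = 0\<close> by (simp add: f1_def s_def t_def int_def)
      qed (simp add: f1_def s_def)
      moreover have "f z = 0" "f2 z = 0" using True by (simp_all add: f_def f2_def s_def t_def)
      ultimately show ?thesis using f30[of z] by simp
    next
      case False
      hence kp: "kb s t > 0" using kb_nonneg[of s t] by simp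
      have st: "s \<in> {b..<b + l}" "t \<in> {b..<b + l}" using kb_supp[OF False] by auto
      show ?thesis
      proof (cases "s \<in> int")
        case True
        have "kb s t = g (t - s)" using kb_interior[of s t] True by (simp add: int_def)
        moreover have "s \<notin> bd" using True by (simp add: bd_def)
        ultimately show ?thesis using True st unfolding f_def f1_def f2_def f3_def s_def[symmetric] t_def[symmetric]
          by (simp add: algebra_simps)
      next
        case nint: False
        hence bd: "s \<in> bd" using st by (simp add: bd_def)
        have "ln (c * kb s t) \<le> ln (c * (3 * gm))" using kp kb_le[of s t] c by (intro ln_mono) auto
        hence "kb s t * ln (c * kb s t) \<le> kb s t * ln (c * (3 * gm))" using kp by (intro mult_left_mono) auto
        hence "f z \<le> kb s t * K" using kDle[of s t] unfolding f_def s_def[symmetric] t_def[symmetric] K_def distrib_left by linarith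
        moreover have "f1 z = 0" "f2 z = kb s t * K" using nint bd by (simp_all add: f1_def f2_def s_def t_def)
        ultimately show ?thesis using f30[of z] by linarith
      qed
    qed
  qed
  have "(\<integral>z. f z \<partial>(lborel \<Otimes>\<^sub>M lborel)) \<le> (\<integral>z. f1 z + f2 z + f3 z \<partial>(lborel \<Otimes>\<^sub>M lborel))"
    by (intro integral_mono fi Bochner_Integration.integrable_add i1 i2 i3 pw)
  also have "\<dots> = (\<integral>z. f1 z \<partial>(lborel \<Otimes>\<^sub>M lborel)) + (\<integral>z. f2 z \<partial>(lborel \<Otimes>\<^sub>M lborel)) + (\<integral>z. f3 z \<partial>(lborel \<Otimes>\<^sub>M lborel))"
    using i1 i2 i3 by simp
  also have "\<dots> \<le> (l - 2 * \<rho>) * (\<integral>u. g u * ln (c * g u) \<partial>lborel) + 2 * \<rho> * K + Q / (2 * h)"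
    using I1 I2 I3 by simp
  finally show "(\<integral>z. f z \<partial>(lborel \<Otimes>\<^sub>M lborel)) \<le> (l - 2 * \<rho>) * (\<integral>u. g u * ln (c * g u) \<partial>lborel) + 2 * \<rho> * (ln (c * (3 * gm)) + \<rho>\<^sup>2 / h) + Q / (2 * h)"
    by (simp add: K_def)
qed

end

section \<open>Truncated Gaussians and the transport cost of a kernel\<close>

text \<open>
  Mass of the Gaussian truncated at distance \<open>R\<close>. The truncation gives the kernel a finite range; it is removed
  at the end by letting \<open>R\<close> tend to infinity.
\<close>

definition zeta :: "real \<Rightarrow> real" where "zeta R = integral {-R..R} (\<lambda>p. exp (- (p\<^sup>2 / 4)))"

definition trunc_gauss :: "real \<Rightarrow> real \<Rightarrow> real \<Rightarrow> real" where
  "trunc_gauss R \<tau> u = (if \<bar>u\<bar> \<le> R * sqrt \<tau> then exp (- (u\<^sup>2 / (4 * \<tau>))) / (sqrt \<tau> * zeta R) else 0)"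

lemma zeta_pos: "R > 0 \<Longrightarrow> zeta R > 0"
proof -
  assume R: "R > 0"
  have "exp (- (R\<^sup>2 / 4)) * (R - (- R)) \<le> zeta R"
    unfolding zeta_def
  proof (rule integral_const_lower)
    show "continuous_on UNIV (\<lambda>p::real. exp (- (p\<^sup>2 / 4)))" by (intro continuous_intros) auto
    fix t assume "- R \<le> t" "t \<le> R"
    hence "\<bar>t\<bar> \<le> R" by auto
    hence "t\<^sup>2 \<le> R\<^sup>2" using R by (metis abs_le_square_iff abs_of_pos)
    thus "exp (- (R\<^sup>2 / 4)) \<le> exp (- (t\<^sup>2 / 4))" by simp
  qed (use R in auto)
  moreover have "exp (- (R\<^sup>2 / 4)) * (R - (- R)) > 0" using R by simp
  ultimately show ?thesis by linarith
qed

lemma zeta_tendsto: "(\<lambda>n. zeta (real n)) \<longlonglongrightarrow> sqrt (4 * pi)"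
proof -
  let ?e = "\<lambda>p::real. exp (- (p\<^sup>2 / 4))"
  have nd: "normal_density 0 (sqrt 2) p = ?e p / sqrt (4 * pi)" for p
    by (simp add: normal_density_def)
  have ei: "integrable lborel ?e" "(\<integral>p. ?e p \<partial>lborel) = sqrt (4 * pi)"
  proof -
    have *: "?e p = sqrt (4 * pi) * normal_density 0 (sqrt 2) p" for p by (simp add: nd)
    show "integrable lborel ?e" unfolding * by (intro integrable_mult_right integrable_normal_density) simp
    show "(\<integral>p. ?e p \<partial>lborel) = sqrt (4 * pi)" unfolding * by (simp add: integral_normal_density)
  qed
  have "(\<lambda>n. \<integral>p. indicator {- real n..real n} p * ?e p \<partial>lborel) \<longlonglongrightarrow> (\<integral>p. ?e p \<partial>lborel)"
  proof (rule integral_dominated_convergence[where w = ?e])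
    show "AE p in lborel. (\<lambda>n. indicator {- real n..real n} p * ?e p) \<longlonglongrightarrow> ?e p"
    proof (rule AE_I2)
      fix p :: real
      obtain N where N: "\<bar>p\<bar> \<le> real N" using real_arch_simple by blast
      have "eventually (\<lambda>n. indicator {- real n..real n} p * ?e p = ?e p) sequentially"
        by (rule eventually_sequentiallyI[of N]) (use N in \<open>auto simp: indicator_def\<close>)
      thus "(\<lambda>n. indicator {- real n..real n} p * ?e p) \<longlonglongrightarrow> ?e p" by (rule tendsto_eventually)
    qed
    show "AE p in lborel. norm (indicator {- real n..real n} p * ?e p) \<le> ?e p" for n
      by (auto simp: indicator_def)
  qed (use ei in auto)
  moreover have "(\<integral>p. indicator {- real n..real n} p * ?e p \<partial>lborel) = zeta (real n)" for n
  proof -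
    have "set_integrable lborel {- real n..real n} ?e"
      by (intro borel_integrable_atLeastAtMost' continuous_intros) auto
    from set_borel_integral_eq_integral(2)[OF this] show ?thesis by (simp add: set_lebesgue_integral_def zeta_def)
  qed
  ultimately show ?thesis by (simp add: ei(2))
qed

lemma zeta_close: "\<epsilon> > 0 \<Longrightarrow> \<exists>R>0. ln (sqrt (4 * pi) / zeta R) \<le> \<epsilon>"
proof -
  assume e: "\<epsilon> > 0"
  have "(\<lambda>n. ln (sqrt (4 * pi) / zeta (real n))) \<longlonglongrightarrow> ln (sqrt (4 * pi) / sqrt (4 * pi))"
    by (intro tendsto_ln tendsto_divide tendsto_const zeta_tendsto) auto
  hence "eventually (\<lambda>n. ln (sqrt (4 * pi) / zeta (real n)) < \<epsilon>) sequentially"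
    using e by (intro order_tendstoD(2)) auto
  hence "eventually (\<lambda>n. ln (sqrt (4 * pi) / zeta (real n)) < \<epsilon> \<and> n > 0) sequentially"
    by (rule eventually_conj) (rule eventually_gt_at_top)
  then obtain n where "ln (sqrt (4 * pi) / zeta (real n)) < \<epsilon>" "n > 0"
    unfolding eventually_sequentially by blast
  thus ?thesis by (intro exI[of _ "real n"]) auto
qed

context
  fixes R \<tau> :: real
  assumes R: "R > 0" and tau: "\<tau> > 0"
begin

lemma trunc_gauss_meas [measurable]: "trunc_gauss R \<tau> \<in> borel_measurable borel"
  unfolding trunc_gauss_def by measurable

lemma trunc_gauss_one: "(\<integral>\<^sup>+u. ennreal (trunc_gauss R \<tau> u) \<partial>lborel) = 1"
proof -
  have s: "sqrt \<tau> > 0" using tau by simp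
  note z = zeta_pos[OF R]
  have "(\<integral>\<^sup>+u. ennreal (trunc_gauss R \<tau> u) \<partial>lborel) = ennreal \<bar>sqrt \<tau>\<bar> * (\<integral>\<^sup>+p. ennreal (trunc_gauss R \<tau> (0 + sqrt \<tau> * p)) \<partial>lborel)"
    by (rule nn_integral_real_affine) (use s in auto)
  also have "\<dots> = ennreal (sqrt \<tau>) * (\<integral>\<^sup>+p. ennreal (1 / (sqrt \<tau> * zeta R)) * (ennreal (exp (- (p\<^sup>2 / 4))) * indicator {-R..R} p) \<partial>lborel)"
  proof -
    have "trunc_gauss R \<tau> (0 + sqrt \<tau> * p) = 1 / (sqrt \<tau> * zeta R) * (exp (- (p\<^sup>2 / 4)) * indicator {-R..R} p)" for p
      using s tau by (auto simp: trunc_gauss_def abs_mult power_mult_distrib indicator_def mult.commute[of "sqrt \<tau>"])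
    hence "ennreal (trunc_gauss R \<tau> (0 + sqrt \<tau> * p)) = ennreal (1 / (sqrt \<tau> * zeta R)) * (ennreal (exp (- (p\<^sup>2 / 4))) * indicator {-R..R} p)" for p
      using s z by (simp add: ennreal_mult'[symmetric] ennreal_indicator[symmetric])
    thus ?thesis using s by simp
  qed
  also have "\<dots> = ennreal (sqrt \<tau>) * (ennreal (1 / (sqrt \<tau> * zeta R)) * ennreal (zeta R))"
  proof -
    have "continuous_on UNIV (\<lambda>p::real. exp (- (p\<^sup>2 / 4)))" by (intro continuous_intros) auto
    hence "(\<integral>\<^sup>+p. ennreal (exp (- (p\<^sup>2 / 4))) * indicator {-R..R} p \<partial>lborel) = ennreal (zeta R)"
      unfolding zeta_def by (rule nn_integral_Icc_continuous) simp
    thus ?thesis by (subst nn_integral_cmult) auto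
  qed
  also have "\<dots> = 1" using s z by (simp add: ennreal_mult[symmetric])
  finally show ?thesis .
qed

lemma block_kernel_trunc_gauss:
  assumes "2 * (R * sqrt \<tau>) \<le> l"
  shows "block_kernel (trunc_gauss R \<tau>) l (R * sqrt \<tau>) (1 / (sqrt \<tau> * zeta R))"
proof
  have s: "sqrt \<tau> * zeta R > 0" using tau zeta_pos[OF R] by simp
  show "0 < R * sqrt \<tau>" using R tau by simp
  show "0 \<le> trunc_gauss R \<tau> u" for u using s by (simp add: trunc_gauss_def)
  show "trunc_gauss R \<tau> u \<le> 1 / (sqrt \<tau> * zeta R)" for u
  proof (cases "\<bar>u\<bar> \<le> R * sqrt \<tau>")
    case True
    have "exp (- (u\<^sup>2 / (4 * \<tau>))) \<le> 1" using tau by simp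
    thus ?thesis using True s unfolding trunc_gauss_def by (simp only: if_True divide_right_mono less_imp_le)
  qed (use s in \<open>simp add: trunc_gauss_def\<close>)
  show "trunc_gauss R \<tau> (- u) = trunc_gauss R \<tau> u" for u by (simp add: trunc_gauss_def)
  show "trunc_gauss R \<tau> u \<noteq> 0 \<Longrightarrow> \<bar>u\<bar> \<le> R * sqrt \<tau>" for u by (auto simp: trunc_gauss_def split: if_splits)
qed (use assms trunc_gauss_one in auto)

definition "second_moment = (\<integral>u. trunc_gauss R \<tau> u * u\<^sup>2 \<partial>lborel)"

lemma second_moment:
  "integrable lborel (\<lambda>u. trunc_gauss R \<tau> u * u\<^sup>2)" "0 \<le> second_moment" "second_moment \<le> R\<^sup>2 * \<tau>"
  "(\<integral>\<^sup>+u. ennreal (trunc_gauss R \<tau> u * u\<^sup>2) \<partial>lborel) = ennreal second_moment"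
proof -
  interpret block_kernel "trunc_gauss R \<tau>" 0 "2 * (R * sqrt \<tau>)" "R * sqrt \<tau>" "1 / (sqrt \<tau> * zeta R)"
    by (rule block_kernel_trunc_gauss) simp
  have le: "trunc_gauss R \<tau> u * u\<^sup>2 \<le> trunc_gauss R \<tau> u * (R\<^sup>2 * \<tau>)" for u
  proof (cases "trunc_gauss R \<tau> u = 0")
    case False
    hence "\<bar>u\<bar> \<le> R * sqrt \<tau>" by (rule gsupp)
    hence "u\<^sup>2 \<le> (R * sqrt \<tau>)\<^sup>2" by (metis abs_ge_zero power2_abs power_mono)
    also have "\<dots> = R\<^sup>2 * \<tau>" using tau by (simp add: power_mult_distrib)
    finally show ?thesis using g0 by (intro mult_left_mono) auto
  qed simp
  show i: "integrable lborel (\<lambda>u. trunc_gauss R \<tau> u * u\<^sup>2)"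
  proof (rule Bochner_Integration.integrable_bound)
    show "integrable lborel (\<lambda>u. trunc_gauss R \<tau> u * (R\<^sup>2 * \<tau>))" using g_integrable(1) by simp
    show "AE u in lborel. norm (trunc_gauss R \<tau> u * u\<^sup>2) \<le> norm (trunc_gauss R \<tau> u * (R\<^sup>2 * \<tau>))"
      using le g0 tau by simp
  qed simp
  show "0 \<le> second_moment" unfolding second_moment_def using g0 by (intro integral_nonneg_AE) auto
  have "second_moment \<le> (\<integral>u. trunc_gauss R \<tau> u * (R\<^sup>2 * \<tau>) \<partial>lborel)"
    unfolding second_moment_def using g_integrable(1) by (intro integral_mono i le) auto
  thus "second_moment \<le> R\<^sup>2 * \<tau>" using g_integrable(2) by simp
  show "(\<integral>\<^sup>+u. ennreal (trunc_gauss R \<tau> u * u\<^sup>2) \<partial>lborel) = ennreal second_moment"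
    unfolding second_moment_def using i g0 by (intro nn_integral_eq_integral) auto
qed

text \<open>
  The second moment is not evaluated, because it will cancel against the transport cost.
\<close>

lemma trunc_gauss_entropy:
  assumes c: "c > 0"
  shows "(\<integral>u. trunc_gauss R \<tau> u * ln (c * trunc_gauss R \<tau> u) \<partial>lborel) = ln (c / (sqrt \<tau> * zeta R)) - second_moment / (4 * \<tau>)"
proof -
  interpret block_kernel "trunc_gauss R \<tau>" 0 "2 * (R * sqrt \<tau>)" "R * sqrt \<tau>" "1 / (sqrt \<tau> * zeta R)"
    by (rule block_kernel_trunc_gauss) simp
  have s: "sqrt \<tau> * zeta R > 0" using tau zeta_pos[OF R] by simp
  have "trunc_gauss R \<tau> u * ln (c * trunc_gauss R \<tau> u)
     = trunc_gauss R \<tau> u * ln (c / (sqrt \<tau> * zeta R)) - trunc_gauss R \<tau> u * u\<^sup>2 / (4 * \<tau>)" for u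
  proof (cases "\<bar>u\<bar> \<le> R * sqrt \<tau>")
    case True
    have "c * trunc_gauss R \<tau> u = c / (sqrt \<tau> * zeta R) * exp (- (u\<^sup>2 / (4 * \<tau>)))" using True by (simp add: trunc_gauss_def)
    hence "ln (c * trunc_gauss R \<tau> u) = ln (c / (sqrt \<tau> * zeta R)) - u\<^sup>2 / (4 * \<tau>)"
      using c s by (subst \<open>c * trunc_gauss R \<tau> u = _\<close>, subst ln_mult) auto
    thus ?thesis by (simp add: right_diff_distrib)
  qed (simp add: trunc_gauss_def)
  hence "(\<integral>u. trunc_gauss R \<tau> u * ln (c * trunc_gauss R \<tau> u) \<partial>lborel)
     = (\<integral>u. trunc_gauss R \<tau> u * ln (c / (sqrt \<tau> * zeta R)) - trunc_gauss R \<tau> u * u\<^sup>2 / (4 * \<tau>) \<partial>lborel)" by simp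
  also have "\<dots> = ln (c / (sqrt \<tau> * zeta R)) - second_moment / (4 * \<tau>)"
    using g_integrable second_moment(1) by (simp add: second_moment_def)
  finally show ?thesis .
qed

end

definition between :: "real \<Rightarrow> real \<Rightarrow> real \<Rightarrow> ennreal" where
  "between s c t = (if s \<le> c \<and> c \<le> t \<or> t \<le> c \<and> c \<le> s then 1 else 0)"

lemma between_measurable [measurable (raw)]:
  assumes [measurable]: "f \<in> borel_measurable N" "g \<in> borel_measurable N" "k \<in> borel_measurable N"
  shows "(\<lambda>x. between (f x) (g x) (k x)) \<in> borel_measurable N"
  unfolding between_def by measurable

lemma nn_integral_between_abs:
  "(\<integral>\<^sup>+s. ennreal \<bar>c - s\<bar> * between s c (s + u) \<partial>lborel) = ennreal (u\<^sup>2 / 2)"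
proof -
  have "(\<integral>\<^sup>+s. ennreal \<bar>c - s\<bar> * between s c (s + u) \<partial>lborel) = (\<integral>\<^sup>+w. ennreal \<bar>w\<bar> * between (c - w) c (c - w + u) \<partial>lborel)"
    by (subst nn_integral_real_affine[where c = "-1" and t = c]) auto
  also have "\<dots> = ennreal (u\<^sup>2 / 2)"
  proof (cases "u \<ge> 0")
    case True
    have "(\<integral>\<^sup>+w. ennreal \<bar>w\<bar> * between (c - w) c (c - w + u) \<partial>lborel) = (\<integral>\<^sup>+w. ennreal w * indicator {0..u} w \<partial>lborel)"
      using True by (intro nn_integral_cong) (auto simp: between_def indicator_def)
    also have "\<dots> = ennreal (u\<^sup>2 / 2 - 0\<^sup>2 / 2)"
      by (rule nn_integral_FTC_Icc) (use True in \<open>auto intro!: derivative_eq_intros\<close>)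
    finally show ?thesis by simp
  next
    case False
    have "(\<integral>\<^sup>+w. ennreal \<bar>w\<bar> * between (c - w) c (c - w + u) \<partial>lborel) = (\<integral>\<^sup>+w. ennreal (- w) * indicator {u..0} w \<partial>lborel)"
      using False by (intro nn_integral_cong) (auto simp: between_def indicator_def)
    also have "\<dots> = ennreal (- (0\<^sup>2 / 2) - (- (u\<^sup>2 / 2)))"
      by (rule nn_integral_FTC_Icc[where F = "\<lambda>w. - (w\<^sup>2 / 2)"]) (use False in \<open>auto intro!: derivative_eq_intros\<close>)
    finally show ?thesis by simp
  qed
  finally show ?thesis .
qed

text \<open>
  For each step \<open>u\<close>, the distance from the starting point to \<open>c\<close> is averaged over all steps that pass
  over \<open>c\<close>, which gives \<open>u\<^sup>2 / 2\<close>.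
\<close>

lemma nn_integral_between_kernel:
  fixes g :: "real \<Rightarrow> real"
  assumes [measurable]: "g \<in> borel_measurable borel" and g0: "\<And>u. g u \<ge> 0"
  shows "(\<integral>\<^sup>+s. \<integral>\<^sup>+t. ennreal (g (t - s)) * (ennreal \<bar>c - s\<bar> * between s c t) \<partial>lborel \<partial>lborel)
     = (\<integral>\<^sup>+u. ennreal (g u * u\<^sup>2) \<partial>lborel) * ennreal (1 / 2)"
proof -
  have "(\<integral>\<^sup>+s. \<integral>\<^sup>+t. ennreal (g (t - s)) * (ennreal \<bar>c - s\<bar> * between s c t) \<partial>lborel \<partial>lborel)
    = (\<integral>\<^sup>+s. \<integral>\<^sup>+u. ennreal (g u) * (ennreal \<bar>c - s\<bar> * between s c (s + u)) \<partial>lborel \<partial>lborel)"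
  proof (rule nn_integral_cong)
    fix s :: real
    show "(\<integral>\<^sup>+t. ennreal (g (t - s)) * (ennreal \<bar>c - s\<bar> * between s c t) \<partial>lborel)
      = (\<integral>\<^sup>+u. ennreal (g u) * (ennreal \<bar>c - s\<bar> * between s c (s + u)) \<partial>lborel)"
      using nn_integral_real_affine[of "\<lambda>t. ennreal (g (t - s)) * (ennreal \<bar>c - s\<bar> * between s c t)" 1 s] by simp
  qed
  also have "\<dots> = (\<integral>\<^sup>+u. \<integral>\<^sup>+s. ennreal (g u) * (ennreal \<bar>c - s\<bar> * between s c (s + u)) \<partial>lborel \<partial>lborel)"
    by (rule lborel_pair.Fubini') (simp add: split_beta')
  also have "\<dots> = (\<integral>\<^sup>+u. ennreal (g u) * ennreal (u\<^sup>2 / 2) \<partial>lborel)"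
    by (rule nn_integral_cong) (simp add: nn_integral_cmult nn_integral_between_abs)
  also have "\<dots> = (\<integral>\<^sup>+u. ennreal (g u * u\<^sup>2) * ennreal (1 / 2) \<partial>lborel)"
  proof (rule nn_integral_cong)
    fix u
    have "g u * (u\<^sup>2 / 2) = (g u * u\<^sup>2) * (1 / 2)" by simp
    thus "ennreal (g u) * ennreal (u\<^sup>2 / 2) = ennreal (g u * u\<^sup>2) * ennreal (1 / 2)"
      using ennreal_mult'[OF g0, of u "u\<^sup>2 / 2"] ennreal_mult'[of "g u * u\<^sup>2" "1 / 2"] g0[of u] by simp
  qed
  also have "\<dots> = (\<integral>\<^sup>+u. ennreal (g u * u\<^sup>2) \<partial>lborel) * ennreal (1 / 2)" by (rule nn_integral_multc) simp
  finally show ?thesis .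
qed

context two_densities
begin

definition D :: "(real \<Rightarrow> real) \<Rightarrow> (real \<Rightarrow> real) \<Rightarrow> real \<Rightarrow> real \<Rightarrow> real" where
  "D U V s t = U (a.X s) + V (b.X t) - a.X s * b.X t"

context
  fixes U V assumes pot: "tr.potentials U V"
begin

lemma D_nonneg: "D U V s t \<ge> 0"
  unfolding D_def by (rule tr.potential_gap_nonneg[OF pot])

lemma D_meas [measurable]: "(\<lambda>z. D U V (fst z) (snd z)) \<in> borel_measurable (borel \<Otimes>\<^sub>M borel)"
proof -
  note pot_meas[OF pot, measurable]
  show ?thesis unfolding D_def by measurable
qed

lemma D_eq: "D U V s t = V (b.X t) - V (b.X s) - a.X s * (b.X t - b.X s)"
  using pot_eq[OF pot, of "a.X s"] by (simp add: D_def T_def algebra_simps)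

lemma D_le: "D U V s t \<le> 2 * (s - t)\<^sup>2"
proof -
  have Sb: "S (b.X p) = a.X p" for p by (simp add: S_def)
  have slope: "\<bar>a.X t - a.X s\<bar> \<le> 100/99 * \<bar>t - s\<bar>" "\<bar>b.X t - b.X s\<bar> \<le> 100/99 * \<bar>t - s\<bar>"
    using a.X_slope(2)[of s t] a.X_slope(2)[of t s] b.X_slope(2)[of s t] b.X_slope(2)[of t s]
      a.X_le_iff[of s t] a.X_le_iff[of t s] b.X_le_iff[of s t] b.X_le_iff[of t s]
    by (auto simp: abs_if)
  have "D U V s t \<le> \<bar>b.X t - b.X s\<bar> * \<bar>a.X t - a.X s\<bar>"
  proof -
    consider "b.X s < b.X t" | "b.X s = b.X t" | "b.X t < b.X s" by linarith
    thus ?thesis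
    proof cases
      case 1
      then obtain z where z: "b.X s < z" "z < b.X t" "V (b.X t) - V (b.X s) = (b.X t - b.X s) * S z"
        using MVT2[OF 1, of V S] dV[OF pot] by blast
      have "S z \<le> a.X t" using tr.S_le_iff[of z "b.X t"] z by (simp add: Sb)
      have st: "a.X s \<le> a.X t" using 1 by (simp add: a.X_le_iff) (use b.X_le_iff[of t s] in linarith)
      have "D U V s t = (b.X t - b.X s) * (S z - a.X s)" unfolding D_eq using z(3) by (simp add: algebra_simps)
      also have "\<dots> \<le> (b.X t - b.X s) * (a.X t - a.X s)" using 1 \<open>S z \<le> a.X t\<close> by (intro mult_left_mono) auto
      finally show ?thesis using 1 st by simp
    next
      case 2
      thus ?thesis by (simp add: D_eq)
    next
      case 3
      then obtain z where z: "b.X t < z" "z < b.X s" "V (b.X s) - V (b.X t) = (b.X s - b.X t) * S z"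
        using MVT2[OF 3, of V S] dV[OF pot] by blast
      have "a.X t \<le> S z" using tr.S_le_iff[of "b.X t" z] z by (simp add: Sb)
      have st: "a.X t \<le> a.X s" using 3 by (simp add: a.X_le_iff) (use b.X_le_iff[of s t] in linarith)
      have "D U V s t = (b.X s - b.X t) * (a.X s - S z)" unfolding D_eq using z(3) by (simp add: algebra_simps)
      also have "\<dots> \<le> (b.X s - b.X t) * (a.X s - a.X t)" using 3 \<open>a.X t \<le> S z\<close> by (intro mult_left_mono) auto
      finally show ?thesis using 3 st by simp
    qed
  qed
  also have "\<dots> \<le> (100/99 * \<bar>t - s\<bar>) * (100/99 * \<bar>t - s\<bar>)" using slope by (intro mult_mono) auto
  also have "\<dots> = (100/99)\<^sup>2 * (s - t)\<^sup>2" by (simp add: power2_eq_square abs_mult_self_eq algebra_simps)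
  also have "\<dots> \<le> 2 * (s - t)\<^sup>2" by (intro mult_right_mono) (auto simp: power2_eq_square)
  finally show ?thesis .
qed

text \<open>
  The gap vanishes at \<open>b.X s\<close> and has derivative \<open>S p - a.X s\<close> in \<open>p\<close>, and \<open>S p = a.X (b.F p)\<close>.
\<close>

lemma D_between:
  assumes G: "\<And>p. p \<in> {b0..b0 + l} \<Longrightarrow> \<bar>a.X p - a.X s\<bar> \<le> G * \<bar>p - s\<bar>"
    and s: "s \<in> {b0..b0 + l}" and t: "t \<in> {b0..b0 + l}"
  shows "ennreal (D U V s t) \<le> (\<integral>\<^sup>+p. ennreal (G * \<bar>b.F p - s\<bar>) * between s (b.F p) t \<partial>lborel)"
proof -
  have cF: "continuous_on UNIV (\<lambda>p. G * \<bar>b.F p - s\<bar>)" by (intro continuous_intros b.F_continuous)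
  have cS: "continuous_on X S" for X by (rule inv.T_continuous)
  have key: "ennreal I \<le> (\<integral>\<^sup>+p. ennreal (G * \<bar>b.F p - s\<bar>) * between s (b.F p) t \<partial>lborel)"
    if I: "(f has_integral I) {b.X c..b.X d}" and cd: "{c..d} \<subseteq> {b0..b0 + l}" and f: "\<And>p. p \<in> {b.X c..b.X d} \<Longrightarrow> f p \<le> \<bar>S p - a.X s\<bar>"
      and sub: "\<And>q. q \<in> {c..d} \<Longrightarrow> between s q t = 1" for f I c d
  proof -
    have inn: "b.F p \<in> {c..d}" if "p \<in> {b.X c..b.X d}" for p
      using that b.F_le_iff[of "b.X c" p] b.F_le_iff[of p "b.X d"] by simp
    have le: "\<bar>S p - a.X s\<bar> \<le> G * \<bar>b.F p - s\<bar>" if "p \<in> {b.X c..b.X d}" for p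
      using G[of "b.F p"] inn[OF that] cd by (auto simp: S_def)
    have "I \<le> integral {b.X c..b.X d} (\<lambda>p. G * \<bar>b.F p - s\<bar>)"
    proof (rule has_integral_le[OF I integrable_integral])
      show "(\<lambda>p. G * \<bar>b.F p - s\<bar>) integrable_on {b.X c..b.X d}"
        by (rule integrable_continuous_real) (rule continuous_on_subset[OF cF], simp)
      show "f p \<le> G * \<bar>b.F p - s\<bar>" if "p \<in> {b.X c..b.X d}" for p using f[OF that] le[OF that] by linarith
    qed
    hence "ennreal I \<le> ennreal (integral {b.X c..b.X d} (\<lambda>p. G * \<bar>b.F p - s\<bar>))" by (rule ennreal_leI)
    also have "\<dots> = (\<integral>\<^sup>+p\<in>{b.X c..b.X d}. ennreal (G * \<bar>b.F p - s\<bar>) \<partial>lborel)"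
      by (rule nn_integral_Icc_continuous[OF cF, symmetric]) (use le abs_ge_zero order_trans in blast)
    also have "\<dots> \<le> (\<integral>\<^sup>+p. ennreal (G * \<bar>b.F p - s\<bar>) * between s (b.F p) t \<partial>lborel)"
    proof (rule nn_integral_mono)
      fix p
      show "ennreal (G * \<bar>b.F p - s\<bar>) * indicator {b.X c..b.X d} p \<le> ennreal (G * \<bar>b.F p - s\<bar>) * between s (b.F p) t"
        using sub[OF inn, of p] by (cases "p \<in> {b.X c..b.X d}") auto
    qed
    finally show ?thesis .
  qed
  have dD: "((\<lambda>p. V p - a.X s * p) has_real_derivative (S p - a.X s)) (at p within Y)" for p Y
    by (auto intro!: derivative_eq_intros has_field_derivative_at_within[OF dV[OF pot]])
  show ?thesis
  proof (cases "s \<le> t")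
    case True
    have "((\<lambda>p. S p - a.X s) has_integral ((V (b.X t) - a.X s * b.X t) - (V (b.X s) - a.X s * b.X s))) {b.X s..b.X t}"
      using True by (intro fundamental_theorem_of_calculus) (auto simp: b.X_le_iff dD simp flip: has_real_derivative_iff_has_vector_derivative)
    moreover have "(V (b.X t) - a.X s * b.X t) - (V (b.X s) - a.X s * b.X s) = D U V s t" by (simp add: D_eq algebra_simps)
    ultimately have "((\<lambda>p. S p - a.X s) has_integral D U V s t) {b.X s..b.X t}" by simp
    thus ?thesis by (rule key) (use s t True in \<open>auto simp: between_def\<close>)
  next
    case False
    have "((\<lambda>p. S p - a.X s) has_integral ((V (b.X s) - a.X s * b.X s) - (V (b.X t) - a.X s * b.X t))) {b.X t..b.X s}"
      using False by (intro fundamental_theorem_of_calculus) (auto simp: b.X_le_iff dD simp flip: has_real_derivative_iff_has_vector_derivative)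
    hence "((\<lambda>p. - (S p - a.X s)) has_integral - ((V (b.X s) - a.X s * b.X s) - (V (b.X t) - a.X s * b.X t))) {b.X t..b.X s}"
      by (rule has_integral_neg)
    moreover have "- ((V (b.X s) - a.X s * b.X s) - (V (b.X t) - a.X s * b.X t)) = D U V s t" by (simp add: D_eq algebra_simps)
    ultimately have "((\<lambda>p. - (S p - a.X s)) has_integral D U V s t) {b.X t..b.X s}" by simp
    thus ?thesis by (rule key) (use s t False in \<open>auto simp: between_def\<close>)
  qed
qed

text \<open>
  Integrating over starting points and steps before integrating over the points \<open>p\<close> passed over, only
  the length of the image of the block under \<open>b.X\<close> remains. This is why the final density may be
  merely measurable.
\<close>

lemma D_kernel_le:
  fixes g :: "real \<Rightarrow> real"
  assumes G0: "G \<ge> 0" and G: "\<And>p s. p \<in> {b0..b0 + l} \<Longrightarrow> s \<in> {b0..b0 + l} \<Longrightarrow> \<bar>a.X p - a.X s\<bar> \<le> G * \<bar>p - s\<bar>"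
    and l: "l \<ge> 0" and gm [measurable]: "g \<in> borel_measurable borel" and g0: "\<And>u. g u \<ge> 0"
    and M2: "(\<integral>\<^sup>+u. ennreal (g u * u\<^sup>2) \<partial>lborel) = ennreal m2" "m2 \<ge> 0"
  shows "(\<integral>\<^sup>+s. \<integral>\<^sup>+t. ennreal (g (t - s) * D U V s t) * (indicator {b0..<b0 + l} s * indicator {b0..<b0 + l} t) \<partial>lborel \<partial>lborel)
     \<le> ennreal (G * (b.X (b0 + l) - b.X b0) * m2 / 2)"
proof -
  let ?J = "{b.X b0..b.X (b0 + l)}"
  define K where "K s t p = ennreal G * indicator ?J p * (ennreal (g (t - s)) * (ennreal \<bar>b.F p - s\<bar> * between s (b.F p) t))" for s t p
  have pw: "ennreal (g (t - s) * D U V s t) * (indicator {b0..<b0 + l} s * indicator {b0..<b0 + l} t) \<le> (\<integral>\<^sup>+p. K s t p \<partial>lborel)" for s t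
  proof (cases "s \<in> {b0..<b0 + l} \<and> t \<in> {b0..<b0 + l}")
    case True
    hence st: "s \<in> {b0..b0 + l}" "t \<in> {b0..b0 + l}" by auto
    have "ennreal (g (t - s) * D U V s t) \<le> ennreal (g (t - s)) * (\<integral>\<^sup>+p. ennreal (G * \<bar>b.F p - s\<bar>) * between s (b.F p) t \<partial>lborel)"
      using g0 D_nonneg by (simp add: ennreal_mult) (intro mult_left_mono D_between[OF G[OF _ st(1)] st], auto)
    also have "\<dots> = (\<integral>\<^sup>+p. ennreal (g (t - s)) * (ennreal (G * \<bar>b.F p - s\<bar>) * between s (b.F p) t) \<partial>lborel)"
      by (rule nn_integral_cmult[symmetric]) simp
    also have "\<dots> = (\<integral>\<^sup>+p. K s t p \<partial>lborel)"
    proof (rule nn_integral_cong)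
      fix p
      show "ennreal (g (t - s)) * (ennreal (G * \<bar>b.F p - s\<bar>) * between s (b.F p) t) = K s t p"
      proof (cases "between s (b.F p) t = 0")
        case False
        hence "b.F p \<in> {b0..b0 + l}" using st by (auto simp: between_def split: if_splits)
        hence "p \<in> ?J" using b.X_le_iff[of b0 "b.F p"] b.X_le_iff[of "b.F p" "b0 + l"] by simp
        thus ?thesis using G0 by (simp add: K_def ennreal_mult ac_simps)
      qed (simp add: K_def)
    qed
    finally show ?thesis using True by simp
  qed auto
  have [measurable]: "(\<lambda>(s, t, p). K s t p) \<in> borel_measurable (borel \<Otimes>\<^sub>M borel \<Otimes>\<^sub>M borel)"
    unfolding K_def by measurable
  have "(\<integral>\<^sup>+s. \<integral>\<^sup>+t. ennreal (g (t - s) * D U V s t) * (indicator {b0..<b0 + l} s * indicator {b0..<b0 + l} t) \<partial>lborel \<partial>lborel)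
    \<le> (\<integral>\<^sup>+s. \<integral>\<^sup>+t. \<integral>\<^sup>+p. K s t p \<partial>lborel \<partial>lborel \<partial>lborel)"
    by (intro nn_integral_mono pw)
  also have "\<dots> = (\<integral>\<^sup>+s. \<integral>\<^sup>+p. \<integral>\<^sup>+t. K s t p \<partial>lborel \<partial>lborel \<partial>lborel)"
    by (rule nn_integral_cong, rule lborel_pair.Fubini') (simp add: K_def split_beta')
  also have "\<dots> = (\<integral>\<^sup>+p. \<integral>\<^sup>+s. \<integral>\<^sup>+t. K s t p \<partial>lborel \<partial>lborel \<partial>lborel)"
    by (rule lborel_pair.Fubini') (simp add: K_def split_beta')
  also have "\<dots> = (\<integral>\<^sup>+p. ennreal G * indicator ?J p * (ennreal m2 * ennreal (1 / 2)) \<partial>lborel)"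
  proof (rule nn_integral_cong)
    fix p
    have "(\<integral>\<^sup>+s. \<integral>\<^sup>+t. K s t p \<partial>lborel \<partial>lborel) = ennreal G * indicator ?J p * (\<integral>\<^sup>+s. \<integral>\<^sup>+t. ennreal (g (t - s)) * (ennreal \<bar>b.F p - s\<bar> * between s (b.F p) t) \<partial>lborel \<partial>lborel)"
      unfolding K_def by (simp add: nn_integral_cmult)
    thus "(\<integral>\<^sup>+s. \<integral>\<^sup>+t. K s t p \<partial>lborel \<partial>lborel) = ennreal G * indicator ?J p * (ennreal m2 * ennreal (1 / 2))"
      unfolding nn_integral_between_kernel[OF gm g0] M2(1) .
  qed
  also have "\<dots> = (\<integral>\<^sup>+p. (ennreal G * (ennreal m2 * ennreal (1 / 2))) * indicator ?J p \<partial>lborel)"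
    by (rule nn_integral_cong) (simp add: ac_simps)
  also have "\<dots> = (ennreal G * (ennreal m2 * ennreal (1 / 2))) * emeasure lborel ?J"
    by (rule nn_integral_cmult_indicator) simp
  also have "\<dots> = ennreal (G * (b.X (b0 + l) - b.X b0) * m2 / 2)"
  proof -
    have "b.X b0 \<le> b.X (b0 + l)" using l by (simp add: b.X_le_iff)
    hence "emeasure lborel ?J = ennreal (b.X (b0 + l) - b.X b0)" by simp
    moreover have "ennreal (G * (m2 * (1 / 2)) * (b.X (b0 + l) - b.X b0)) = ennreal G * (ennreal m2 * ennreal (1 / 2)) * ennreal (b.X (b0 + l) - b.X b0)"
    proof -
      have "0 \<le> G * (m2 * (1 / 2))" using G0 M2(2) by simp
      thus ?thesis by (simp only: ennreal_mult' ennreal_mult'[OF G0] ennreal_mult'[OF M2(2)])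
    qed
    moreover have "G * (m2 * (1 / 2)) * (b.X (b0 + l) - b.X b0) = G * (b.X (b0 + l) - b.X b0) * m2 / 2" by simp
    ultimately show ?thesis by (simp only:)
  qed
  finally show ?thesis .
qed

end

end

section \<open>Gluing the blocks\<close>

context two_densities
begin

text \<open>
  With the variance parameter \<open>h * v i\<close> the bound for the transport cost over a block is its length times the second
  moment divided by \<open>4 * h * v i\<close>, exactly the amount by which the second moment lowers the entropy of the
  truncated Gaussian. What is left is the logarithm of the normalisation and boundary terms of order
  \<open>sqrt h\<close>.
\<close>

lemma gap_le_blocks:
  fixes G :: "nat \<Rightarrow> real" and n :: nat and R h :: real
  assumes h: "h > 0" and n: "n > 0" and R: "R > 0" and Gpos: "\<And>i. G i > 0"
    and lip: "\<And>i p s. i < n \<Longrightarrow> p \<in> {i * L / n..i * L / n + L / n} \<Longrightarrow> s \<in> {i * L / n..i * L / n + L / n}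
        \<Longrightarrow> \<bar>a.X p - a.X s\<bar> \<le> G i * \<bar>p - s\<bar>"
    and v_def: "\<And>i. v i = (L / n) / (G i * (b.X (i * L / n + L / n) - b.X (i * L / n)))"
    and small: "\<And>i. i < n \<Longrightarrow> 2 * (R * sqrt (h * v i)) \<le> L / n"
  shows "gap L h r1 r0 \<le> ereal ((\<integral>y. ln (r1 y) \<partial>law L r1)
     + (\<Sum>i<n. L / n * ln (L * sqrt (4 * pi) / (sqrt (v i) * zeta R)) + 2 * (R * sqrt (h * v i)) * (R\<^sup>2 / 4 + ln 3 + R\<^sup>2 * v i)) / L)"
proof -
  obtain U V where pot: "tr.potentials U V" using tr.potentials_exist by blast
  define l where "l = L / n"
  define \<beta> where "\<beta> i = i * L / n" for i :: nat
  define Jl where "Jl i = b.X (\<beta> i + l) - b.X (\<beta> i)" for i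
  have l: "l > 0" using a.L n by (simp add: l_def)
  have Jl: "Jl i > 0" for i
    using l b.X_slope(1)[of "\<beta> i" "\<beta> i + l"] by (simp add: Jl_def)
  have v: "v i = l / (G i * Jl i)" "v i > 0" for i
  proof -
    show "v i = l / (G i * Jl i)" by (simp add: v_def l_def Jl_def \<beta>_def)
    thus "v i > 0" using l Gpos[of i] Jl[of i] by simp
  qed
  define \<tau> where "\<tau> i = h * v i" for i
  have tau: "\<tau> i > 0" for i using h v(2)[of i] by (simp add: \<tau>_def)
  define \<rho> where "\<rho> i = R * sqrt (\<tau> i)" for i
  define gm where "gm i = 1 / (sqrt (\<tau> i) * zeta R)" for i
  have bk: "block_kernel (trunc_gauss R (\<tau> i)) l (\<rho> i) (gm i)" if "i < n" for i
    unfolding \<rho>_def gm_def by (rule block_kernel_trunc_gauss[OF R tau]) (use small[OF that] in \<open>simp add: \<tau>_def l_def\<close>)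
  define kb where "kb i = block_kernel.kb (trunc_gauss R (\<tau> i)) (\<beta> i) l" for i
  have kb_meas[measurable]: "(\<lambda>z. kb i (fst z) (snd z)) \<in> borel_measurable (borel \<Otimes>\<^sub>M borel)" if "i < n" for i
    unfolding kb_def by (rule block_kernel.kb_meas[OF bk[OF that]])
  have kb_nonneg: "kb i s t \<ge> 0" if "i < n" for i s t
    unfolding kb_def by (rule block_kernel.kb_nonneg[OF bk[OF that]])
  have kb_le: "kb i s t \<le> 3 * gm i" if "i < n" for i s t
    unfolding kb_def by (rule block_kernel.kb_le[OF bk[OF that]])
  have kb_sym: "kb i s t = kb i t s" if "i < n" for i s t
    unfolding kb_def by (rule block_kernel.kb_sym[OF bk[OF that]])
  have kb_supp: "s \<in> {\<beta> i..<\<beta> i + l}" if "i < n" "kb i s t \<noteq> 0" for i s t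
    using block_kernel.kb_supp[OF bk[OF that(1)], of "\<beta> i" s t] that(2) unfolding kb_def by blast
  have kb_one: "(\<integral>\<^sup>+t. ennreal (kb i s t) \<partial>lborel) = 1" if "i < n" "s \<in> {\<beta> i..<\<beta> i + l}" for i s
    unfolding kb_def by (rule block_kernel.kb_one[OF bk[OF that(1)] that(2)])
  have blk: "real i \<le> s * n / L \<and> s * n / L < real i + 1" if "s \<in> {\<beta> i..<\<beta> i + l}" for i s
    using that a.L n by (auto simp: \<beta>_def l_def field_simps)
  have uniq: "i = j" if "s \<in> {\<beta> i..<\<beta> i + l}" "s \<in> {\<beta> j..<\<beta> j + l}" for i j s
    using blk[OF that(1)] blk[OF that(2)] by linarith
  have cover: "\<exists>i<n. s \<in> {\<beta> i..<\<beta> i + l}" if "s \<in> {0..<L}" for s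
  proof -
    define i where "i = nat \<lfloor>s * n / L\<rfloor>"
    have i: "real i \<le> s * n / L" "s * n / L < real i + 1"
      unfolding i_def using that a.L by (auto simp: of_nat_nat)
    have "s * n / L < n" using that a.L n by (simp add: field_simps)
    hence "i < n" using i(1) by linarith
    thus ?thesis using i a.L n by (intro exI[of _ i]) (auto simp: \<beta>_def l_def field_simps)
  qed
  define \<kappa> where "\<kappa> s t = (\<Sum>i<n. kb i s t)" for s t
  have \<kappa>_block: "\<kappa> s t = kb i s t" if iB: "i < n" "s \<in> {\<beta> i..<\<beta> i + l}" for i s t
  proof -
    have "kb j s t = (if j = i then kb i s t else 0)" if j: "j < n" for j
    proof (cases "j = i")
      case False
      have "kb j s t = 0"
      proof (rule ccontr)
        assume "kb j s t \<noteq> 0"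
        hence "s \<in> {\<beta> j..<\<beta> j + l}" by (rule kb_supp[OF j])
        hence "j = i" by (rule uniq) (rule iB(2))
        with False show False by contradiction
      qed
      thus ?thesis using False by (simp only: if_False)
    next
      case True
      thus ?thesis by simp
    qed
    hence "\<kappa> s t = (\<Sum>j<n. if j = i then kb i s t else 0)"
      unfolding \<kappa>_def by (intro sum.cong[OF refl]) (simp only: lessThan_iff)
    also have "\<dots> = kb i s t" using iB(1) by (simp only: sum.delta finite_lessThan lessThan_iff if_True)
    finally show ?thesis .
  qed
  have km: "(\<lambda>z. \<kappa> (fst z) (snd z)) \<in> borel_measurable (borel \<Otimes>\<^sub>M borel)"
    unfolding \<kappa>_def by (intro borel_measurable_sum) (auto intro: kb_meas)
  have k0: "\<kappa> s t \<ge> 0" for s t unfolding \<kappa>_def by (rule sum_nonneg, rule kb_nonneg) simp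
  have kC: "\<kappa> s t \<le> (\<Sum>i<n. 3 * gm i)" for s t unfolding \<kappa>_def by (rule sum_mono, rule kb_le) simp
  have ksym: "\<kappa> s t = \<kappa> t s" for s t unfolding \<kappa>_def by (rule sum.cong[OF refl], rule kb_sym) simp
  have kblock: "\<exists>i<n. s \<in> {\<beta> i..<\<beta> i + l}" if "\<kappa> s t \<noteq> 0" for s t
  proof -
    have "\<exists>i<n. kb i s t \<noteq> 0" by (rule ccontr) (use that in \<open>simp add: \<kappa>_def\<close>)
    thus ?thesis using kb_supp by blast
  qed
  have ksupp: "s \<in> {0..L}" if ne: "\<kappa> s t \<noteq> 0" for s t
  proof -
    obtain i where i: "i < n" "s \<in> {\<beta> i..<\<beta> i + l}" using kblock[OF ne] by blast
    have "\<beta> i \<ge> 0" using a.L by (simp add: \<beta>_def)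
    moreover have "\<beta> i + l \<le> L"
    proof -
      have "real i + 1 \<le> real n" using i(1) by linarith
      hence "(real i + 1) * L \<le> real n * L" using a.L by (intro mult_right_mono) auto
      thus ?thesis using n by (simp add: \<beta>_def l_def field_simps)
    qed
    ultimately show ?thesis using i(2) by auto
  qed
  have kone: "(\<integral>\<^sup>+t. ennreal (\<kappa> s t) \<partial>lborel) = 1" if "s \<in> {0..<L}" for s
  proof -
    obtain i where i: "i < n" "s \<in> {\<beta> i..<\<beta> i + l}" using cover[OF \<open>s \<in> {0..<L}\<close>] by blast
    show ?thesis using kb_one[OF i] \<kappa>_block[OF i] by simp
  qed
  define c where "c = L * sqrt (4 * pi * h)"
  have c: "c > 0" using a.L h by (simp add: c_def)
  define Dt where "Dt s t = U (a.X s) + V (b.X t) - a.X s * b.X t" for s t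
  have Dt: "Dt = D U V" by (simp add: fun_eq_iff Dt_def D_def)
  define f where "f i z = kb i (fst z) (snd z) * (ln (c * kb i (fst z) (snd z)) + Dt (fst z) (snd z) / (2 * h))" for i z
  define al where "al i = L * sqrt (4 * pi) / (sqrt (v i) * zeta R)" for i
  have al: "al i > 0" for i using a.L v(2)[of i] zeta_pos[OF R] by (simp add: al_def)
  have block: "integrable (lborel \<Otimes>\<^sub>M lborel) (f i)"
    "(\<integral>z. f i z \<partial>(lborel \<Otimes>\<^sub>M lborel)) \<le> l * ln (al i) + 2 * \<rho> i * (R\<^sup>2 / 4 + ln 3 + R\<^sup>2 * v i)" if i: "i < n" for i
  proof -
    interpret bk: block_kernel "trunc_gauss R (\<tau> i)" "\<beta> i" l "\<rho> i" "gm i" by (rule bk[OF i])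
    define m2 where "m2 = second_moment R (\<tau> i)"
    note sm = second_moment[OF R tau[of i], folded m2_def]
    define Q where "Q = G i * Jl i * m2 / 2"
    have Q0: "Q \<ge> 0" using Gpos[of i] Jl[of i] sm(2) by (simp add: Q_def)
    have Q: "(\<integral>\<^sup>+s. \<integral>\<^sup>+t. ennreal (trunc_gauss R (\<tau> i) (t - s) * D U V s t) * (indicator {\<beta> i..<\<beta> i + l} s * indicator {\<beta> i..<\<beta> i + l} t) \<partial>lborel \<partial>lborel) \<le> ennreal Q"
      unfolding Q_def Jl_def
    proof (rule D_kernel_le[OF pot _ _ _ bk.gmeas bk.g0 sm(4) sm(2)])
      show "0 \<le> G i" "0 \<le> l" using Gpos[of i] l by auto
      show "\<bar>a.X p - a.X s\<bar> \<le> G i * \<bar>p - s\<bar>" if "p \<in> {\<beta> i..\<beta> i + l}" "s \<in> {\<beta> i..\<beta> i + l}" for p s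
        using lip[OF i] that unfolding \<beta>_def l_def by blast
    qed
    note be = bk.block_excess_le[OF c h D_meas[OF pot] D_nonneg[OF pot] D_le[OF pot] Q Q0]
    show "integrable (lborel \<Otimes>\<^sub>M lborel) (f i)" using be(1) unfolding f_def kb_def Dt by simp
    have ca: "c / (sqrt (\<tau> i) * zeta R) = al i"
      using h by (simp add: c_def al_def \<tau>_def real_sqrt_mult)
    have "(\<integral>z. f i z \<partial>(lborel \<Otimes>\<^sub>M lborel)) \<le> (l - 2 * \<rho> i) * (ln (al i) - m2 / (4 * \<tau> i)) + 2 * \<rho> i * (ln (c * (3 * gm i)) + (\<rho> i)\<^sup>2 / h) + Q / (2 * h)"
      using be(2) unfolding f_def kb_def Dt trunc_gauss_entropy[OF R tau c] ca m2_def[symmetric] .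
    also have "ln (c * (3 * gm i)) = ln 3 + ln (al i)"
    proof -
      have "c * (3 * gm i) = 3 * al i" unfolding ca[symmetric] gm_def by simp
      thus ?thesis using al[of i] by (simp only:) (simp add: ln_mult)
    qed
    also have "(\<rho> i)\<^sup>2 / h = R\<^sup>2 * v i" using h tau[of i] by (simp add: \<rho>_def \<tau>_def power_mult_distrib)
    also have "Q / (2 * h) = l * (m2 / (4 * \<tau> i))"
      unfolding Q_def \<tau>_def using v[of i] Gpos[of i] Jl[of i] h l by (simp add: field_simps)
    also have "(l - 2 * \<rho> i) * (ln (al i) - m2 / (4 * \<tau> i)) + 2 * \<rho> i * (ln 3 + ln (al i) + R\<^sup>2 * v i) + l * (m2 / (4 * \<tau> i))
        = l * ln (al i) + 2 * \<rho> i * (m2 / (4 * \<tau> i) + ln 3 + R\<^sup>2 * v i)"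
    proof -
      have "(l - 2 * r) * (x - w) + 2 * r * (a + x + y) + l * w = l * x + 2 * r * (w + a + y)" for r x w a y :: real
        by (simp add: algebra_simps)
      thus ?thesis .
    qed
    also have "\<dots> \<le> l * ln (al i) + 2 * \<rho> i * (R\<^sup>2 / 4 + ln 3 + R\<^sup>2 * v i)"
    proof -
      have "m2 / (4 * \<tau> i) \<le> R\<^sup>2 / 4" using sm(3) tau[of i] by (simp add: field_simps)
      moreover have "\<rho> i > 0" by (rule bk.rho)
      ultimately show ?thesis by (intro add_left_mono mult_left_mono) auto
    qed
    finally show "(\<integral>z. f i z \<partial>(lborel \<Otimes>\<^sub>M lborel)) \<le> l * ln (al i) + 2 * \<rho> i * (R\<^sup>2 / 4 + ln 3 + R\<^sup>2 * v i)" .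
  qed
  have ex: "excess U V h \<kappa> (fst z) (snd z) = (\<Sum>i<n. f i z)" for z
  proof -
    define s t where "s = fst z" and "t = snd z"
    show ?thesis
    proof (cases "\<kappa> s t = 0")
      case True
      have "kb i s t = 0" if "i < n" for i
      proof (rule ccontr)
        assume "kb i s t \<noteq> 0"
        with \<kappa>_block[OF that kb_supp[OF that]] True show False by metis
      qed
      hence "f i z = 0" if "i < n" for i using that by (simp add: f_def s_def t_def)
      thus ?thesis using True by (simp add: excess_def s_def t_def)
    next
      case False
      obtain i where i: "i < n" "s \<in> {\<beta> i..<\<beta> i + l}" using kblock[OF False] by blast
      have ki: "\<kappa> s t = kb i s t" by (rule \<kappa>_block[OF i])
      have kp: "kb i s t > 0" using False ki k0[of s t] by simp
      have "f j z = (if j = i then f i z else 0)" if "j < n" for j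
      proof (cases "j = i")
        case False
        hence "kb j s t = 0" using kb_supp[OF that] uniq[OF _ i(2)] by blast
        thus ?thesis using False by (simp add: f_def s_def t_def)
      qed simp
      hence "(\<Sum>j<n. f j z) = (\<Sum>j<n. if j = i then f i z else 0)" by (intro sum.cong) auto
      also have "\<dots> = f i z" using i(1) by simp
      also have "ln (c * kb i s t) = ln (L * kb i s t) + ln (4 * pi * h) / 2"
      proof -
        have "c * kb i s t = sqrt (4 * pi * h) * (L * kb i s t)" by (simp add: c_def)
        thus ?thesis using kp a.L h by (simp add: ln_mult ln_sqrt)
      qed
      hence "f i z = excess U V h \<kappa> (fst z) (snd z)"
        unfolding f_def excess_def Dt_def s_def[symmetric] t_def[symmetric] ki by simp
      finally show ?thesis by simp
    qed
  qed
  have "(\<integral>z. excess U V h \<kappa> (fst z) (snd z) \<partial>(lborel \<Otimes>\<^sub>M lborel)) = (\<Sum>i<n. \<integral>z. f i z \<partial>(lborel \<Otimes>\<^sub>M lborel))"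
    unfolding ex by (rule Bochner_Integration.integral_sum) (use block(1) in auto)
  also have "\<dots> \<le> (\<Sum>i<n. l * ln (al i) + 2 * \<rho> i * (R\<^sup>2 / 4 + ln 3 + R\<^sup>2 * v i))"
    by (intro sum_mono block(2)) auto
  finally have "(\<integral>z. excess U V h \<kappa> (fst z) (snd z) \<partial>(lborel \<Otimes>\<^sub>M lborel)) / L \<le> (\<Sum>i<n. l * ln (al i) + 2 * \<rho> i * (R\<^sup>2 / 4 + ln 3 + R\<^sup>2 * v i)) / L"
    using a.L by (intro divide_right_mono) auto
  moreover have "gap L h r1 r0 \<le> ereal ((\<integral>y. ln (r1 y) \<partial>law L r1) + (\<integral>z. excess U V h \<kappa> (fst z) (snd z) \<partial>(lborel \<Otimes>\<^sub>M lborel)) / L)"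
    by (rule gap_le_excess[OF pot h km k0 kC ksym ksupp kone])
  ultimately show ?thesis
    unfolding l_def al_def \<rho>_def \<tau>_def by (meson add_left_mono ereal_less_eq(3) order_trans)
qed

end

context near_uniform
begin

text \<open>
  Lowering the sampled values of \<open>f\<close> by \<open>\<epsilon>\<close> makes them lower bounds for \<open>f\<close> on the intervals; the error in the
  logarithm is at most \<open>2 * \<epsilon>\<close> divided by the lowered value, which is at least \<open>1 / (2 * L)\<close>.
\<close>

lemma riemann_log:
  fixes f :: "real \<Rightarrow> real"
  assumes fc: "continuous_on UNIV f" and flo: "\<And>x. 99 / (100 * L) \<le> f x" and e: "0 < \<epsilon>" "\<epsilon> \<le> 1 / (4 * L)"
  shows "\<exists>N::nat. \<forall>n>N. (\<forall>i<n. \<forall>t\<in>{X (real i * L / n)..X (real i * L / n + L / n)}. \<bar>f t - f (X (real i * L / n))\<bar> \<le> \<epsilon>)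
    \<and> (\<integral>x. ln (f x) \<partial>law L \<rho>) \<le> (\<Sum>i<n. ln (f (X (real i * L / n)) - \<epsilon>)) / n + 4 * L * \<epsilon>"
proof -
  have cfX: "continuous_on Y (\<lambda>s. f (X s))" for Y
    by (rule continuous_on_compose2[OF fc X_continuous]) simp
  have "uniformly_continuous_on {0..L} (\<lambda>s. f (X s))" by (rule compact_uniformly_continuous[OF cfX]) simp
  then obtain \<omega> where w: "\<omega> > 0" "\<And>s t. s \<in> {0..L} \<Longrightarrow> t \<in> {0..L} \<Longrightarrow> dist t s < \<omega> \<Longrightarrow> dist (f (X t)) (f (X s)) < \<epsilon>"
    unfolding uniformly_continuous_on_def using e(1) by metis
  obtain N :: nat where N: "L / \<omega> < real N" using reals_Archimedean2 by blast
  show ?thesis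
  proof (intro exI[of _ N] allI impI)
    fix n assume "n > N"
    hence n: "n > 0" "L / n < \<omega>" using N w(1) L
      by (auto simp: field_simps) (smt (verit) mult_left_mono of_nat_less_iff)
    define \<beta> where "\<beta> i = i * L / n" for i :: nat
    have bS: "\<beta> i + L / n = \<beta> (Suc i)" for i by (simp add: \<beta>_def add_divide_distrib distrib_right add.commute)
    have b_in: "\<beta> i \<in> {0..L}" if "i \<le> n" for i using that L n by (auto simp: \<beta>_def field_simps)
    have osc: "\<bar>f (X s) - f (X (\<beta> i))\<bar> \<le> \<epsilon>" if "i < n" "s \<in> {\<beta> i..\<beta> (Suc i)}" for i s
    proof -
      have "\<beta> i \<in> {0..L}" "s \<in> {0..L}" using that b_in[of i] b_in[of "Suc i"] by auto
      moreover have "dist s (\<beta> i) < \<omega>" using that n(2) bS[of i] by (auto simp: dist_real_def)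
      ultimately show ?thesis using w(2)[of "\<beta> i" s] by (simp add: dist_real_def)
    qed
    have osc': "\<bar>f t - f (X (\<beta> i))\<bar> \<le> \<epsilon>" if "i < n" "t \<in> {X (\<beta> i)..X (\<beta> (Suc i))}" for i t
      using osc[OF that(1), of "F t"] that(2) F_le_iff[of "X (\<beta> i)" t] F_le_iff[of t "X (\<beta> (Suc i))"] by simp
    have pos: "f (X (\<beta> i)) - \<epsilon> \<ge> 1 / (2 * L)" for i
    proof -
      have "1 / (4 * L) + 1 / (2 * L) \<le> 99 / (100 * L)" using L by (simp add: field_simps)
      thus ?thesis using flo[of "X (\<beta> i)"] e(2) by linarith
    qed
    have fpos: "f x > 0" for x
    proof -
      have "99 / (100 * L) > 0" using L by simp
      thus ?thesis using flo[of x] by linarith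
    qed
    define u where "u s = ln (f (X s))" for s
    have cu: "continuous_on Y u" for Y unfolding u_def
      by (intro continuous_on_ln cfX) (metis fpos less_irrefl)
    have up: "u s \<le> ln (f (X (\<beta> i)) - \<epsilon>) + 4 * L * \<epsilon>" if "i < n" "s \<in> {\<beta> i..\<beta> (Suc i)}" for i s
    proof -
      define q where "q = f (X (\<beta> i)) - \<epsilon>"
      have "0 < 1 / (2 * L)" using L by simp
      hence q: "q \<ge> 1 / (2 * L)" "q > 0" using pos[of i] unfolding q_def by linarith+
      have "f (X s) \<le> q + 2 * \<epsilon>" using osc[OF that] unfolding q_def by linarith
      hence "u s \<le> ln (q * (1 + 2 * \<epsilon> / q))"
      proof -
        have "q * (1 + 2 * \<epsilon> / q) = q + 2 * \<epsilon>" using q by (simp add: field_simps)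
        thus ?thesis unfolding u_def using fpos[of "X s"] \<open>f (X s) \<le> q + 2 * \<epsilon>\<close> by (simp add: ln_mono)
      qed
      also have "\<dots> = ln q + ln (1 + 2 * \<epsilon> / q)" 
      proof -
        have "0 < 1 + 2 * \<epsilon> / q" using q e by (simp add: add_pos_pos)
        thus ?thesis using q by (simp add: ln_mult)
      qed
      also have "ln (1 + 2 * \<epsilon> / q) \<le> 2 * \<epsilon> / q" using q e by (intro ln_add_one_self_le_self) auto
      also have "2 * \<epsilon> / q \<le> 2 * \<epsilon> / (1 / (2 * L))" using q e L by (intro divide_left_mono) auto
      also have "\<dots> = 4 * L * \<epsilon>" using L by simp
      finally show ?thesis unfolding q_def by simp
    qed
    have int: "(\<integral>x. ln (f x) \<partial>law L \<rho>) = integral {0..L} u / L"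
    proof -
      have [measurable]: "u \<in> borel_measurable borel" "f \<in> borel_measurable borel"
        by (intro borel_measurable_continuous_onI cu fc)+
      interpret uni: near_uniform L \<delta> "\<lambda>_. 1 / L" by (rule near_uniform_const[OF L d])
      have "(\<integral>x. ln (f x) \<partial>law L \<rho>) = (\<integral>x. ln (f x) \<partial>distr unif borel X)" by (simp add: distr_X)
      also have "\<dots> = (\<integral>s. u s \<partial>unif)" unfolding u_def by (subst integral_distr) auto
      also have "\<dots> = (\<integral>s. indicator {0..L} s * (1 / L) * u s \<partial>lborel)" by (rule uni.integral_law) simp
      also have "\<dots> = (\<integral>s. indicator {0..L} s * u s \<partial>lborel) / L" by (simp add: mult.assoc[symmetric] mult.commute)
      also have "(\<integral>s. indicator {0..L} s * u s \<partial>lborel) = integral {0..L} u"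
      proof -
        have "set_integrable lborel {0..L} u" by (rule borel_integrable_atLeastAtMost'[OF cu])
        from set_borel_integral_eq_integral(2)[OF this] show ?thesis by (simp add: set_lebesgue_integral_def)
      qed
      finally show ?thesis .
    qed
    have "integral {0..L} u = (\<Sum>i<n. integral {\<beta> i..\<beta> (Suc i)} u)"
    proof -
      have "\<beta> i \<le> \<beta> (Suc i)" for i unfolding bS[symmetric] using L by simp
      moreover have "\<beta> 0 = 0" "\<beta> n = L" using n by (simp_all add: \<beta>_def)
      ultimately show ?thesis using sum_integral_partition[OF cu[of UNIV], of \<beta> n] by simp
    qed
    also have "\<dots> \<le> (\<Sum>i<n. L / n * (ln (f (X (\<beta> i)) - \<epsilon>) + 4 * L * \<epsilon>))"
    proof (rule sum_mono)
      fix i assume i: "i \<in> {..<n}"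
      have "integral {\<beta> i..\<beta> (Suc i)} u \<le> integral {\<beta> i..\<beta> (Suc i)} (\<lambda>_. ln (f (X (\<beta> i)) - \<epsilon>) + 4 * L * \<epsilon>)"
        by (rule Henstock_Kurzweil_Integration.integral_le) (use up i in \<open>auto intro!: integrable_continuous_real cu\<close>)
      also have "\<dots> = L / n * (ln (f (X (\<beta> i)) - \<epsilon>) + 4 * L * \<epsilon>)"
        using L unfolding bS[symmetric] by simp
      finally show "integral {\<beta> i..\<beta> (Suc i)} u \<le> L / n * (ln (f (X (\<beta> i)) - \<epsilon>) + 4 * L * \<epsilon>)" .
    qed
    also have "\<dots> = L * ((\<Sum>i<n. ln (f (X (\<beta> i)) - \<epsilon>)) / n + 4 * L * \<epsilon>)"
    proof -
      have "(\<Sum>i<n. L / n * (ln (f (X (\<beta> i)) - \<epsilon>) + 4 * L * \<epsilon>)) = L / n * ((\<Sum>i<n. ln (f (X (\<beta> i)) - \<epsilon>)) + n * (4 * L * \<epsilon>))"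
        by (subst sum_distrib_left[symmetric]) (simp add: sum.distrib)
      thus ?thesis using n by (simp add: field_simps)
    qed
    finally have "(\<integral>x. ln (f x) \<partial>law L \<rho>) \<le> (\<Sum>i<n. ln (f (X (\<beta> i)) - \<epsilon>)) / n + 4 * L * \<epsilon>"
      unfolding int using L by (simp add: divide_le_eq mult.commute)
    thus "(\<forall>i<n. \<forall>t\<in>{X (real i * L / n)..X (real i * L / n + L / n)}. \<bar>f t - f (X (real i * L / n))\<bar> \<le> \<epsilon>)
      \<and> (\<integral>x. ln (f x) \<partial>law L \<rho>) \<le> (\<Sum>i<n. ln (f (X (real i * L / n)) - \<epsilon>)) / n + 4 * L * \<epsilon>"
      using osc' unfolding bS[symmetric] unfolding \<beta>_def by blast
  qed
qed

end

section \<open>The upper bound and Gamma-convergence\<close>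

text \<open>
  On each block \<open>G i\<close> is determined by a lower bound \<open>p i\<close> for \<open>r0\<close>, and the image length \<open>Jl i\<close> is compared with a
  lower bound \<open>s i\<close> for the continuous approximation \<open>rt\<close> of \<open>r1\<close>. Since \<open>s i * Jl i\<close> is at most the integral of
  \<open>rt\<close> over the image, \<open>ln x \<le> x - 1\<close> and summation over the blocks leave \<open>integral {0..L} rt - 1\<close>,
  which is small.
\<close>

lemma gap_limsup:
  assumes n0: "near_uniform L \<delta> r0" and c0: "continuous_on UNIV r0" and n1: "near_uniform L \<delta> r1" and e: "\<epsilon> > 0"
  shows "eventually (\<lambda>h. gap L h r1 r0 \<le> ereal ((\<integral>x. ln (r1 x) \<partial>law L r1) / 2 - (\<integral>x. ln (r0 x) \<partial>law L r0) / 2 + \<epsilon>)) (at_right 0)"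
proof -
  interpret a: near_uniform L \<delta> r0 by fact
  interpret b: near_uniform L \<delta> r1 by fact
  interpret two_densities L \<delta> r0 r1 ..
  define \<eta> where "\<eta> = \<epsilon> / 6"
  have eta: "\<eta> > 0" using e by (simp add: \<eta>_def)
  obtain rt where rc: "continuous_on UNIV rt" and rb: "\<And>x. \<bar>rt x - 1 / L\<bar> \<le> \<delta>"
    and r1: "\<bar>(\<integral>x. ln (rt x) \<partial>law L r1) - (\<integral>x. ln (r1 x) \<partial>law L r1)\<bar> < \<eta>" and r2: "\<bar>integral {0..L} rt - 1\<bar> < \<eta>"
    using b.continuous_approximation[OF eta] by blast
  note rlo = a.near_bounds(1)[OF rb]
  define \<epsilon>' where "\<epsilon>' = min (1 / (4 * L)) (\<eta> / (4 * L))"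
  have e': "0 < \<epsilon>'" "\<epsilon>' \<le> 1 / (4 * L)" "4 * L * \<epsilon>' \<le> \<eta>"
  proof -
    show "0 < \<epsilon>'" "\<epsilon>' \<le> 1 / (4 * L)" using a.L eta by (auto simp: \<epsilon>'_def)
    have "\<epsilon>' \<le> \<eta> / (4 * L)" by (simp add: \<epsilon>'_def)
    thus "4 * L * \<epsilon>' \<le> \<eta>" using a.L by (simp add: field_simps)
  qed
  obtain N0 :: nat where N0: "\<And>n. n > N0 \<Longrightarrow> (\<forall>i<n. \<forall>t\<in>{a.X (real i * L / n)..a.X (real i * L / n + L / n)}. \<bar>r0 t - r0 (a.X (real i * L / n))\<bar> \<le> \<epsilon>')
    \<and> (\<integral>x. ln (r0 x) \<partial>law L r0) \<le> (\<Sum>i<n. ln (r0 (a.X (real i * L / n)) - \<epsilon>')) / n + 4 * L * \<epsilon>'"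
    using a.riemann_log[OF c0 a.bounds(1) e'(1,2)] by blast
  obtain N1 :: nat where N1: "\<And>n. n > N1 \<Longrightarrow> (\<forall>i<n. \<forall>t\<in>{b.X (real i * L / n)..b.X (real i * L / n + L / n)}. \<bar>rt t - rt (b.X (real i * L / n))\<bar> \<le> \<epsilon>')
    \<and> (\<integral>x. ln (rt x) \<partial>law L r1) \<le> (\<Sum>i<n. ln (rt (b.X (real i * L / n)) - \<epsilon>')) / n + 4 * L * \<epsilon>'"
    using b.riemann_log[OF rc rlo e'(1,2)] by blast
  define n where "n = Suc (max N0 N1)"
  have n: "n > 0" "n > N0" "n > N1" by (auto simp: n_def)
  obtain R where R: "R > 0" "ln (sqrt (4 * pi) / zeta R) \<le> \<eta>" using zeta_close[OF eta] by blast
  define l where "l = L / n"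
  have l: "l > 0" using a.L n by (simp add: l_def)
  define \<beta> where "\<beta> i = i * L / n" for i :: nat
  have bS: "\<beta> i + l = \<beta> (Suc i)" for i by (simp add: \<beta>_def l_def add_divide_distrib distrib_right add.commute)
  have b_in: "\<beta> i \<in> {0..L}" if "i \<le> n" for i using that a.L n by (auto simp: \<beta>_def field_simps)
  define p where "p i = r0 (a.X (\<beta> i)) - \<epsilon>'" for i
  define s where "s i = rt (b.X (\<beta> i)) - \<epsilon>'" for i
  have "1 / (4 * L) < 99 / (100 * L)" using a.L by (simp add: field_simps)
  hence pos: "p i > 0" "s i > 0" for i
    using a.bounds(1)[of "a.X (\<beta> i)"] rlo[of "b.X (\<beta> i)"] e'(2) unfolding p_def s_def by linarith+
  have osc0: "p i \<le> r0 t" if "i < n" "t \<in> {a.X (\<beta> i)..a.X (\<beta> i + l)}" for i t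
  proof -
    have "\<bar>r0 t - r0 (a.X (real i * L / n))\<bar> \<le> \<epsilon>'"
      using N0[OF n(2)] that unfolding \<beta>_def l_def by blast
    thus ?thesis unfolding p_def \<beta>_def abs_le_iff by linarith
  qed
  have S0: "(\<integral>x. ln (r0 x) \<partial>law L r0) \<le> (\<Sum>i<n. ln (p i)) / n + \<eta>"
    using conjunct2[OF N0[OF n(2)]] e'(3) unfolding p_def \<beta>_def by linarith
  have osc1: "s i \<le> rt t" if "i < n" "t \<in> {b.X (\<beta> i)..b.X (\<beta> i + l)}" for i t
  proof -
    have "\<bar>rt t - rt (b.X (real i * L / n))\<bar> \<le> \<epsilon>'"
      using N1[OF n(3)] that unfolding \<beta>_def l_def by blast
    thus ?thesis unfolding s_def \<beta>_def abs_le_iff by linarith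
  qed
  have S1: "(\<integral>x. ln (rt x) \<partial>law L r1) \<le> (\<Sum>i<n. ln (s i)) / n + \<eta>"
    using conjunct2[OF N1[OF n(3)]] e'(3) unfolding s_def \<beta>_def by linarith
  define G where "G i = 1 / (L * p i)" for i
  have G: "G i > 0" for i using pos a.L by (simp add: G_def)
  define Jl where "Jl i = b.X (\<beta> i + l) - b.X (\<beta> i)" for i
  have Jl: "Jl i > 0" for i using l b.X_slope(1)[of "\<beta> i" "\<beta> i + l"] by (simp add: Jl_def)
  define v where "v i = l / (G i * Jl i)" for i
  have v: "v i > 0" for i using l G[of i] Jl[of i] by (simp add: v_def)
  have lip: "\<bar>a.X q - a.X t\<bar> \<le> G i * \<bar>q - t\<bar>" if i: "i < n" and q: "q \<in> {\<beta> i..\<beta> i + l}" and t: "t \<in> {\<beta> i..\<beta> i + l}" for i q t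
  proof -
    have main: "a.X y - a.X x \<le> G i * (y - x)" if xy: "x \<le> y" "x \<in> {\<beta> i..\<beta> i + l}" "y \<in> {\<beta> i..\<beta> i + l}" for x y
    proof -
      have "L * p i * (a.X y - a.X x) \<le> a.F (a.X y) - a.F (a.X x)"
      proof (rule a.F_lower)
        show "a.X x \<le> a.X y" using xy by (simp add: a.X_le_iff)
        fix u assume u: "u \<in> {a.X x..a.X y}"
        have "a.X (\<beta> i) \<le> a.X x" "a.X y \<le> a.X (\<beta> i + l)" using xy by (simp_all add: a.X_le_iff)
        hence "u \<in> {a.X (\<beta> i)..a.X (\<beta> i + l)}" using u by auto
        thus "L * p i \<le> L * r0 u" using osc0[OF i] a.L by simp
      next
        have "0 \<le> x" "y \<le> L" using xy b_in[of i] b_in[of "Suc i"] i bS[of i] by auto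
        hence "0 \<le> a.X x" "a.X y \<le> L" using a.X_le_iff[of 0 x] a.X_le_iff[of y L] by simp_all
        thus "L * p i \<le> 1 \<or> 0 \<le> a.X x \<and> a.X y \<le> L" by simp
      qed
      thus ?thesis using pos[of i] a.L by (simp add: G_def field_simps)
    qed
    show ?thesis using main[of q t] main[of t q] q t a.X_le_iff[of q t] a.X_le_iff[of t q]
      by (cases "q \<le> t") (auto simp: abs_if)
  qed
  define al where "al i = L * sqrt (4 * pi) / (sqrt (v i) * zeta R)" for i
  define K where "K i = 2 * (R * sqrt (v i)) * (R\<^sup>2 / 4 + ln 3 + R\<^sup>2 * v i)" for i
  have sum_al: "(\<Sum>i<n. ln (al i)) / n \<le> - (\<integral>x. ln (r0 x) \<partial>law L r0) / 2 - (\<integral>x. ln (r1 x) \<partial>law L r1) / 2 + 3 * \<eta>"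
  proof -
    have z: "zeta R > 0" by (rule zeta_pos[OF R(1)])
    have "ln (al i) \<le> \<eta> + (n * integral {b.X (\<beta> i)..b.X (\<beta> (Suc i))} rt - 1 - ln (p i) - ln (s i)) / 2"
      if i: "i < n" for i
    proof -
      have "al i = L * (sqrt (4 * pi) / zeta R) / sqrt (v i)" by (simp add: al_def)
      hence "ln (al i) = ln L + ln (sqrt (4 * pi) / zeta R) - ln (v i) / 2"
        using a.L z v[of i] by (simp add: ln_mult ln_div ln_sqrt)
      moreover have "ln (v i) = 2 * ln L + ln (p i) + ln (s i) - ln (n * Jl i * s i)"
      proof -
        have vi: "v i = L * L * p i * s i / (n * Jl i * s i)"
          unfolding v_def G_def l_def using pos[of i] a.L Jl[of i] n by (simp add: field_simps)
        have "0 < L * L * p i * s i" "0 < n * Jl i * s i" using pos[of i] a.L Jl[of i] n by simp_all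
        hence "ln (v i) = ln (L * L * p i * s i) - ln (n * Jl i * s i)"
          unfolding vi by (subst ln_div) auto
        also have "ln (L * L * p i * s i) = 2 * ln L + ln (p i) + ln (s i)"
          using pos[of i] a.L by (simp add: ln_mult)
        finally show ?thesis by simp
      qed
      moreover have "ln (n * Jl i * s i) \<le> n * integral {b.X (\<beta> i)..b.X (\<beta> (Suc i))} rt - 1"
      proof -
        have "s i * (b.X (\<beta> (Suc i)) - b.X (\<beta> i)) \<le> integral {b.X (\<beta> i)..b.X (\<beta> (Suc i))} rt"
          by (rule integral_const_lower[OF rc]) (use osc1[OF i] Jl[of i] in \<open>auto simp: Jl_def bS\<close>)
        hence "s i * Jl i \<le> integral {b.X (\<beta> i)..b.X (\<beta> (Suc i))} rt" by (simp add: Jl_def bS)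
        hence "n * (s i * Jl i) \<le> n * integral {b.X (\<beta> i)..b.X (\<beta> (Suc i))} rt" by (rule mult_left_mono) simp
        moreover have "ln (n * Jl i * s i) \<le> n * Jl i * s i - 1" using pos[of i] Jl[of i] n by (intro ln_le_minus_one) auto
        ultimately show ?thesis by (simp add: mult_ac)
      qed
      ultimately show ?thesis using R(2) by (simp add: field_simps)
    qed
    hence "(\<Sum>i<n. ln (al i)) \<le> (\<Sum>i<n. \<eta> + (n * integral {b.X (\<beta> i)..b.X (\<beta> (Suc i))} rt - 1 - ln (p i) - ln (s i)) / 2)"
      by (intro sum_mono) auto
    also have "\<dots> = n * \<eta> + (n * (\<Sum>i<n. integral {b.X (\<beta> i)..b.X (\<beta> (Suc i))} rt) - n - (\<Sum>i<n. ln (p i)) - (\<Sum>i<n. ln (s i))) / 2"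
      by (simp add: sum.distrib sum_subtractf sum_divide_distrib[symmetric] sum_distrib_left[symmetric])
    also have "(\<Sum>i<n. integral {b.X (\<beta> i)..b.X (\<beta> (Suc i))} rt) = integral {0..L} rt"
    proof -
      have "b.X (\<beta> i) \<le> b.X (\<beta> (Suc i))" for i unfolding bS[symmetric] b.X_le_iff using l by simp
      moreover have "\<beta> 0 = 0" "\<beta> n = L" using n by (simp_all add: \<beta>_def)
      ultimately show ?thesis using sum_integral_partition[OF rc, of "\<lambda>i. b.X (\<beta> i)" n] by simp
    qed
    finally have "(\<Sum>i<n. ln (al i)) / n \<le> (n * \<eta> + (n * integral {0..L} rt - n - (\<Sum>i<n. ln (p i)) - (\<Sum>i<n. ln (s i))) / 2) / n"
      by (rule divide_right_mono) simp
    also have "\<dots> = \<eta> + (integral {0..L} rt - 1 - (\<Sum>i<n. ln (p i)) / n - (\<Sum>i<n. ln (s i)) / n) / 2"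
      using n by (simp add: field_simps)
    also have "\<dots> \<le> \<eta> + (\<eta> - ((\<integral>x. ln (r0 x) \<partial>law L r0) - \<eta>) - ((\<integral>x. ln (r1 x) \<partial>law L r1) - 2 * \<eta>)) / 2"
      using S0 S1 r1 r2 unfolding abs_less_iff by (intro add_left_mono divide_right_mono) linarith+
    finally show ?thesis by (simp add: field_simps)
  qed
  define C where "C = (\<Sum>i<n. K i) / L"
  define B where "B = (\<Sum>i<n. 2 * (R * sqrt (v i)))"
  have sq0: "((\<lambda>h. sqrt h * c) \<longlongrightarrow> 0) (at_right 0)" for c :: real
    by (rule tendsto_eq_intros | simp)+
  have ev1: "eventually (\<lambda>h. sqrt h * C < \<eta>) (at_right 0)" by (rule order_tendstoD(2)[OF sq0 eta])
  have ev2: "eventually (\<lambda>h. sqrt h * B < l) (at_right 0)" by (rule order_tendstoD(2)[OF sq0 l])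
  show ?thesis
    using ev1 ev2 eventually_at_right_less[of 0]
  proof eventually_elim
    case (elim h)
    hence h: "h > 0" by simp
    have small: "2 * (R * sqrt (h * v i)) \<le> l" if i: "i < n" for i
    proof -
      have "2 * (R * sqrt (v i)) \<le> B"
        unfolding B_def using R(1) v i by (intro member_le_sum) (auto intro: less_imp_le)
      hence "sqrt h * (2 * (R * sqrt (v i))) \<le> sqrt h * B" using h by (intro mult_left_mono) auto
      thus ?thesis using elim(2) by (simp add: real_sqrt_mult mult_ac)
    qed
    have "gap L h r1 r0 \<le> ereal ((\<integral>y. ln (r1 y) \<partial>law L r1)
     + (\<Sum>i<n. L / n * ln (L * sqrt (4 * pi) / (sqrt (v i) * zeta R)) + 2 * (R * sqrt (h * v i)) * (R\<^sup>2 / 4 + ln 3 + R\<^sup>2 * v i)) / L)"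
    proof (rule gap_le_blocks[OF h n(1) R(1) G])
      show "\<bar>a.X q - a.X t\<bar> \<le> G i * \<bar>q - t\<bar>"
        if "i < n" "q \<in> {real i * L / n..real i * L / n + L / n}" "t \<in> {real i * L / n..real i * L / n + L / n}" for i q t
        using lip[OF that(1), of q t] that(2,3) unfolding \<beta>_def l_def by blast
      show "v i = (L / n) / (G i * (b.X (real i * L / n + L / n) - b.X (real i * L / n)))" for i
        unfolding v_def l_def Jl_def \<beta>_def ..
      show "2 * (R * sqrt (h * v i)) \<le> L / n" if "i < n" for i
        using small[OF that] unfolding l_def .
    qed
    also have "(\<Sum>i<n. L / n * ln (L * sqrt (4 * pi) / (sqrt (v i) * zeta R)) + 2 * (R * sqrt (h * v i)) * (R\<^sup>2 / 4 + ln 3 + R\<^sup>2 * v i)) / L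
      = (\<Sum>i<n. ln (al i)) / n + sqrt h * C"
    proof -
      have "2 * (R * sqrt (h * v i)) * (R\<^sup>2 / 4 + ln 3 + R\<^sup>2 * v i) = sqrt h * K i" for i
        by (simp add: K_def real_sqrt_mult)
      hence "(\<Sum>i<n. L / n * ln (L * sqrt (4 * pi) / (sqrt (v i) * zeta R)) + 2 * (R * sqrt (h * v i)) * (R\<^sup>2 / 4 + ln 3 + R\<^sup>2 * v i))
        = (\<Sum>i<n. L / n * ln (al i)) + (\<Sum>i<n. sqrt h * K i)"
        by (simp only: al_def sum.distrib)
      also have "\<dots> = L / n * (\<Sum>i<n. ln (al i)) + sqrt h * (\<Sum>i<n. K i)" by (simp only: sum_distrib_left)
      finally show ?thesis using a.L by (simp add: C_def add_divide_distrib)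
    qed
    also have "ereal ((\<integral>y. ln (r1 y) \<partial>law L r1) + ((\<Sum>i<n. ln (al i)) / n + sqrt h * C))
       \<le> ereal ((\<integral>x. ln (r1 x) \<partial>law L r1) / 2 - (\<integral>x. ln (r0 x) \<partial>law L r0) / 2 + \<epsilon>)"
      using sum_al elim(1) eta unfolding \<eta>_def ereal_less_eq by argo
    finally show ?case .
  qed
qed

theorem theorem3:
  fixes L :: real
  assumes "L > 0"
  shows "\<exists>\<delta>. 0 < \<delta> \<and> \<delta> < 1 \<and>
    (\<forall>\<rho>0 \<in> A L \<delta>. continuous_on {0..L} \<rho>0 \<longrightarrow>
      (\<forall>\<rho> \<in> A L \<delta>. \<forall>\<rho>h :: real \<Rightarrow> real \<Rightarrow> real.
          (\<forall>h>0. \<rho>h h \<in> A L \<delta>) \<and>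
          narrow_conv (\<lambda>h. meas L (\<rho>h h)) (meas L \<rho>) (at_right 0) \<longrightarrow>
          Liminf (at_right 0) (\<lambda>h. scaled_gap L h (\<rho>h h) \<rho>0)
            \<ge> ereal (entropy_fun (zero_ext L \<rho>) / 2 - entropy_fun (zero_ext L \<rho>0) / 2)) \<and>
      (\<forall>\<rho> \<in> A L \<delta>. \<exists>\<rho>h :: real \<Rightarrow> real \<Rightarrow> real.
          (\<forall>h>0. \<rho>h h \<in> A L \<delta>) \<and>
          narrow_conv (\<lambda>h. meas L (\<rho>h h)) (meas L \<rho>) (at_right 0) \<and>
          ((\<lambda>h. scaled_gap L h (\<rho>h h) \<rho>0) \<longlongrightarrow>
             ereal (entropy_fun (zero_ext L \<rho>) / 2 - entropy_fun (zero_ext L \<rho>0) / 2)) (at_right 0)))"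
proof -
  \<comment> \<open>at most one per cent of \<open>1 / L\<close>: the slopes of all transport maps lie between \<open>99/101\<close> and \<open>101/99\<close>\<close>
  define \<delta> where "\<delta> = min (1/2) (1 / (100 * L))"
  have d: "0 < \<delta>" "\<delta> < 1" "\<delta> * L \<le> 1/100"
  proof -
    show "0 < \<delta>" "\<delta> < 1" using assms by (auto simp: \<delta>_def)
    have "\<delta> \<le> 1 / (100 * L)" by (simp add: \<delta>_def)
    thus "\<delta> * L \<le> 1/100" using assms by (simp add: field_simps)
  qed
  note clean = A_near_uniform[OF assms d(1,3)]
  have lower: "eventually (\<lambda>h. ereal (entropy_fun (zero_ext L \<rho>) / 2 - entropy_fun (zero_ext L \<rho>0) / 2 - \<epsilon>) \<le> scaled_gap L h (\<rho>h h) \<rho>0) (at_right 0)"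
    if r0: "\<rho>0 \<in> A L \<delta>" "continuous_on {0..L} \<rho>0" and r: "\<rho> \<in> A L \<delta>" and rh: "\<And>h. h > 0 \<Longrightarrow> \<rho>h h \<in> A L \<delta>"
      and conv: "narrow_conv (\<lambda>h. meas L (\<rho>h h)) (meas L \<rho>) (at_right 0)" and e: "\<epsilon> > 0" for \<rho>0 \<rho> \<rho>h \<epsilon>
  proof -
    obtain s0 where s0: "near_uniform L \<delta> s0" "meas L \<rho>0 = law L s0" "entropy_fun (zero_ext L \<rho>0) = (\<integral>x. ln (s0 x) \<partial>law L s0)" "continuous_on UNIV s0"
      using clean[OF r0(1)] r0(2) by blast
    obtain s where s: "near_uniform L \<delta> s" "meas L \<rho> = law L s" "entropy_fun (zero_ext L \<rho>) = (\<integral>x. ln (s x) \<partial>law L s)"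
      using clean[OF r] by blast
    have "\<forall>h. \<exists>sh. h > 0 \<longrightarrow> near_uniform L \<delta> sh \<and> meas L (\<rho>h h) = law L sh"
      using clean[OF rh] by blast
    then obtain sh where sh: "\<And>h. h > 0 \<Longrightarrow> near_uniform L \<delta> (sh h)" "\<And>h. h > 0 \<Longrightarrow> meas L (\<rho>h h) = law L (sh h)"
      by metis
    have pos: "eventually (\<lambda>h. h > 0) (at_right (0::real))" by (rule eventually_at_right_less)
    have conv': "narrow_conv (\<lambda>h. law L (sh h)) (law L s) (at_right 0)"
      unfolding narrow_conv_def
    proof (intro allI impI)
      fix f :: "real \<Rightarrow> real" assume f: "continuous_on UNIV f \<and> bounded (range f)"
      have "((\<lambda>h. \<integral>x. f x \<partial>meas L (\<rho>h h)) \<longlongrightarrow> (\<integral>x. f x \<partial>law L s)) (at_right 0)"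
        using conv f unfolding narrow_conv_def s(2) by blast
      moreover have "eventually (\<lambda>h. (\<integral>x. f x \<partial>meas L (\<rho>h h)) = (\<integral>x. f x \<partial>law L (sh h))) (at_right 0)"
        using pos by eventually_elim (simp add: sh(2))
      ultimately show "((\<lambda>h. \<integral>x. f x \<partial>law L (sh h)) \<longlongrightarrow> (\<integral>x. f x \<partial>law L s)) (at_right 0)"
        by (rule Lim_transform_eventually)
    qed
    have "eventually (\<lambda>h. ereal ((\<integral>x. ln (s x) \<partial>law L s) / 2 - (\<integral>x. ln (s0 x) \<partial>law L s0) / 2 - \<epsilon>) \<le> gap L h (sh h) s0) (at_right 0)"
      by (rule gap_liminf[OF s0(1,4) s(1) _ conv' e]) (rule sh(1))
    with pos show ?thesis
      by eventually_elim (simp add: gap_def scaled_gap_def s0 s sh(2))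
  qed
  have upper: "eventually (\<lambda>h. scaled_gap L h \<rho> \<rho>0 \<le> ereal (entropy_fun (zero_ext L \<rho>) / 2 - entropy_fun (zero_ext L \<rho>0) / 2 + \<epsilon>)) (at_right 0)"
    if r0: "\<rho>0 \<in> A L \<delta>" "continuous_on {0..L} \<rho>0" and r: "\<rho> \<in> A L \<delta>" and e: "\<epsilon> > 0" for \<rho>0 \<rho> \<epsilon>
  proof -
    obtain s0 where s0: "near_uniform L \<delta> s0" "meas L \<rho>0 = law L s0" "entropy_fun (zero_ext L \<rho>0) = (\<integral>x. ln (s0 x) \<partial>law L s0)" "continuous_on UNIV s0"
      using clean[OF r0(1)] r0(2) by blast
    obtain s where s: "near_uniform L \<delta> s" "meas L \<rho> = law L s" "entropy_fun (zero_ext L \<rho>) = (\<integral>x. ln (s x) \<partial>law L s)"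
      using clean[OF r] by blast
    from gap_limsup[OF s0(1,4) s(1) e] show ?thesis
      by eventually_elim (simp add: gap_def scaled_gap_def s0 s)
  qed
  have ereal_less: "\<exists>\<epsilon>>0. a < ereal (x - \<epsilon>)" if "a < ereal x" for a x
  proof (cases a)
    case (real y)
    thus ?thesis using that by (intro exI[of _ "(x - y) / 2"]) (auto simp: field_simps)
  next
    case MInf
    thus ?thesis by (intro exI[of _ 1]) auto
  qed (use that in auto)
  have ereal_greater: "\<exists>\<epsilon>>0. ereal (x + \<epsilon>) < a" if "ereal x < a" for a x
  proof (cases a)
    case (real y)
    thus ?thesis using that by (intro exI[of _ "(y - x) / 2"]) (auto simp: field_simps)
  next
    case PInf
    thus ?thesis by (intro exI[of _ 1]) auto
  qed (use that in auto)
  show ?thesis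
  proof (intro exI[of _ \<delta>] conjI ballI allI impI d(1,2))
    fix \<rho>0 \<rho> and \<rho>h :: "real \<Rightarrow> real \<Rightarrow> real"
    assume r0: "\<rho>0 \<in> A L \<delta>" "continuous_on {0..L} \<rho>0" and r: "\<rho> \<in> A L \<delta>"
      and rh: "(\<forall>h>0. \<rho>h h \<in> A L \<delta>) \<and> narrow_conv (\<lambda>h. meas L (\<rho>h h)) (meas L \<rho>) (at_right 0)"
    show "Liminf (at_right 0) (\<lambda>h. scaled_gap L h (\<rho>h h) \<rho>0) \<ge> ereal (entropy_fun (zero_ext L \<rho>) / 2 - entropy_fun (zero_ext L \<rho>0) / 2)"
      unfolding le_Liminf_iff
    proof (intro allI impI)
      fix y assume "y < ereal (entropy_fun (zero_ext L \<rho>) / 2 - entropy_fun (zero_ext L \<rho>0) / 2)"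
      then obtain \<epsilon> where e: "\<epsilon> > 0" "y < ereal (entropy_fun (zero_ext L \<rho>) / 2 - entropy_fun (zero_ext L \<rho>0) / 2 - \<epsilon>)"
        using ereal_less by blast
      have "eventually (\<lambda>h. ereal (entropy_fun (zero_ext L \<rho>) / 2 - entropy_fun (zero_ext L \<rho>0) / 2 - \<epsilon>) \<le> scaled_gap L h (\<rho>h h) \<rho>0) (at_right 0)"
        using lower[OF r0 r _ _ e(1), of \<rho>h] rh by blast
      thus "eventually (\<lambda>h. y < scaled_gap L h (\<rho>h h) \<rho>0) (at_right 0)"
        by eventually_elim (rule less_le_trans[OF e(2)])
    qed
  next
    fix \<rho>0 \<rho>
    assume r0: "\<rho>0 \<in> A L \<delta>" "continuous_on {0..L} \<rho>0" and r: "\<rho> \<in> A L \<delta>"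
    let ?E = "ereal (entropy_fun (zero_ext L \<rho>) / 2 - entropy_fun (zero_ext L \<rho>0) / 2)"
    have nc: "narrow_conv (\<lambda>h. meas L \<rho>) (meas L \<rho>) (at_right 0)" by (simp add: narrow_conv_def)
    have "((\<lambda>h. scaled_gap L h \<rho> \<rho>0) \<longlongrightarrow> ?E) (at_right 0)"
    proof (rule order_tendstoI)
      fix y assume "y < ?E"
      then obtain \<epsilon> where e: "\<epsilon> > 0" "y < ereal (entropy_fun (zero_ext L \<rho>) / 2 - entropy_fun (zero_ext L \<rho>0) / 2 - \<epsilon>)"
        using ereal_less by blast
      from lower[OF r0 r r nc e(1)] show "eventually (\<lambda>h. y < scaled_gap L h \<rho> \<rho>0) (at_right 0)"
        by eventually_elim (rule less_le_trans[OF e(2)])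
    next
      fix y assume "?E < y"
      then obtain \<epsilon> where e: "\<epsilon> > 0" "ereal (entropy_fun (zero_ext L \<rho>) / 2 - entropy_fun (zero_ext L \<rho>0) / 2 + \<epsilon>) < y"
        using ereal_greater by blast
      from upper[OF r0 r e(1)] show "eventually (\<lambda>h. scaled_gap L h \<rho> \<rho>0 < y) (at_right 0)"
        by eventually_elim (rule le_less_trans[OF _ e(2)])
    qed
    with nc r show "\<exists>\<rho>h :: real \<Rightarrow> real \<Rightarrow> real. (\<forall>h>0. \<rho>h h \<in> A L \<delta>) \<and>
          narrow_conv (\<lambda>h. meas L (\<rho>h h)) (meas L \<rho>) (at_right 0) \<and>
          ((\<lambda>h. scaled_gap L h (\<rho>h h) \<rho>0) \<longlongrightarrow> ?E) (at_right 0)"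
      by (intro exI[of _ "\<lambda>_. \<rho>"]) simp
  qed
qed

end
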